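(* For any $c \geq 0$ and $d > 0$ with $c^2 + d^2 \leq 1$ we have $$\min\left\{\lambda_2(\mathsf{L}_{c,d}\oplus \mathsf{M}_{c,d}),\ \frac{(2j_{0,1}+\pi)^2}{(1+c)^2+d^2}\right\}\le\frac{9\pi^2}{(1+\sqrt{c^2+d^2})^2},$$ and, in particular, $$|\partial\Omega_{c,d}|^2\,\mu_3(\Omega_{c,d}) \le 36\pi^2.$$ Both inequalities are strict if $(c,d)\ne (0,\tfrac12)$.
   Context: For $c\ge 0$, $d>0$, $\Omega_{c,d}\subset\mathbb{R}^2$ denotes the open parallelogram spanned by the vectors $(1,0)^\top$ and $(c,d)^\top$, i.e. with vertices $(0,0)$, $(c,d)$, $(c+1,d)$, $(1,0)$; $|\partial\Omega_{c,d}| = 2(1+\sqrt{c^2+d^2})$ is its perimeter. $0=\mu_1(\Omega_{c,d})<\mu_2(\Omega_{c,d})\le\mu_3(\Omega_{c,d})\le\dots$ are the eigenvalues, counted with multiplicities, of the Neumann Laplacian on $\Omega_{c,d}$, i.e. of the self-adjoint operator in $L^2(\Omega_{c,d})$ associated with the closed quadratic form $u\mapsto\int_{\Omega_{c,d}}|\nabla u|^2\,dx\,dy$ with domain $H^1(\Omega_{c,d})$. The matrices are $$\mathsf{L}_{c,d} := \begin{pmatrix} \pi^2\left(1+\frac{c^2}{d^2}\right) & -\frac{8c}{d^2}\\ -\frac{8c}{d^2} & \frac{\pi^2}{d^2}\end{pmatrix},\qquad \mathsf{M}_{c,d} := \begin{pmatrix} \pi^2\left(1+\frac{c^2}{d^2}\right)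 +\frac{\pi^2}{d^2} & -\frac{32\sqrt{2}\,c}{3d^2}\\ -\frac{32\sqrt{2}\,c}{3d^2} & 4\pi^2\left(1+\frac{c^2}{d^2}\right)\end{pmatrix}.$$ $\mathsf{L}_{c,d}\oplus\mathsf{M}_{c,d}$ is the $4\times4$ block-diagonal matrix with these blocks. For a Hermitian matrix $\mathsf{N}$, $\lambda_1(\mathsf{N})\le\lambda_2(\mathsf{N})\le\dots$ are its eigenvalues with multiplicities taken into account. $j_{0,1}\approx 2.4048$ is the first positive zero of the Bessel function $J_0$. *)

theory Defs
  imports "HOL-Analysis.Analysis" "HOL-Library.Extended_Nat"
begin

primrec C_k :: "nat \<Rightarrow> ('a::euclidean_space \<Rightarrow> real) \<Rightarrow> bool" where
  "C_k 0 \<phi> \<longleftrightarrow> continuous_on UNIV \<phi>"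
| "C_k (Suc k) \<phi> \<longleftrightarrow> (\<forall>x. \<phi> differentiable (at x)) \<and>
     (\<forall>b\<in>Basis. C_k k (\<lambda>x. frechet_derivative \<phi> (at x) b))"

definition test_functions :: "'a::euclidean_space set \<Rightarrow> ('a \<Rightarrow> real) set" where
  "test_functions S = {\<phi>. (\<forall>k. C_k k \<phi>) \<and>
     compact (closure {x. \<phi> x \<noteq> 0}) \<and> closure {x. \<phi> x \<noteq> 0} \<subseteq> S}"

text \<open>Functions are not identified up to null sets here; the quotient is taken only when
  dimensions of function spaces are computed, see \<open>L2_independent\<close>.\<close>

definition L2 :: "'a::euclidean_space set \<Rightarrow> ('a \<Rightarrow> 'b::euclidean_space) set" where
  "L2 S = {u. u \<in> borel_measurable (lebesgue_on S) \<and>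
     integrable (lebesgue_on S) (\<lambda>x. (norm (u x))\<^sup>2)}"

definition weak_gradient ::
    "'a::euclidean_space set \<Rightarrow> ('a \<Rightarrow> real) \<Rightarrow> ('a \<Rightarrow> 'a) \<Rightarrow> bool" where
  "weak_gradient S u g \<longleftrightarrow> (\<forall>\<phi>\<in>test_functions S. \<forall>b\<in>Basis.
     (LINT x|lebesgue_on S. u x * frechet_derivative \<phi> (at x) b)
       = - (LINT x|lebesgue_on S. (g x \<bullet> b) * \<phi> x))"

text \<open>\<open>H1 S u g\<close>: the function \<open>u\<close> lies in \<open>H\<^sup>1(S)\<close> and \<open>g\<close> is (a representative of)
  its gradient.\<close>

definition H1 :: "'a::euclidean_space set \<Rightarrow> ('a \<Rightarrow> real) \<Rightarrow> ('a \<Rightarrow> 'a) \<Rightarrow> bool" where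
  "H1 S u g \<longleftrightarrow> u \<in> L2 S \<and> g \<in> L2 S \<and> weak_gradient S u g"

text \<open>The graph of the operator in \<open>L\<^sup>2(S)\<close> associated with the form
  \<open>u \<mapsto> \<integral>\<bar>\<nabla>u\<bar>\<^sup>2\<close> on \<open>H\<^sup>1(S)\<close>: \<open>u\<close> is in the domain with image \<open>f\<close> iff the polarized form
  satisfies \<open>\<integral>\<nabla>u\<cdot>\<nabla>v = \<integral>f v\<close> for all \<open>v \<in> H\<^sup>1(S)\<close>. The scalars are real; since the operator
  commutes with complex conjugation, its eigenvalues and their multiplicities are those of
  the operator in the complex space.\<close>

definition neumann_laplacian ::
    "'a::euclidean_space set \<Rightarrow> ('a \<Rightarrow> real) \<Rightarrow> ('a \<Rightarrow> real) \<Rightarrow> bool" where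
  "neumann_laplacian S u f \<longleftrightarrow> f \<in> L2 S \<and>
     (\<exists>g. H1 S u g \<and> (\<forall>v h. H1 S v h \<longrightarrow>
        (LINT x|lebesgue_on S. g x \<bullet> h x) = (LINT x|lebesgue_on S. f x * v x)))"

definition L2_independent ::
    "'a::euclidean_space set \<Rightarrow> nat \<Rightarrow> (nat \<Rightarrow> 'a \<Rightarrow> real) \<Rightarrow> bool" where
  "L2_independent S n u \<longleftrightarrow> (\<forall>a :: nat \<Rightarrow> real.
     (AE x in lebesgue_on S. (\<Sum>i<n. a i * u i x) = 0) \<longrightarrow> (\<forall>i<n. a i = 0))"

text \<open>The dimension of the eigenspace for \<open>t\<close>, as a subspace of \<open>L\<^sup>2(S)\<close>; it is \<open>0\<close> if
  \<open>t\<close> is not an eigenvalue.\<close>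

definition neumann_multiplicity :: "'a::euclidean_space set \<Rightarrow> real \<Rightarrow> enat" where
  "neumann_multiplicity S t = Sup {enat n | n.
     \<exists>u. (\<forall>i<n. neumann_laplacian S (u i) (\<lambda>x. t * u i x)) \<and> L2_independent S n u}"

text \<open>Given the multiplicities \<open>m\<close> of the eigenvalues, the \<open>k\<close>-th eigenvalue (\<open>k \<ge> 1\<close>) in
  nondecreasing order is the smallest \<open>t\<close> such that at least \<open>k\<close> eigenvalues, counted with
  multiplicities, are at most \<open>t\<close>. The finite sets \<open>F\<close> make the count meaningful even if
  there are infinitely many eigenvalues below \<open>t\<close>.\<close>

definition kth_eigenvalue :: "(real \<Rightarrow> enat) \<Rightarrow> nat \<Rightarrow> real" where
  "kth_eigenvalue m k = Inf {t. \<exists>F. finite F \<and> F \<subseteq> {..t} \<and> enat k \<le> sum m F}"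

definition neumann_eigenvalue :: "'a::euclidean_space set \<Rightarrow> nat \<Rightarrow> real" where
  "neumann_eigenvalue S = kth_eigenvalue (neumann_multiplicity S)"

text \<open>To be used for symmetric matrices only, for which geometric and algebraic
  multiplicities agree.\<close>

definition matrix_eigenvalue :: "real^'n^'n \<Rightarrow> nat \<Rightarrow> real" where
  "matrix_eigenvalue A = kth_eigenvalue (\<lambda>t. enat (dim {v. A *v v = t *\<^sub>R v}))"

definition parallelogram :: "real \<Rightarrow> real \<Rightarrow> (real \<times> real) set" where
  "parallelogram c d = {s *\<^sub>R (1, 0) + t *\<^sub>R (c, d) | s t. 0 < s \<and> s < 1 \<and> 0 < t \<and> t < 1}"

definition perimeter :: "real \<Rightarrow> real \<Rightarrow> real" where
  "perimeter c d = dist (0, 0) (c, d) + dist (c, d) (c + 1, d)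
     + dist (c + 1, d) (1, 0) + dist (1, 0) (0::real, 0::real)"

lemma perimeter_eq: "perimeter c d = 2 * (1 + sqrt (c\<^sup>2 + d\<^sup>2))"
  by (simp add: perimeter_def dist_Pair_Pair dist_real_def)

definition L_mat :: "real \<Rightarrow> real \<Rightarrow> real^2^2" where
  "L_mat c d = vector [
     vector [pi\<^sup>2 * (1 + c\<^sup>2 / d\<^sup>2), - (8 * c / d\<^sup>2)],
     vector [- (8 * c / d\<^sup>2), pi\<^sup>2 / d\<^sup>2]]"

definition M_mat :: "real \<Rightarrow> real \<Rightarrow> real^2^2" where
  "M_mat c d = vector [
     vector [pi\<^sup>2 * (1 + c\<^sup>2 / d\<^sup>2) + pi\<^sup>2 / d\<^sup>2, - (32 * sqrt 2 * c / (3 * d\<^sup>2))],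
     vector [- (32 * sqrt 2 * c / (3 * d\<^sup>2)), 4 * pi\<^sup>2 * (1 + c\<^sup>2 / d\<^sup>2)]]"

definition direct_sum :: "real^'n^'n \<Rightarrow> real^'m^'m \<Rightarrow> real^('n + 'm)^('n + 'm)"
    (infixr "\<oplus>\<^sub>m" 65) where
  "A \<oplus>\<^sub>m B = (\<chi> i j. case (i, j) of
       (Inl a, Inl b) \<Rightarrow> A $ a $ b
     | (Inr a, Inr b) \<Rightarrow> B $ a $ b
     | _ \<Rightarrow> 0)"

definition bessel_J0 :: "real \<Rightarrow> real" where
  "bessel_J0 x = (\<Sum>n. (-1) ^ n / (fact n)\<^sup>2 * (x / 2) ^ (2 * n))"

definition j01 :: real where
  "j01 = (LEAST x. 0 < x \<and> bessel_J0 x = 0)"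

end

theory Submission
  imports Defs "HOL-Real_Asymp.Real_Asymp" "HOL-Library.Diagonal_Subsequence"
begin

text \<open>The infimum that defines an eigenvalue is finite and attained only if eigenvectors exist.
  Existence and the min-max upper bound are obtained for an abstract pair of forms, by minimising
  \<open>A/B\<close> successively, under completeness and a Rellich-type compactness; both \<open>\<real>\<^sup>n\<close> and
  \<open>H\<^sup>1\<close> are instances. Compactness on the parallelogram comes from the orthogonal basis
  \<open>cos(m\<pi>s) cos(n\<pi>t)\<close> in the affine coordinates \<open>s\<close>, \<open>t\<close>: integrating by parts against the fields
  \<open>sin(m\<pi>s) cos(n\<pi>t) \<partial>\<^sub>s\<close>, which are tangential to the boundary, the coefficients of an
  \<open>H\<^sup>1\<close> function decay.

  Put \<open>r = \<surd>(c\<^sup>2 + d\<^sup>2)\<close>. If \<open>5 c\<^sup>2 \<le> r\<^sup>2\<close>, then \<open>\<lambda>\<^sub>2(L \<oplus> M)\<close> is small enough: either both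
  eigenvalues of \<open>L\<close> are, or the lowest eigenvalues of \<open>L\<close> and of \<open>M\<close> are. The matrices are Gram
  matrices of cosines on the domain, so the same vectors bound \<open>\<mu>\<^sub>3\<close>. If \<open>5 c\<^sup>2 > r\<^sup>2\<close>, then
  \<open>64 / ((1 + c)\<^sup>2 + d\<^sup>2)\<close> is below the bound. It dominates the term with \<open>j\<^sub>0\<^sub>1\<close> because
  \<open>2 j\<^sub>0\<^sub>1 + \<pi> < 8\<close>, and it dominates \<open>\<mu>\<^sub>3\<close> through the trial functions \<open>cos \<theta>\<close> and
  \<open>cos 2\<theta> + m\<close> of the projection to the long diagonal, so that no general theorem on convex
  domains is needed.\<close>

section \<open>Eigenvalues of a pair of forms\<close>

text \<open>With \<open>r = sqrt (c\<^sup>2 + d\<^sup>2)\<close> and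
  \<open>k = c\<^sup>2 / r\<^sup>2\<close>, multiplication by \<open>d\<^sup>2 / pi\<^sup>2\<close>
  turns the threshold \<open>T = 9 * pi\<^sup>2 / (1 + r)\<^sup>2\<close> into
  \<open>Y = 9 * r\<^sup>2 * (1 - k) / (1 + r)\<^sup>2\<close>, and the comparison with the matrices
  becomes a question about \<open>r\<close> and \<open>k\<close> alone. The obstacle is the point
  \<open>(0, 1 / 2)\<close>: there the modes \<open>(0, 1)\<close> and \<open>(2, 0)\<close> both
  have the eigenvalue 4 pi^2 = \<open>T\<close>, so every estimate loses its margin. Enlarging
  \<open>d\<close> favours \<open>(0, 1)\<close>, hence L; reducing \<open>d\<close> favours
  \<open>(2, 0)\<close>, hence M; a shear also favours M, since it couples \<open>(2, 0)\<close> to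
  \<open>(1, 1)\<close>. So M serves \<open>r \<le> 1 / 2\<close> and, for \<open>r\<close> up to
  13/20, the points \<open>(r, k)\<close> above the segment from (1/2, 0) to (13/20, 1/5); L serves
  the rest. The modes of L are odd and those of M even under the central symmetry of the
  parallelogram, which is why the blocks do not interact. The value 1/5 is close to the least
  \<open>k\<close> for which the bound with 64 still reaches \<open>r = 1\<close>.\<close>

lemma linear_system_nontrivial:
  fixes M :: "nat \<Rightarrow> 'i \<Rightarrow> real"
  assumes "finite I" and "card I = Suc n"
  shows "\<exists>x. (\<exists>i\<in>I. x i \<noteq> 0) \<and> (\<forall>j<n. (\<Sum>i\<in>I. x i * M j i) = 0)"
  using assms
proof (induction n arbitrary: I M)
  case 0
  then obtain i where "i \<in> I" by fastforce
  then show ?case by (intro exI[of _ "\<lambda>_. 1"]) auto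
next
  case (Suc n)
  show ?case
  proof (cases "\<exists>i\<in>I. M n i \<noteq> 0")
    case True
    then obtain k where k: "k \<in> I" "M n k \<noteq> 0" by blast
    define J where "J = I - {k}"
    have J: "finite J" "card J = Suc n" using Suc.prems k by (auto simp: J_def)
    \<comment> \<open>One step of Gaussian elimination: equation \<open>n\<close> is solved for the
      unknown \<open>k\<close>, and \<open>M'\<close> holds the remaining equations after
      substitution.\<close>
    define M' where "M' j i = M j i - M j k * M n i / M n k" for j i
    obtain x where x: "\<exists>i\<in>J. x i \<noteq> 0" "\<forall>j<n. (\<Sum>i\<in>J. x i * M' j i) = 0"
      using Suc.IH[OF J] by blast
    define y where "y i = (if i = k then - (\<Sum>i\<in>J. x i * M n i) / M n k else x i)" for i
    have split: "(\<Sum>i\<in>I. y i * M j i) = - (\<Sum>i\<in>J. x i * M n i) / M n k * M j k + (\<Sum>i\<in>J. x i * M j i)" for j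
    proof -
      have "(\<Sum>i\<in>I. y i * M j i) = y k * M j k + (\<Sum>i\<in>J. y i * M j i)"
        unfolding J_def using Suc.prems k by (simp add: sum.remove)
      also have "(\<Sum>i\<in>J. y i * M j i) = (\<Sum>i\<in>J. x i * M j i)"
        by (rule sum.cong) (auto simp: J_def y_def)
      finally show ?thesis by (simp add: y_def)
    qed
    have "(\<Sum>i\<in>I. y i * M j i) = 0" if "j < Suc n" for j
    proof (cases "j = n")
      case True
      then show ?thesis using k by (simp add: split)
    next
      case False
      then have "(\<Sum>i\<in>J. x i * M' j i) = 0" using x that by simp
      moreover have "(\<Sum>i\<in>J. x i * M' j i) = (\<Sum>i\<in>J. x i * M j i) - (\<Sum>i\<in>J. x i * M n i) / M n k * M j k"
        unfolding M'_def
        by (simp add: right_diff_distrib sum_subtractf sum_divide_distrib sum_distrib_left sum_distrib_right mult_ac)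
      ultimately show ?thesis by (simp add: split)
    qed
    moreover have "\<exists>i\<in>I. y i \<noteq> 0"
      using x(1) by (auto simp: y_def J_def)
    ultimately show ?thesis by blast
  next
    case False
    obtain k where k: "k \<in> I" using Suc.prems by fastforce
    define J where "J = I - {k}"
    have J: "finite J" "card J = Suc n" using Suc.prems k by (auto simp: J_def)
    obtain x where x: "\<exists>i\<in>J. x i \<noteq> 0" "\<forall>j<n. (\<Sum>i\<in>J. x i * M j i) = 0"
      using Suc.IH[OF J] by blast
    define y where "y i = (if i = k then 0 else x i)" for i
    have "(\<Sum>i\<in>I. y i * M j i) = (\<Sum>i\<in>J. x i * M j i)" for j
    proof -
      have "(\<Sum>i\<in>I. y i * M j i) = y k * M j k + (\<Sum>i\<in>J. y i * M j i)"
        unfolding J_def using Suc.prems k by (simp add: sum.remove)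
      also have "(\<Sum>i\<in>J. y i * M j i) = (\<Sum>i\<in>J. x i * M j i)"
        by (rule sum.cong) (auto simp: J_def y_def)
      finally show ?thesis by (simp add: y_def)
    qed
    then have "(\<Sum>i\<in>I. y i * M j i) = 0" if "j < Suc n" for j
      using that x(2) False by (cases "j = n") auto
    moreover have "\<exists>i\<in>I. y i \<noteq> 0"
      using x(1) by (auto simp: y_def J_def)
    ultimately show ?thesis by blast
  qed
qed

text \<open>The distinct values of the list \<open>l\<close> serve as the finite set in the
  definition, and their multiplicities add up to at least \<open>k\<close>. That \<open>m\<close>
  vanishes on the negative axis bounds the set below, which gives the real \<open>Inf\<close> its
  meaning.\<close>

lemma kth_eigenvalue_le:
  assumes neg: "\<And>t. t < 0 \<Longrightarrow> m t = 0"
    and mult: "\<And>t. enat (card {i. i < k \<and> l i = t}) \<le> m t"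
    and le: "\<And>i. i < k \<Longrightarrow> l i \<le> T" and "k > 0"
  shows "kth_eigenvalue m k \<le> T"
proof -
  let ?S = "{t. \<exists>F. finite F \<and> F \<subseteq> {..t} \<and> enat k \<le> sum m F}"
  have "T \<in> ?S"
  proof -
    let ?F = "l ` {..<k}"
    have "enat k = enat (\<Sum>t\<in>?F. card {i. i < k \<and> l i = t})"
    proof -
      have "k = card (\<Union>t\<in>?F. {i. i < k \<and> l i = t})"
      proof -
        have "(\<Union>t\<in>?F. {i. i < k \<and> l i = t}) = {..<k}" by auto
        then show ?thesis by simp
      qed
      also have "\<dots> = (\<Sum>t\<in>?F. card {i. i < k \<and> l i = t})"
        by (rule card_UN_disjoint) auto
      finally show ?thesis by simp
    qed
    also have "\<dots> = (\<Sum>t\<in>?F. enat (card {i. i < k \<and> l i = t}))"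
      using of_nat_sum[where 'a = enat] by (simp add: of_nat_eq_enat)
    also have "\<dots> \<le> sum m ?F" by (rule sum_mono) (rule mult)
    finally show ?thesis using le by (intro CollectI exI[of _ ?F]) auto
  qed
  moreover have "bdd_below ?S"
  proof
    fix t assume "t \<in> ?S"
    then obtain F where F: "finite F" "F \<subseteq> {..t}" "enat k \<le> sum m F" by blast
    have "sum m F \<noteq> 0" using F(3) \<open>k > 0\<close> by (auto simp: enat_0_iff)
    then obtain f where "f \<in> F" "m f \<noteq> 0" by (meson sum.neutral)
    then show "0 \<le> t" using neg[of f] F(2) by (cases "f < 0") auto
  qed
  ultimately show ?thesis
    unfolding kth_eigenvalue_def by (rule cInf_lower)
qed

text \<open>The forms are only semidefinite: the Dirichlet form vanishes on constants, the L2 form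
  on functions that are zero almost everywhere. Hence the separate case \<open>s = 0\<close>, where
  nonnegativity along a line forces \<open>q = 0\<close>.\<close>

lemma psd_Cauchy_Schwarz:
  fixes p q s :: real
  assumes "\<And>a b. 0 \<le> a\<^sup>2 * p + 2 * a * b * q + b\<^sup>2 * s" and "0 \<le> p" "0 \<le> s"
  shows "\<bar>q\<bar> \<le> sqrt (p * s)"
proof -
  have "q\<^sup>2 \<le> p * s"
  proof (cases "s = 0")
    case True
    have "q = 0"
    proof (rule ccontr)
      assume "q \<noteq> 0"
      \<comment> \<open>The value inserted for \<open>b\<close> makes the expression equal to
        \<open>-1\<close>.\<close>
      have "0 \<le> 1\<^sup>2 * p + 2 * 1 * (- (p + 1) / (2 * q)) * q + (- (p + 1) / (2 * q))\<^sup>2 * s"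
        by (rule assms(1))
      then show False using \<open>q \<noteq> 0\<close> True by (simp add: field_simps)
    qed
    then show ?thesis using True by simp
  next
    case False
    have "0 \<le> s\<^sup>2 * p + 2 * s * (- q) * q + (- q)\<^sup>2 * s" by (rule assms(1))
    then have "0 \<le> s * (p * s - q\<^sup>2)" by (simp add: algebra_simps power2_eq_square)
    then show ?thesis using False assms(3) by (simp add: zero_le_mult_iff)
  qed
  then show ?thesis by (metis real_sqrt_abs real_sqrt_le_mono)
qed

text \<open>The form domain \<open>V\<close> is a set of functions in one application, and functions that agree almost
  everywhere are not identified; so only the operation \<open>lin a x b y\<close>, standing for \<open>a x + b y\<close>, is
  assumed, and all vector identities are read off from \<open>A\<close> and \<open>B\<close>.\<close>

locale form_pair =
  fixes V :: "'v set"
    and lin :: "real \<Rightarrow> 'v \<Rightarrow> real \<Rightarrow> 'v \<Rightarrow> 'v"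
    and A B :: "'v \<Rightarrow> 'v \<Rightarrow> real"
  assumes lin_closed: "x \<in> V \<Longrightarrow> y \<in> V \<Longrightarrow> lin a x b y \<in> V"
    and A_sym: "x \<in> V \<Longrightarrow> y \<in> V \<Longrightarrow> A x y = A y x"
    and B_sym: "x \<in> V \<Longrightarrow> y \<in> V \<Longrightarrow> B x y = B y x"
    and A_lin: "x \<in> V \<Longrightarrow> y \<in> V \<Longrightarrow> z \<in> V \<Longrightarrow> A (lin a x b y) z = a * A x z + b * A y z"
    and B_lin: "x \<in> V \<Longrightarrow> y \<in> V \<Longrightarrow> z \<in> V \<Longrightarrow> B (lin a x b y) z = a * B x z + b * B y z"
    and A_nonneg: "x \<in> V \<Longrightarrow> 0 \<le> A x x"
    and B_nonneg: "x \<in> V \<Longrightarrow> 0 \<le> B x x"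
    and complete: "(\<And>n. u n \<in> V) \<Longrightarrow>
      (\<And>e. e > 0 \<Longrightarrow> \<exists>N. \<forall>m\<ge>N. \<forall>n\<ge>N. A (lin 1 (u m) (-1) (u n)) (lin 1 (u m) (-1) (u n)) < e
         \<and> B (lin 1 (u m) (-1) (u n)) (lin 1 (u m) (-1) (u n)) < e) \<Longrightarrow>
      \<exists>w\<in>V. (\<lambda>n. A (lin 1 (u n) (-1) w) (lin 1 (u n) (-1) w)) \<longlonglongrightarrow> 0
         \<and> (\<lambda>n. B (lin 1 (u n) (-1) w) (lin 1 (u n) (-1) w)) \<longlonglongrightarrow> 0"
    and compact: "(\<And>n::nat. u n \<in> V) \<Longrightarrow> (\<And>n. A (u n) (u n) + B (u n) (u n) \<le> K) \<Longrightarrow>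
      \<exists>r::nat \<Rightarrow> nat. strict_mono r \<and> (\<forall>e>0. \<exists>N. \<forall>m\<ge>N. \<forall>n\<ge>N.
         B (lin 1 (u (r m)) (-1) (u (r n))) (lin 1 (u (r m)) (-1) (u (r n))) < e)"
begin

lemma A_lin2: "x \<in> V \<Longrightarrow> y \<in> V \<Longrightarrow> z \<in> V \<Longrightarrow> A z (lin a x b y) = a * A z x + b * A z y"
  by (metis A_lin A_sym lin_closed)

lemma B_lin2: "x \<in> V \<Longrightarrow> y \<in> V \<Longrightarrow> z \<in> V \<Longrightarrow> B z (lin a x b y) = a * B z x + b * B z y"
  by (metis B_lin B_sym lin_closed)

lemma A_square: "x \<in> V \<Longrightarrow> y \<in> V \<Longrightarrow>
    A (lin a x b y) (lin a x b y) = a\<^sup>2 * A x x + 2 * a * b * A x y + b\<^sup>2 * A y y"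
  using A_sym[of x y] by (simp add: A_lin A_lin2 lin_closed algebra_simps power2_eq_square)

lemma B_square: "x \<in> V \<Longrightarrow> y \<in> V \<Longrightarrow>
    B (lin a x b y) (lin a x b y) = a\<^sup>2 * B x x + 2 * a * b * B x y + b\<^sup>2 * B y y"
  using B_sym[of x y] by (simp add: B_lin B_lin2 lin_closed algebra_simps power2_eq_square)

lemma A_Cauchy_Schwarz: "x \<in> V \<Longrightarrow> y \<in> V \<Longrightarrow> \<bar>A x y\<bar> \<le> sqrt (A x x * A y y)"
  by (rule psd_Cauchy_Schwarz) (auto simp flip: A_square intro: A_nonneg lin_closed)

lemma B_Cauchy_Schwarz: "x \<in> V \<Longrightarrow> y \<in> V \<Longrightarrow> \<bar>B x y\<bar> \<le> sqrt (B x x * B y y)"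
  by (rule psd_Cauchy_Schwarz) (auto simp flip: B_square intro: B_nonneg lin_closed)

lemma A_tendsto:
  assumes u: "\<And>n. u n \<in> V" and w: "w \<in> V" and z: "z \<in> V"
    and lim: "(\<lambda>n. A (lin 1 (u n) (-1) w) (lin 1 (u n) (-1) w)) \<longlonglongrightarrow> 0"
  shows "(\<lambda>n. A (u n) z) \<longlonglongrightarrow> A w z" and "(\<lambda>n. A (u n) (u n)) \<longlonglongrightarrow> A w w"
proof -
  have conv: "(\<lambda>n. A (u n) z) \<longlonglongrightarrow> A w z" if z: "z \<in> V" for z
  proof (rule LIM_zero_cancel, rule tendsto_rabs_zero_cancel, rule tendsto_sandwich[OF _ _ tendsto_const])
    have "A (u n) z - A w z = A (lin 1 (u n) (-1) w) z" for n using u w z by (simp add: A_lin)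
    then show "\<forall>\<^sub>F n in sequentially. \<bar>A (u n) z - A w z\<bar> \<le> sqrt (A (lin 1 (u n) (-1) w) (lin 1 (u n) (-1) w) * A z z)"
      using u w z A_Cauchy_Schwarz lin_closed by simp
    show "(\<lambda>n. sqrt (A (lin 1 (u n) (-1) w) (lin 1 (u n) (-1) w) * A z z)) \<longlonglongrightarrow> 0"
      using tendsto_real_sqrt[OF tendsto_mult_left_zero[OF lim]] by simp
  qed simp
  show "(\<lambda>n. A (u n) z) \<longlonglongrightarrow> A w z" by (rule conv) fact
  have "(\<lambda>n. A (lin 1 (u n) (-1) w) (lin 1 (u n) (-1) w) + 2 * A (u n) w - A w w) \<longlonglongrightarrow> 0 + 2 * A w w - A w w"
    by (intro tendsto_intros lim conv w)
  moreover have "A (lin 1 (u n) (-1) w) (lin 1 (u n) (-1) w) + 2 * A (u n) w - A w w = A (u n) (u n)" for n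
    using u w by (simp add: A_square)
  ultimately show "(\<lambda>n. A (u n) (u n)) \<longlonglongrightarrow> A w w" by simp
qed

lemma B_tendsto:
  assumes u: "\<And>n. u n \<in> V" and w: "w \<in> V" and z: "z \<in> V"
    and lim: "(\<lambda>n. B (lin 1 (u n) (-1) w) (lin 1 (u n) (-1) w)) \<longlonglongrightarrow> 0"
  shows "(\<lambda>n. B (u n) z) \<longlonglongrightarrow> B w z" and "(\<lambda>n. B (u n) (u n)) \<longlonglongrightarrow> B w w"
proof -
  have conv: "(\<lambda>n. B (u n) z) \<longlonglongrightarrow> B w z" if z: "z \<in> V" for z
  proof (rule LIM_zero_cancel, rule tendsto_rabs_zero_cancel, rule tendsto_sandwich[OF _ _ tendsto_const])
    have "B (u n) z - B w z = B (lin 1 (u n) (-1) w) z" for n using u w z by (simp add: B_lin)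
    then show "\<forall>\<^sub>F n in sequentially. \<bar>B (u n) z - B w z\<bar> \<le> sqrt (B (lin 1 (u n) (-1) w) (lin 1 (u n) (-1) w) * B z z)"
      using u w z B_Cauchy_Schwarz lin_closed by simp
    show "(\<lambda>n. sqrt (B (lin 1 (u n) (-1) w) (lin 1 (u n) (-1) w) * B z z)) \<longlonglongrightarrow> 0"
      using tendsto_real_sqrt[OF tendsto_mult_left_zero[OF lim]] by simp
  qed simp
  show "(\<lambda>n. B (u n) z) \<longlonglongrightarrow> B w z" by (rule conv) fact
  have "(\<lambda>n. B (lin 1 (u n) (-1) w) (lin 1 (u n) (-1) w) + 2 * B (u n) w - B w w) \<longlonglongrightarrow> 0 + 2 * B w w - B w w"
    by (intro tendsto_intros lim conv w)
  moreover have "B (lin 1 (u n) (-1) w) (lin 1 (u n) (-1) w) + 2 * B (u n) w - B w w = B (u n) (u n)" for n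
    using u w by (simp add: B_square)
  ultimately show "(\<lambda>n. B (u n) (u n)) \<longlonglongrightarrow> B w w" by simp
qed

definition orth :: "(nat \<Rightarrow> 'v) \<Rightarrow> nat \<Rightarrow> 'v set" where
  "orth e n = {v\<in>V. \<forall>i<n. B (e i) v = 0}"

lemma orth_lin: "\<lbrakk>\<And>i. i < n \<Longrightarrow> e i \<in> V; x \<in> orth e n; y \<in> orth e n\<rbrakk> \<Longrightarrow> lin a x b y \<in> orth e n"
  by (auto simp: orth_def lin_closed B_lin2)

text \<open>The direct method. A minimising sequence is bounded in \<open>A + B\<close>, so
  \<open>compact\<close> gives a subsequence that is Cauchy for \<open>B\<close>; the parallelogram
  law makes it Cauchy for \<open>A\<close> as well, and \<open>complete\<close> supplies a limit,
  which attains the infimum and stays orthogonal to the \<open>e i\<close>.\<close>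

lemma minimizer:
  assumes e: "\<And>i. i < n \<Longrightarrow> e i \<in> V" and z: "z \<in> orth e n" "B z z > 0"
  obtains w l where "w \<in> orth e n" "B w w = 1" "A w w = l" "\<And>v. v \<in> orth e n \<Longrightarrow> l * B v v \<le> A v v"
proof -
  define S where "S = {A v v | v. v \<in> orth e n \<and> B v v = 1}"
  define l where "l = Inf S"
  have W: "v \<in> V" if "v \<in> orth e n" for v using that by (simp add: orth_def)
  have normalize: "\<exists>v'\<in>orth e n. B v' v' = 1 \<and> A v' v' = A v v / B v v" if v: "v \<in> orth e n" "B v v > 0" for v
  proof
    show "lin (1 / sqrt (B v v)) v 0 v \<in> orth e n" using e v by (intro orth_lin)
    show "B (lin (1 / sqrt (B v v)) v 0 v) (lin (1 / sqrt (B v v)) v 0 v) = 1 \<and>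
        A (lin (1 / sqrt (B v v)) v 0 v) (lin (1 / sqrt (B v v)) v 0 v) = A v v / B v v"
      using v W by (simp add: A_square B_square power_divide)
  qed
  have "S \<noteq> {}" using normalize[OF z] by (auto simp: S_def)
  have bdd: "bdd_below S" by (rule bdd_belowI[of _ 0]) (auto simp: S_def W A_nonneg)
  have l0: "0 \<le> l" unfolding l_def by (rule cInf_greatest) (use \<open>S \<noteq> {}\<close> in \<open>auto simp: S_def W A_nonneg\<close>)
  have lower: "l * B v v \<le> A v v" if v: "v \<in> orth e n" for v
  proof (cases "B v v = 0")
    case True
    then show ?thesis using A_nonneg W v by simp
  next
    case False
    then have "B v v > 0" using B_nonneg[OF W[OF v]] by simp
    then obtain v' where "v' \<in> orth e n" "B v' v' = 1" "A v' v' = A v v / B v v" using normalize v by blast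
    then have "l \<le> A v v / B v v" unfolding l_def by (intro cInf_lower bdd) (auto simp: S_def, metis)
    then show ?thesis using \<open>B v v > 0\<close> by (simp add: field_simps)
  qed
  have "\<exists>v. v \<in> orth e n \<and> B v v = 1 \<and> A v v < l + 1 / real (Suc k)" for k
  proof -
    have "\<exists>s\<in>S. s < l + 1 / real (Suc k)"
      using cInf_less_iff[OF \<open>S \<noteq> {}\<close> bdd, of "l + 1 / real (Suc k)"] unfolding l_def by simp
    then show ?thesis by (auto simp: S_def)
  qed
  then obtain u where u: "\<And>k. u k \<in> orth e n" "\<And>k. B (u k) (u k) = 1" "\<And>k. A (u k) (u k) < l + 1 / real (Suc k)"
    by metis
  have "A (u k) (u k) + B (u k) (u k) \<le> l + 2" for k
  proof -
    have "1 / real (Suc k) \<le> 1" by simp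
    then show ?thesis using u(2,3)[of k] by linarith
  qed
  then have "\<exists>r::nat \<Rightarrow> nat. strict_mono r \<and> (\<forall>e>0. \<exists>N. \<forall>m\<ge>N. \<forall>n\<ge>N.
         B (lin 1 (u (r m)) (-1) (u (r n))) (lin 1 (u (r m)) (-1) (u (r n))) < e)"
    using u(1) W by (intro compact) auto
  then obtain r :: "nat \<Rightarrow> nat" where r: "strict_mono r" and
    rB: "\<And>e. e > 0 \<Longrightarrow> \<exists>N. \<forall>m\<ge>N. \<forall>n\<ge>N. B (lin 1 (u (r m)) (-1) (u (r n))) (lin 1 (u (r m)) (-1) (u (r n))) < e"
    by blast
  define U where "U k = u (r k)" for k
  have U: "U k \<in> orth e n" "U k \<in> V" "B (U k) (U k) = 1" "A (U k) (U k) < l + 1 / real (Suc k)" for k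
  proof -
    show "U k \<in> orth e n" "U k \<in> V" "B (U k) (U k) = 1" using u W by (auto simp: U_def)
    have "1 / real (Suc (r k)) \<le> 1 / real (Suc k)"
      using strict_mono_imp_increasing[OF r, of k] by (intro divide_left_mono) auto
    then show "A (U k) (U k) < l + 1 / real (Suc k)" using u(3)[of "r k"] by (simp add: U_def)
  qed
  \<comment> \<open>The parallelogram law, with the sum \<open>U i + U j\<close> bounded from below
    by \<open>l\<close> times its \<open>B\<close>-value; the latter is 4 minus the
    \<open>B\<close>-value of the difference.\<close>
  have diffA: "A (lin 1 (U i) (-1) (U j)) (lin 1 (U i) (-1) (U j)) \<le>
      2 / real (Suc i) + 2 / real (Suc j) + l * B (lin 1 (U i) (-1) (U j)) (lin 1 (U i) (-1) (U j))" for i j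
  proof -
    have "lin 1 (U i) 1 (U j) \<in> orth e n" using e U by (intro orth_lin)
    then have "l * B (lin 1 (U i) 1 (U j)) (lin 1 (U i) 1 (U j)) \<le> A (lin 1 (U i) 1 (U j)) (lin 1 (U i) 1 (U j))"
      by (rule lower)
    then have *: "l * (2 + 2 * B (U i) (U j)) \<le> A (U i) (U i) + 2 * A (U i) (U j) + A (U j) (U j)"
      using U by (simp add: A_square B_square)
    show ?thesis using * U(4)[of i] U(4)[of j] U(2,3)
      by (simp add: A_square B_square algebra_simps)
  qed
  have "\<exists>w\<in>V. (\<lambda>n. A (lin 1 (U n) (-1) w) (lin 1 (U n) (-1) w)) \<longlonglongrightarrow> 0
         \<and> (\<lambda>n. B (lin 1 (U n) (-1) w) (lin 1 (U n) (-1) w)) \<longlonglongrightarrow> 0"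
  proof (rule complete[OF U(2)])
    fix d :: real assume "d > 0"
    \<comment> \<open>With this choice the \<open>B\<close>-term of \<open>diffA\<close> costs at
      most \<open>d / 2\<close>; the two remaining terms cost less than \<open>d / 4\<close> each.
      The summand 1 covers \<open>l = 0\<close>.\<close>
    define d' where "d' = d / (2 * (l + 1))"
    have d': "0 < d'" "l * d' \<le> d / 2" "d' \<le> d" using \<open>d > 0\<close> l0 by (auto simp: d'_def field_simps)
    obtain N1 where N1: "\<And>m n. m \<ge> N1 \<Longrightarrow> n \<ge> N1 \<Longrightarrow> B (lin 1 (U m) (-1) (U n)) (lin 1 (U m) (-1) (U n)) < d'"
      using rB[OF d'(1)] unfolding U_def by blast
    obtain N2 :: nat where N2: "8 / d < real N2" using reals_Archimedean2 by blast
    have small: "2 / real (Suc m) < d / 4" if "m \<ge> N2" for m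
    proof -
      have "8 / d < real (Suc m)" using that N2 by linarith
      then show ?thesis using \<open>d > 0\<close> by (simp add: field_simps)
    qed
    have "A (lin 1 (U m) (-1) (U n)) (lin 1 (U m) (-1) (U n)) < d \<and> B (lin 1 (U m) (-1) (U n)) (lin 1 (U m) (-1) (U n)) < d"
      if "m \<ge> max N1 N2" "n \<ge> max N1 N2" for m n
    proof -
      have b: "B (lin 1 (U m) (-1) (U n)) (lin 1 (U m) (-1) (U n)) < d'" using N1 that by simp
      then have "l * B (lin 1 (U m) (-1) (U n)) (lin 1 (U m) (-1) (U n)) \<le> l * d'"
        using l0 by (intro mult_left_mono) auto
      then show ?thesis using diffA[of m n] small[of m] small[of n] that b d' by auto
    qed
    then show "\<exists>N. \<forall>m\<ge>N. \<forall>n\<ge>N. A (lin 1 (U m) (-1) (U n)) (lin 1 (U m) (-1) (U n)) < d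
         \<and> B (lin 1 (U m) (-1) (U n)) (lin 1 (U m) (-1) (U n)) < d" by blast
  qed
  then obtain w where w: "w \<in> V" and limA: "(\<lambda>n. A (lin 1 (U n) (-1) w) (lin 1 (U n) (-1) w)) \<longlonglongrightarrow> 0"
    and limB: "(\<lambda>n. B (lin 1 (U n) (-1) w) (lin 1 (U n) (-1) w)) \<longlonglongrightarrow> 0" by blast
  have "B (e i) w = 0" if "i < n" for i
  proof -
    have "(\<lambda>k. B (U k) (e i)) \<longlonglongrightarrow> B w (e i)" using B_tendsto(1)[OF U(2) w e[OF that] limB] .
    moreover have "B (U k) (e i) = 0" for k using U(1)[of k] e that B_sym by (auto simp: orth_def)
    ultimately have "B w (e i) = 0" by (simp add: LIMSEQ_const_iff)
    then show ?thesis using B_sym w e that by simp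
  qed
  then have wW: "w \<in> orth e n" using w by (simp add: orth_def)
  have "(\<lambda>k. B (U k) (U k)) \<longlonglongrightarrow> B w w" using B_tendsto(2)[OF U(2) w w limB] .
  then have Bw: "B w w = 1" using U(3) by (simp add: LIMSEQ_const_iff)
  have "A w w \<le> l"
  proof (rule LIMSEQ_le)
    show "(\<lambda>k. A (U k) (U k)) \<longlonglongrightarrow> A w w" using A_tendsto(2)[OF U(2) w w limA] .
    show "(\<lambda>k. l + 1 / real (Suc k)) \<longlonglongrightarrow> l"
      using tendsto_add[OF tendsto_const LIMSEQ_inverse_real_of_nat] by (simp add: inverse_eq_divide)
    show "\<exists>N. \<forall>n\<ge>N. A (U n) (U n) \<le> l + 1 / real (Suc n)" using U(4) less_imp_le by blast
  qed
  moreover have "l \<le> A w w" using lower[OF wW] Bw by simp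
  ultimately show thesis using that wW Bw lower by fastforce
qed

text \<open>For small \<open>t\<close> of the sign opposite to \<open>p\<close> the linear term
  wins. It is applied to the first variation of \<open>A - m B\<close> at a minimiser.\<close>

lemma first_variation_zero:
  fixes p q :: real
  assumes "\<And>t. 0 \<le> 2 * t * p + t\<^sup>2 * q"
  shows "p = 0"
proof (rule ccontr)
  assume "p \<noteq> 0"
  define t where "t = - p / (\<bar>q\<bar> + 1)"
  have "2 * t * p + t\<^sup>2 * q \<le> 2 * t * p + t\<^sup>2 * (\<bar>q\<bar> + 1)" by (simp add: mult_left_mono)
  also have "\<dots> = - p\<^sup>2 / (\<bar>q\<bar> + 1)"
    by (simp add: t_def divide_simps power2_eq_square)
  also have "\<dots> < 0" using \<open>p \<noteq> 0\<close> by (simp add: divide_neg_pos)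
  finally show False using assms[of t] by simp
qed

definition eigen :: "real \<Rightarrow> 'v \<Rightarrow> bool" where
  "eigen t u \<longleftrightarrow> u \<in> V \<and> (\<forall>v\<in>V. A u v = t * B u v)"

text \<open>The recursion starts with \<open>lin 0 (w 0) 0 (w 0)\<close>, which plays the part of
  the zero vector, because \<open>lin\<close> is the only operation on \<open>V\<close>.\<close>

primrec comb :: "(nat \<Rightarrow> real) \<Rightarrow> (nat \<Rightarrow> 'v) \<Rightarrow> nat \<Rightarrow> 'v" where
  "comb x w 0 = lin 0 (w 0) 0 (w 0)"
| "comb x w (Suc n) = lin 1 (comb x w n) (x n) (w n)"

lemma comb_closed: "(\<And>i. w i \<in> V) \<Longrightarrow> comb x w n \<in> V"
  by (induction n) (auto intro: lin_closed)

lemma A_comb: "(\<And>i. w i \<in> V) \<Longrightarrow> v \<in> V \<Longrightarrow> A (comb x w n) v = (\<Sum>i<n. x i * A (w i) v)"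
  by (induction n) (auto simp: A_lin comb_closed)

lemma B_comb: "(\<And>i. w i \<in> V) \<Longrightarrow> v \<in> V \<Longrightarrow> B (comb x w n) v = (\<Sum>i<n. x i * B (w i) v)"
  by (induction n) (auto simp: B_lin comb_closed)

lemma A_comb2:
  assumes w: "\<And>i. w i \<in> V"
  shows "A (comb x w n) (comb x w n) = (\<Sum>i<n. \<Sum>j<n. x i * x j * A (w i) (w j))"
proof -
  have "A (comb x w n) (comb x w n) = (\<Sum>i<n. x i * A (w i) (comb x w n))"
    using w by (simp add: A_comb comb_closed)
  also have "\<dots> = (\<Sum>i<n. x i * A (comb x w n) (w i))"
    using A_sym[OF w comb_closed[OF w]] by simp
  also have "\<dots> = (\<Sum>i<n. \<Sum>j<n. x i * (x j * A (w i) (w j)))"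
    using w A_sym[OF w w] by (simp add: A_comb sum_distrib_left)
  finally show ?thesis by (simp add: mult_ac)
qed

lemma B_comb2:
  assumes w: "\<And>i. w i \<in> V"
  shows "B (comb x w n) (comb x w n) = (\<Sum>i<n. \<Sum>j<n. x i * x j * B (w i) (w j))"
proof -
  have "B (comb x w n) (comb x w n) = (\<Sum>i<n. x i * B (w i) (comb x w n))"
    using w by (simp add: B_comb comb_closed)
  also have "\<dots> = (\<Sum>i<n. x i * B (comb x w n) (w i))"
    using B_sym[OF w comb_closed[OF w]] by simp
  also have "\<dots> = (\<Sum>i<n. \<Sum>j<n. x i * (x j * B (w i) (w j)))"
    using w B_sym[OF w w] by (simp add: B_comb sum_distrib_left)
  finally show ?thesis by (simp add: mult_ac)
qed

text \<open>Successive minimisation: the next eigenvector minimises \<open>A\<close> relative to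
  \<open>B\<close> among the vectors orthogonal to the earlier ones. The positive Gram form of the
  \<open>w i\<close> guarantees that such vectors with positive \<open>B\<close> exist for
  \<open>n\<close> rounds.\<close>

theorem eigenvectors_exist:
  fixes w :: "nat \<Rightarrow> 'v"
  assumes w: "\<And>i. w i \<in> V"
    and pos: "\<And>x. \<exists>i<n. x i \<noteq> 0 \<Longrightarrow> 0 < (\<Sum>i<n. \<Sum>j<n. x i * x j * B (w i) (w j))"
  shows "\<exists>e l. (\<forall>i<n. eigen (l i) (e i)) \<and> (\<forall>i<n. \<forall>j<n. B (e i) (e j) = (if i = j then 1 else 0)) \<and>
    (\<forall>i<n. \<forall>j\<le>i. l j \<le> l i) \<and> (\<forall>i<n. \<forall>v\<in>orth e i. l i * B v v \<le> A v v)"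
proof -
  have "\<exists>e l. (\<forall>i<k. eigen (l i) (e i)) \<and> (\<forall>i<k. \<forall>j<k. B (e i) (e j) = (if i = j then 1 else 0)) \<and>
    (\<forall>i<k. \<forall>j\<le>i. l j \<le> l i) \<and> (\<forall>i<k. \<forall>v\<in>orth e i. l i * B v v \<le> A v v)" if "k \<le> n" for k
    using that
  proof (induction k)
    case 0
    show ?case by simp
  next
    case (Suc k)
    then have "\<exists>e l. (\<forall>i<k. eigen (l i) (e i)) \<and> (\<forall>i<k. \<forall>j<k. B (e i) (e j) = (if i = j then 1 else 0)) \<and>
      (\<forall>i<k. \<forall>j\<le>i. l j \<le> l i) \<and> (\<forall>i<k. \<forall>v\<in>orth e i. l i * B v v \<le> A v v)" by simp
    then obtain e l where el: "(\<forall>i<k. eigen (l i) (e i)) \<and> (\<forall>i<k. \<forall>j<k. B (e i) (e j) = (if i = j then 1 else 0)) \<and>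
      (\<forall>i<k. \<forall>j\<le>i. l j \<le> l i) \<and> (\<forall>i<k. \<forall>v\<in>orth e i. l i * B v v \<le> A v v)"
    by (elim exE)
  have eig: "\<And>i. i < k \<Longrightarrow> eigen (l i) (e i)"
    and on: "\<And>i j. i < k \<Longrightarrow> j < k \<Longrightarrow> B (e i) (e j) = (if i = j then 1 else 0)"
    and mono: "\<And>i j. i < k \<Longrightarrow> j \<le> i \<Longrightarrow> l j \<le> l i"
    and low: "\<And>i v. i < k \<Longrightarrow> v \<in> orth e i \<Longrightarrow> l i * B v v \<le> A v v"
    using el by simp_all
    have eV: "e i \<in> V" if "i < k" for i using eig[OF that] by (simp add: eigen_def)
    obtain x where x: "\<exists>i\<in>{..<Suc k}. x i \<noteq> 0" "\<forall>j<k. (\<Sum>i\<in>{..<Suc k}. x i * B (w i) (e j)) = 0"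
      using linear_system_nontrivial[of "{..<Suc k}" k "\<lambda>j i. B (w i) (e j)"] by auto
    \<comment> \<open>\<open>Suc k\<close> coefficients against \<open>k\<close> orthogonality
      conditions; they are padded with zeros up to length \<open>n\<close>, so that
      \<open>pos\<close> applies.\<close>
    define z where "z = comb (\<lambda>i. if i < Suc k then x i else 0) w n"
    have zV: "z \<in> V" unfolding z_def using w by (rule comb_closed)
    have "B (e j) z = 0" if "j < k" for j
    proof -
      have "B (e j) z = B z (e j)" using eV zV that B_sym by blast
      also have "\<dots> = (\<Sum>i<n. (if i < Suc k then x i else 0) * B (w i) (e j))"
        unfolding z_def using w eV that by (simp add: B_comb)
      also have "\<dots> = (\<Sum>i<Suc k. x i * B (w i) (e j))"
        using Suc.prems by (intro sum.mono_neutral_cong_right) auto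
      finally show ?thesis using x(2) that by simp
    qed
    then have z: "z \<in> orth e k" using zV by (simp add: orth_def)
    have "0 < B z z" unfolding z_def B_comb2[OF w]
      using x(1) Suc.prems by (intro pos) (auto intro: less_le_trans)
    then obtain u m where u: "u \<in> orth e k" "B u u = 1" "A u u = m" and
      min: "\<And>v. v \<in> orth e k \<Longrightarrow> m * B v v \<le> A v v"
      using minimizer[of k e z] eV z by blast
    have uV: "u \<in> V" using u by (simp add: orth_def)
    have "A u v = m * B u v" if v: "v \<in> V" for v
    proof -
      \<comment> \<open>The Euler-Lagrange equation of the minimum, so far only against directions
        inside the orthogonal complement.\<close>
      have EL: "A u v = m * B u v" if v: "v \<in> orth e k" for v
      proof -
        have vV: "v \<in> V" using v by (simp add: orth_def)
        have "0 \<le> 2 * t * (A u v - m * B u v) + t\<^sup>2 * (A v v - m * B v v)" for t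
        proof -
          have "lin 1 u t v \<in> orth e k" using eV u v by (intro orth_lin)
          from min[OF this] show ?thesis
            using u uV vV by (simp add: A_square B_square algebra_simps)
        qed
        then have "A u v - m * B u v = 0" by (rule first_variation_zero)
        then show ?thesis by simp
      qed
      \<comment> \<open>An arbitrary \<open>v\<close> is moved into the complement by subtracting
        its components along the \<open>e i\<close> one at a time. This changes neither
        \<open>A u v\<close> nor \<open>B u v\<close>: \<open>u\<close> is orthogonal to
        \<open>e i\<close> for \<open>B\<close>, and then for \<open>A\<close>, since
        \<open>e i\<close> is an eigenvector.\<close>
      have "\<exists>v'\<in>V. (\<forall>i<j. B (e i) v' = 0) \<and> A u v' = A u v \<and> B u v' = B u v" if "j \<le> k" for j
        using that
      proof (induction j)
        case 0
        then show ?case using v by auto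
      next
        case (Suc j)
        then obtain v' where v': "v' \<in> V" "\<forall>i<j. B (e i) v' = 0" "A u v' = A u v" "B u v' = B u v" by auto
        have j: "j < k" using Suc by simp
        have uj: "B u (e j) = 0" using u(1) j B_sym eV uV by (auto simp: orth_def)
        have "A u (e j) = A (e j) u" using A_sym eV j uV by blast
        also have "\<dots> = l j * B (e j) u" using eig[OF j] uV by (simp add: eigen_def)
        finally have Auj: "A u (e j) = 0" using uj B_sym eV j uV by simp
        let ?v = "lin 1 v' (- B (e j) v') (e j)"
        have "?v \<in> V" using v' eV j by (simp add: lin_closed)
        moreover have "\<forall>i<Suc j. B (e i) ?v = 0"
          using v' eV j on by (auto simp: B_lin2 less_Suc_eq)
        moreover have "A u ?v = A u v" "B u ?v = B u v"
          using v' eV j uV uj Auj by (auto simp: A_lin2 B_lin2)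
        ultimately show ?case by blast
      qed
      from this[of k] obtain v' where v': "v' \<in> V" "\<forall>i<k. B (e i) v' = 0" "A u v' = A u v" "B u v' = B u v" by auto
      then have "v' \<in> orth e k" by (simp add: orth_def)
      then show ?thesis using EL v' by metis
    qed
    then have eigu: "eigen m u" using uV by (simp add: eigen_def)
    have lm: "l j \<le> m" if "j < k" for j
    proof -
      have "u \<in> orth e j" using u(1) that by (auto simp: orth_def)
      from low[OF that this] show ?thesis using u by simp
    qed
    define e' l' where "e' = e(k := u)" and "l' = l(k := m)"
    have orth': "orth e' i = orth e i" if "i \<le> k" for i using that by (auto simp: orth_def e'_def)
    have Beu: "B (e i) u = 0" "B u (e i) = 0" if "i < k" for i
      using u(1) that B_sym eV uV by (auto simp: orth_def)
    have "\<forall>i<Suc k. eigen (l' i) (e' i)"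
      using eig eigu by (auto simp: e'_def l'_def less_Suc_eq)
    moreover have "\<forall>i<Suc k. \<forall>j<Suc k. B (e' i) (e' j) = (if i = j then 1 else 0)"
      using on u(2) Beu by (auto simp: e'_def less_Suc_eq)
    moreover have "\<forall>i<Suc k. \<forall>j\<le>i. l' j \<le> l' i"
      using mono lm by (auto simp: l'_def less_Suc_eq le_less)
    moreover have "\<forall>i<Suc k. \<forall>v\<in>orth e' i. l' i * B v v \<le> A v v"
      using low min orth' by (auto simp: l'_def less_Suc_eq)
    ultimately show ?case by blast
  qed
  then show ?thesis by blast
qed

text \<open>The min-max argument: some nontrivial combination of the \<open>n\<close> trial vectors
  is orthogonal to the first \<open>n - 1\<close> eigenvectors, so its quotient is at least the last
  \<open>l\<close>, which dominates the \<open>n\<close>-th eigenvalue. The multiplicity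
  \<open>m\<close> is kept abstract so that matrices and the Neumann Laplacian both fit.\<close>

theorem eigenvalue_upper_bound:
  fixes w :: "nat \<Rightarrow> 'v"
  assumes w: "\<And>i. w i \<in> V" and "n > 0"
    and pos: "\<And>x. \<exists>i<n. x i \<noteq> 0 \<Longrightarrow> 0 < (\<Sum>i<n. \<Sum>j<n. x i * x j * B (w i) (w j))"
    and neg: "\<And>t. t < 0 \<Longrightarrow> m t = 0"
    and mult: "\<And>F e t. finite F \<Longrightarrow> (\<And>i. i \<in> F \<Longrightarrow> eigen t (e i)) \<Longrightarrow>
       (\<And>i j. i \<in> F \<Longrightarrow> j \<in> F \<Longrightarrow> B (e i) (e j) = (if i = j then 1 else 0)) \<Longrightarrow> enat (card (F :: nat set)) \<le> m t"
  shows "\<exists>x. (\<exists>i<n. x i \<noteq> 0) \<and>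
    kth_eigenvalue m n * (\<Sum>i<n. \<Sum>j<n. x i * x j * B (w i) (w j)) \<le> (\<Sum>i<n. \<Sum>j<n. x i * x j * A (w i) (w j))"
proof -
  have "\<exists>e l. (\<forall>i<n. eigen (l i) (e i)) \<and> (\<forall>i<n. \<forall>j<n. B (e i) (e j) = (if i = j then 1 else 0)) \<and>
    (\<forall>i<n. \<forall>j\<le>i. l j \<le> l i) \<and> (\<forall>i<n. \<forall>v\<in>orth e i. l i * B v v \<le> A v v)"
    using w pos by (rule eigenvectors_exist)
  then obtain e l where el: "(\<forall>i<n. eigen (l i) (e i)) \<and> (\<forall>i<n. \<forall>j<n. B (e i) (e j) = (if i = j then 1 else 0)) \<and>
      (\<forall>i<n. \<forall>j\<le>i. l j \<le> l i) \<and> (\<forall>i<n. \<forall>v\<in>orth e i. l i * B v v \<le> A v v)"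
    by (elim exE)
  have eig: "\<And>i. i < n \<Longrightarrow> eigen (l i) (e i)"
    and on: "\<And>i j. i < n \<Longrightarrow> j < n \<Longrightarrow> B (e i) (e j) = (if i = j then 1 else 0)"
    and mono: "\<And>i j. i < n \<Longrightarrow> j \<le> i \<Longrightarrow> l j \<le> l i"
    and low: "\<And>i v. i < n \<Longrightarrow> v \<in> orth e i \<Longrightarrow> l i * B v v \<le> A v v"
    using el by simp_all
  obtain k where n: "n = Suc k" using \<open>n > 0\<close> gr0_implies_Suc by blast
  have eV: "e i \<in> V" if "i < n" for i using eig[OF that] by (simp add: eigen_def)
  have le: "kth_eigenvalue m n \<le> l k"
  proof (rule kth_eigenvalue_le[where l = l])
    show "enat (card {i. i < n \<and> l i = t}) \<le> m t" for t
      by (rule mult[where e = e]) (use eig on in auto)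
  qed (use neg mono n in auto)
  obtain x where x: "\<exists>i\<in>{..<n}. x i \<noteq> 0" "\<forall>j<k. (\<Sum>i\<in>{..<n}. x i * B (w i) (e j)) = 0"
    using linear_system_nontrivial[of "{..<n}" k "\<lambda>j i. B (w i) (e j)"] n by auto
  define z where "z = comb x w n"
  have zV: "z \<in> V" unfolding z_def using w by (rule comb_closed)
  have "B (e j) z = 0" if "j < k" for j
  proof -
    have "B (e j) z = B z (e j)" using eV zV that n B_sym by simp
    also have "\<dots> = (\<Sum>i<n. x i * B (w i) (e j))"
      unfolding z_def using eV[of j] that n by (intro B_comb w) auto
    finally show ?thesis using x(2) that by simp
  qed
  then have "z \<in> orth e k" using zV by (simp add: orth_def)
  then have "l k * B z z \<le> A z z" using low n by simp
  moreover have "kth_eigenvalue m n * B z z \<le> l k * B z z"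
    using le B_nonneg zV by (simp add: mult_right_mono)
  ultimately have "kth_eigenvalue m n * B z z \<le> A z z" by simp
  then show ?thesis using x(1) unfolding z_def A_comb2[OF w] B_comb2[OF w] by blast
qed


text \<open>The preceding bound holds at one particular combination, so a strict inequality at every
  nonzero combination passes to the eigenvalue directly.\<close>

lemma eigenvalue_strict_upper_bound:
  fixes w :: "nat \<Rightarrow> 'v"
  assumes "\<And>i. w i \<in> V" and "n > 0"
    and pos: "\<And>x. \<exists>i<n. x i \<noteq> 0 \<Longrightarrow> 0 < (\<Sum>i<n. \<Sum>j<n. x i * x j * B (w i) (w j))"
    and "\<And>t. t < 0 \<Longrightarrow> m t = 0"
    and "\<And>F e t. finite F \<Longrightarrow> (\<And>i. i \<in> F \<Longrightarrow> eigen t (e i)) \<Longrightarrow>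
       (\<And>i j. i \<in> F \<Longrightarrow> j \<in> F \<Longrightarrow> B (e i) (e j) = (if i = j then 1 else 0)) \<Longrightarrow> enat (card (F :: nat set)) \<le> m t"
  shows "(\<And>x. \<exists>i<n. x i \<noteq> 0 \<Longrightarrow> (\<Sum>i<n. \<Sum>j<n. x i * x j * A (w i) (w j)) < T * (\<Sum>i<n. \<Sum>j<n. x i * x j * B (w i) (w j)))
      \<Longrightarrow> kth_eigenvalue m n < T"
    and "(\<And>x. \<exists>i<n. x i \<noteq> 0 \<Longrightarrow> (\<Sum>i<n. \<Sum>j<n. x i * x j * A (w i) (w j)) \<le> T * (\<Sum>i<n. \<Sum>j<n. x i * x j * B (w i) (w j)))
      \<Longrightarrow> kth_eigenvalue m n \<le> T"
proof -
  have "\<exists>x. (\<exists>i<n. x i \<noteq> 0) \<and>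
    kth_eigenvalue m n * (\<Sum>i<n. \<Sum>j<n. x i * x j * B (w i) (w j)) \<le> (\<Sum>i<n. \<Sum>j<n. x i * x j * A (w i) (w j))"
    by (rule eigenvalue_upper_bound) (use assms in blast)+
  then obtain x where x: "\<exists>i<n. x i \<noteq> 0"
    "kth_eigenvalue m n * (\<Sum>i<n. \<Sum>j<n. x i * x j * B (w i) (w j)) \<le> (\<Sum>i<n. \<Sum>j<n. x i * x j * A (w i) (w j))" by blast
  have p: "0 < (\<Sum>i<n. \<Sum>j<n. x i * x j * B (w i) (w j))" by (rule pos[OF x(1)])
  show "kth_eigenvalue m n < T"
    if "\<And>x. \<exists>i<n. x i \<noteq> 0 \<Longrightarrow> (\<Sum>i<n. \<Sum>j<n. x i * x j * A (w i) (w j)) < T * (\<Sum>i<n. \<Sum>j<n. x i * x j * B (w i) (w j))"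
  proof -
    have "kth_eigenvalue m n * (\<Sum>i<n. \<Sum>j<n. x i * x j * B (w i) (w j)) < T * (\<Sum>i<n. \<Sum>j<n. x i * x j * B (w i) (w j))"
      using x(2) that[OF x(1)] by (rule order_le_less_trans)
    then show ?thesis using p by simp
  qed
  show "kth_eigenvalue m n \<le> T"
    if "\<And>x. \<exists>i<n. x i \<noteq> 0 \<Longrightarrow> (\<Sum>i<n. \<Sum>j<n. x i * x j * A (w i) (w j)) \<le> T * (\<Sum>i<n. \<Sum>j<n. x i * x j * B (w i) (w j))"
  proof -
    have "kth_eigenvalue m n * (\<Sum>i<n. \<Sum>j<n. x i * x j * B (w i) (w j)) \<le> T * (\<Sum>i<n. \<Sum>j<n. x i * x j * B (w i) (w j))"
      using x(2) that[OF x(1)] by (rule order_trans)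
    then show ?thesis using p by simp
  qed
qed

end

section \<open>Numerical inequalities\<close>

text \<open>The polynomial inequalities below are certified by Bernstein expansions with positive coefficients.\<close>

lemma poly_pos_1:
  fixes r :: real
  assumes "17 / 50 \<le> r" "r \<le> 25 / 50"
  shows "0 < 233 * (1 + r) ^ 4 - (10 * (1 + r\<^sup>2) * (1 + r)\<^sup>2 - 72 * r\<^sup>2) * (200 * (1 + r)\<^sup>2 - 360)"
proof -
  \<comment> \<open>Scaled distances to the endpoints. Since \<open>a + b\<close> is constant, its
    powers make the polynomial homogeneous in \<open>a\<close> and \<open>b\<close>; the large
    factor below clears the denominators.\<close>
  define a b where "a = 50 * r - 17" and "b = 25 - 50 * r"
  have ab: "0 \<le> a" "0 \<le> b" "a + b = 8" using assms by (auto simp: a_def b_def)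
  have "0 < 23798040089 * b ^ 6 + 122591720630 * a * b ^ 5 + 259043544215 * a ^ 2 * b ^ 4 + 288248968500 * a ^ 3 * b ^ 3 + 179169384375 * a ^ 4 * b ^ 2 + 59556093750 * a ^ 5 * b + 8384765625 * a ^ 6"
  proof (cases "a = 0")
    case True
    then show ?thesis using ab by simp
  next
    case False
    then show ?thesis using ab by (intro add_nonneg_pos add_nonneg_nonneg mult_nonneg_nonneg mult_pos_pos) auto
  qed
  also have "\<dots> = 8192000000000 * (233 * (1 + r) ^ 4 - (10 * (1 + r\<^sup>2) * (1 + r)\<^sup>2 - 72 * r\<^sup>2) * (200 * (1 + r)\<^sup>2 - 360))" unfolding a_def b_def by algebra
  finally show ?thesis by (rule zero_less_mult_pos) simp
qed

lemma poly_pos_2: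
  fixes r :: real
  assumes "13 / 20 \<le> r" "r \<le> 20 / 20"
  shows "0 < 1000 * (72 - 10 * (1 + r)\<^sup>2) * (72 * r\<^sup>2 - 10 * (1 + r)\<^sup>2) - 13142 * (1 + r) ^ 4"
proof -
  define a b where "a = 20 * r - 13" and "b = 20 - 20 * r"
  have ab: "0 \<le> a" "0 \<le> b" "a + b = 7" using assms by (auto simp: a_def b_def)
  have "0 < 3651803109 * b ^ 4 + 81017275680 * a * b ^ 3 + 226331337600 * a ^ 2 * b ^ 2 + 214824192000 * a ^ 3 * b + 65098240000 * a ^ 4"
  proof (cases "a = 0")
    case True
    then show ?thesis using ab by simp
  next
    case False
    then show ?thesis using ab by (intro add_nonneg_pos add_nonneg_nonneg mult_nonneg_nonneg mult_pos_pos) auto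
  qed
  also have "\<dots> = 192080000 * (1000 * (72 - 10 * (1 + r)\<^sup>2) * (72 * r\<^sup>2 - 10 * (1 + r)\<^sup>2) - 13142 * (1 + r) ^ 4)" unfolding a_def b_def by algebra
  finally show ?thesis by (rule zero_less_mult_pos) simp
qed

lemma poly_pos_3:
  fixes r :: real
  assumes "10 / 20 \<le> r" "r \<le> 13 / 20"
  shows "0 < 466 * (1 + r) ^ 4 - (10 * (1 + r\<^sup>2) * (1 + r)\<^sup>2 - 72 * r\<^sup>2) * (400 * (1 + r)\<^sup>2 - 720)"
proof -
  define a b where "a = 20 * r - 10" and "b = 13 - 20 * r"
  have ab: "0 \<le> a" "0 \<le> b" "a + b = 3" using assms by (auto simp: a_def b_def)
  have "0 < 530000 * b ^ 6 + 2632000 * a * b ^ 5 + 5607800 * a ^ 2 * b ^ 4 + 6740520 * a ^ 3 * b ^ 3 + 4921493 * a ^ 4 * b ^ 2 + 2070526 * a ^ 5 * b + 383708 * a ^ 6"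
  proof (cases "a = 0")
    case True
    then show ?thesis using ab by simp
  next
    case False
    then show ?thesis using ab by (intro add_nonneg_pos add_nonneg_nonneg mult_nonneg_nonneg mult_pos_pos) auto
  qed
  also have "\<dots> = 720000 * (466 * (1 + r) ^ 4 - (10 * (1 + r\<^sup>2) * (1 + r)\<^sup>2 - 72 * r\<^sup>2) * (400 * (1 + r)\<^sup>2 - 720))" unfolding a_def b_def by algebra
  finally show ?thesis by (rule zero_less_mult_pos) simp
qed

text \<open>The determinant condition for M on the segment \<open>k = 4 / 3 * (r - 1 / 2)\<close>,
  after division by the factor \<open>2 * r - 1\<close>, which vanishes at the degenerate
  point.\<close>

lemma poly_pos_4:
  fixes r :: real
  assumes "10 / 20 \<le> r" "r \<le> 13 / 20"
  shows "0 < 932 * (1 + r) ^ 4 - 300 * (2 * r\<^sup>2 * (1 + r)\<^sup>2 - (2 * r - 1) * (3 - 2 * (2 * r - 1) - 3 * (2 * r - 1)\<^sup>2)) * (12 + (2 * r - 1))"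
proof -
  define a b where "a = 20 * r - 10" and "b = 13 - 20 * r"
  have ab: "0 \<le> a" "0 \<le> b" "a + b = 3" using assms by (auto simp: a_def b_def)
  have "0 < 330000 * b ^ 5 + 2532000 * a * b ^ 4 + 6207800 * a ^ 2 * b ^ 3 + 6529720 * a ^ 3 * b ^ 2 + 2907673 * a ^ 4 * b + 383708 * a ^ 5"
  proof (cases "a = 0")
    case True
    then show ?thesis using ab by simp
  next
    case False
    then show ?thesis using ab by (intro add_nonneg_pos add_nonneg_nonneg mult_nonneg_nonneg mult_pos_pos) auto
  qed
  also have "\<dots> = 120000 * (932 * (1 + r) ^ 4 - 300 * (2 * r\<^sup>2 * (1 + r)\<^sup>2 - (2 * r - 1) * (3 - 2 * (2 * r - 1) - 3 * (2 * r - 1)\<^sup>2)) * (12 + (2 * r - 1)))" unfolding a_def b_def by algebra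
  finally show ?thesis by (rule zero_less_mult_pos) simp
qed

lemma poly_pos_5a:
  fixes v :: real
  assumes "2 / 4 \<le> v" "v \<le> 3 / 4"
  shows "0 < 3831250 - 262150 * (v * (4 + v)\<^sup>2) + 10486 * v * (v * (4 + v)\<^sup>2)\<^sup>2 - 5257 * (v * (4 + v)\<^sup>2)\<^sup>2"
proof -
  define a b where "a = 4 * v - 2" and "b = 3 - 4 * v"
  have ab: "0 \<le> a" "0 \<le> b" "a + b = 1" using assms by (auto simp: a_def b_def)
  have "0 < 9630073088 * b ^ 7 + 56309839040 * a * b ^ 6 + 137037423488 * a ^ 2 * b ^ 5 + 178638049296 * a ^ 3 * b ^ 4 + 133486710672 * a ^ 4 * b ^ 3 + 56601741588 * a ^ 5 * b ^ 2 + 12557351968 * a ^ 6 * b + 1161934535 * a ^ 7"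
  proof (cases "a = 0")
    case True
    then show ?thesis using ab by simp
  next
    case False
    then show ?thesis using ab by (intro add_nonneg_pos add_nonneg_nonneg mult_nonneg_nonneg mult_pos_pos) auto
  qed
  also have "\<dots> = 8192 * (3831250 - 262150 * (v * (4 + v)\<^sup>2) + 10486 * v * (v * (4 + v)\<^sup>2)\<^sup>2 - 5257 * (v * (4 + v)\<^sup>2)\<^sup>2)" unfolding a_def b_def by algebra
  finally show ?thesis by (rule zero_less_mult_pos) simp
qed

lemma poly_pos_5b:
  fixes v :: real
  assumes "3 / 4 \<le> v" "v \<le> 4 / 4"
  shows "0 < 3831250 - 262150 * (v * (4 + v)\<^sup>2) + 10486 * v * (v * (4 + v)\<^sup>2)\<^sup>2 - 5257 * (v * (4 + v)\<^sup>2)\<^sup>2"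
proof -
  define a b where "a = 4 * v - 3" and "b = 4 - 4 * v"
  have ab: "0 \<le> a" "0 \<le> b" "a + b = 1" using assms by (auto simp: a_def b_def)
  have "0 < 1161934535 * b ^ 7 + 3709731522 * a * b ^ 6 + 3516018912 * a ^ 2 * b ^ 5 + 4431256928 * a ^ 3 * b ^ 4 + 16321052160 * a ^ 4 * b ^ 3 + 26304678400 * a ^ 5 * b ^ 2 + 17916416000 * a ^ 6 * b + 4469760000 * a ^ 7"
  proof (cases "a = 0")
    case True
    then show ?thesis using ab by simp
  next
    case False
    then show ?thesis using ab by (intro add_nonneg_pos add_nonneg_nonneg mult_nonneg_nonneg mult_pos_pos) auto
  qed
  also have "\<dots> = 8192 * (3831250 - 262150 * (v * (4 + v)\<^sup>2) + 10486 * v * (v * (4 + v)\<^sup>2)\<^sup>2 - 5257 * (v * (4 + v)\<^sup>2)\<^sup>2)" unfolding a_def b_def by algebra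
  finally show ?thesis by (rule zero_less_mult_pos) simp
qed

section \<open>Bounds for pi and for the first zero of the Bessel function\<close>

lemma pi_sq_bounds: "9.8692 \<le> pi\<^sup>2" "pi\<^sup>2 \<le> 9.8697"
proof -
  have "3.14153\<^sup>2 \<le> pi\<^sup>2" using pi_approx by (intro power_mono) auto
  then show "9.8692 \<le> pi\<^sup>2" by (simp add: power2_eq_square)
  have "pi\<^sup>2 \<le> 3.1416\<^sup>2" using pi_approx by (intro power_mono) auto
  then show "pi\<^sup>2 \<le> 9.8697" by (simp add: power2_eq_square)
qed

lemma pi_pow4_bounds: "97.4 \<le> pi ^ 4" "pi ^ 4 \<le> 97.42"
proof -
  have eq: "pi ^ 4 = pi\<^sup>2 * pi\<^sup>2" by (simp flip: power_add)
  have "9.8692 * 9.8692 \<le> pi\<^sup>2 * pi\<^sup>2" using pi_sq_bounds by (intro mult_mono) auto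
  then show "97.4 \<le> pi ^ 4" unfolding eq by simp
  have "pi\<^sup>2 * pi\<^sup>2 \<le> 9.8697 * 9.8697" using pi_sq_bounds by (intro mult_mono) auto
  then show "pi ^ 4 \<le> 97.42" unfolding eq by simp
qed

lemma summable_bessel: "summable (\<lambda>n. (-1) ^ n / (fact n)\<^sup>2 * y ^ n :: real)"
proof (rule summable_comparison_test'[where N = 0])
  show "summable (\<lambda>n. inverse (fact n) * \<bar>y\<bar> ^ n)" by (rule summable_exp)
  show "norm ((-1) ^ n / (fact n)\<^sup>2 * y ^ n) \<le> inverse (fact n) * \<bar>y\<bar> ^ n" for n
  proof -
    have "(1::real) / (fact n)\<^sup>2 \<le> 1 / fact n"
      by (rule divide_left_mono) (auto simp: power2_eq_square)
    then have "1 / (fact n)\<^sup>2 * \<bar>y\<bar> ^ n \<le> 1 / fact n * \<bar>y\<bar> ^ n"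
      by (rule mult_right_mono) simp
    then show ?thesis by (simp add: abs_mult power_abs inverse_eq_divide)
  qed
qed

lemma bessel_J0_powser: "bessel_J0 x = (\<Sum>n. (-1) ^ n / (fact n)\<^sup>2 * ((x / 2)\<^sup>2) ^ n)"
  by (simp add: bessel_J0_def power_mult)

lemma continuous_bessel_J0: "continuous_on UNIV bessel_J0"
proof -
  have "isCont (\<lambda>y. \<Sum>n. (-1) ^ n / (fact n)\<^sup>2 * y ^ n) (y :: real)" for y
    using summable_bessel by (intro isCont_powser_converges_everywhere)
  then have "continuous_on UNIV (\<lambda>y :: real. \<Sum>n. (-1) ^ n / (fact n)\<^sup>2 * y ^ n)"
    by (simp add: continuous_on_eq_continuous_at)
  then have "continuous_on UNIV ((\<lambda>y :: real. \<Sum>n. (-1) ^ n / (fact n)\<^sup>2 * y ^ n) \<circ> (\<lambda>x. (x / 2)\<^sup>2))"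
    by (intro continuous_on_compose continuous_intros) (auto elim: continuous_on_subset)
  then show ?thesis
    by (rule continuous_on_cong[THEN iffD1, rotated -1]) (auto simp: bessel_J0_powser)
qed

lemma bessel_J0_zero: "bessel_J0 0 = 1"
proof -
  have "(\<lambda>n. (-1) ^ n / (fact n)\<^sup>2 * (0 / 2 :: real) ^ (2 * n)) sums ((-1) ^ 0 / (fact 0)\<^sup>2 * (0 / 2) ^ (2 * 0))"
    by (rule sums_single[THEN sums_cong[THEN iffD1, rotated]]) auto
  then show ?thesis by (simp add: bessel_J0_def sums_iff)
qed

text \<open>The point 2.42 lies a little above the zero, yet 2 * 2.42 + pi is still below 8. Five
  terms of the series give about -0.0074, and the tail is geometric and below 0.00094.\<close>

lemma bessel_J0_negative: "bessel_J0 (242 / 100) < 0"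
proof -
  define y :: real where "y = 14641 / 10000"
  define f where "f n = (-1) ^ n / (fact n)\<^sup>2 * y ^ n" for n :: nat
  have y: "(242 / 100 / 2)\<^sup>2 = y" by (simp add: y_def power2_eq_square)
  have sf: "summable f" unfolding f_def by (rule summable_bessel)
  have "bessel_J0 (242 / 100) = suminf f" unfolding bessel_J0_powser y f_def ..
  also have "\<dots> = (\<Sum>n. f (n + 5)) + (\<Sum>n<5. f n)"
    using suminf_split_initial_segment[OF sf] by simp
  finally have split: "bessel_J0 (242 / 100) = (\<Sum>n. f (n + 5)) + (\<Sum>n<5. f n)" .
  have f_Suc: "f (Suc m) = f m * (- y / (real (Suc m))\<^sup>2)" for m
    by (simp add: f_def power_mult_distrib mult_ac)
  \<comment> \<open>14400 is the square of 5!. From here on consecutive terms shrink by a factor of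
    at most \<open>y / 36\<close>, well below 1/2.\<close>
  have b: "\<bar>f (n + 5)\<bar> \<le> y ^ 5 / 14400 * (1 / 2) ^ n" for n
  proof (induction n)
    case 0
    have "(fact 5 :: real) = 120" by (simp add: fact_numeral)
    then show ?case by (simp add: f_def y_def abs_mult)
  next
    case (Suc n)
    have "f (Suc n + 5) = f (n + 5) * (- y / (real (n + 6))\<^sup>2)"
      using f_Suc[of "n + 5"] by simp
    then have "\<bar>f (Suc n + 5)\<bar> = \<bar>f (n + 5)\<bar> * (y / (real (n + 6))\<^sup>2)"
      by (simp add: abs_mult y_def)
    also have "y / (real (n + 6))\<^sup>2 \<le> 1 / 2"
    proof -
      have "6\<^sup>2 \<le> (real (n + 6))\<^sup>2" by (rule power_mono) auto
      then show ?thesis by (simp add: y_def field_simps)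
    qed
    then have "\<bar>f (n + 5)\<bar> * (y / (real (n + 6))\<^sup>2) \<le> (y ^ 5 / 14400 * (1 / 2) ^ n) * (1 / 2)"
      using Suc by (intro mult_mono) (auto simp: y_def)
    finally show ?case by simp
  qed
  have g: "(\<lambda>n. y ^ 5 / 14400 * (1 / 2) ^ n) sums (y ^ 5 / 14400 * 2)"
    by (intro sums_mult) (use geometric_sums[of "1 / 2 :: real"] in simp)
  have "(\<Sum>n. f (n + 5)) \<le> (\<Sum>n. y ^ 5 / 14400 * (1 / 2) ^ n)"
    by (intro suminf_le abs_le_D1[OF b] summable_ignore_initial_segment[OF sf] sums_summable[OF g])
  also have "\<dots> = y ^ 5 / 14400 * 2" using g by (simp add: sums_iff)
  also have "\<dots> \<le> 0.00094" by (simp add: y_def power_divide)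
  finally have tail: "(\<Sum>n. f (n + 5)) \<le> 0.00094" .
  have "(\<Sum>n<5. f n) = 1 - y + y\<^sup>2 / 4 - y ^ 3 / 36 + y ^ 4 / 576"
    by (simp add: f_def eval_nat_numeral lessThan_Suc fact_reduce)
  also have "\<dots> < -0.007" by (simp add: y_def eval_nat_numeral)
  finally show ?thesis using split tail by simp
qed

text \<open>\<open>LEAST\<close> on the reals is determined only if a least element exists. The
  zeros in \<open>{0..2.42}\<close> form a compact set, nonempty by the intermediate value theorem,
  and its minimum is positive because the function equals 1 at the origin.\<close>

lemma j01_bounds: "0 < j01" "j01 \<le> 2.42"
proof -
  let ?K = "{x \<in> {0..242 / 100}. bessel_J0 x = 0}"
  have cont: "continuous_on {0..242 / 100} bessel_J0"
    using continuous_bessel_J0 by (rule continuous_on_subset) auto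
  have cK: "compact ?K"
  proof -
    have "closed ?K" using cont by (intro continuous_closed_preimage_constant) auto
    moreover have "bounded ?K" by (rule bounded_subset[of "{0..242 / 100}"]) auto
    ultimately show ?thesis by (simp add: compact_eq_bounded_closed)
  qed
  have neK: "?K \<noteq> {}"
  proof -
    have "\<exists>x\<ge>0. x \<le> 242 / 100 \<and> bessel_J0 x = 0"
      using bessel_J0_zero bessel_J0_negative cont by (intro IVT2') auto
    then show ?thesis by auto
  qed
  obtain x where x: "x \<in> ?K" "\<forall>y\<in>?K. x \<le> y"
    by (rule bexE[OF compact_attains_inf[OF cK neK]])
  have x0: "0 < x" using x(1) bessel_J0_zero by (cases "x = 0") auto
  have "j01 = x" unfolding j01_def
  proof (rule Least_equality)
    show "0 < x \<and> bessel_J0 x = 0" using x x0 by simp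
    show "x \<le> y" if "0 < y \<and> bessel_J0 y = 0" for y
    proof (cases "y \<le> 242 / 100")
      case True
      then show ?thesis using x(2) that by simp
    next
      case False
      then show ?thesis using x(1) by simp
    qed
  qed
  then show "0 < j01" "j01 \<le> 2.42" using x x0 by auto
qed

lemma kroeger_constant: "(2 * j01 + pi)\<^sup>2 \<le> 64"
proof -
  have "(2 * j01 + pi)\<^sup>2 \<le> 8\<^sup>2"
    using j01_bounds pi_approx by (intro power_mono) auto
  then show ?thesis by simp
qed

text \<open>The hypothesis gives \<open>c > r / sqrt 5\<close>, and 0.447 is just below
  \<open>1 / sqrt 5\<close>. The inequality is tightest at \<open>r = 1\<close>, where it reads 256
  against about 257.\<close>

lemma kroeger_region:
  fixes c r :: real
  assumes "0 \<le> c" "c \<le> r" "0 < r" "r\<^sup>2 < 5 * c\<^sup>2"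
  shows "64 * (1 + r)\<^sup>2 < 9 * pi\<^sup>2 * (1 + 2 * c + r\<^sup>2)"
proof -
  have "(447 / 1000 * r)\<^sup>2 = 199809 / 1000000 * r\<^sup>2" by algebra
  then have "(447 / 1000 * r)\<^sup>2 \<le> c\<^sup>2" using assms(4) zero_le_power2[of r] by linarith
  then have c: "447 / 1000 * r \<le> c" by (rule power2_le_imp_le) (use assms in simp)
  have "0 \<le> (1 - r)\<^sup>2" by simp
  then have "2 * r \<le> 1 + r\<^sup>2" by (simp add: power2_eq_square algebra_simps)
  then have "64 * (1 + r)\<^sup>2 < 88.822 * (1 + 2 * c + r\<^sup>2)"
    using c assms by (simp add: power2_sum)
  also have "\<dots> \<le> 9 * pi\<^sup>2 * (1 + 2 * c + r\<^sup>2)"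
    using pi_sq_bounds assms by (intro mult_right_mono) auto
  finally show ?thesis .
qed

text \<open>The second claim says that \<open>T - L\<close> has positive determinant, after scaling
  by \<open>d\<^sup>2 / pi\<^sup>2\<close>; 0.6571 is 64 / pi^4 rounded up. Both sides tend to 0 at
  the degenerate point, so each is compared with a multiple of \<open>e = r - 1 / 2\<close>: about
  0.370 \<open>e\<close> on the left, 0.450 \<open>e\<close> on the right.\<close>

lemma det_L_near:
  fixes r k :: real
  assumes "1 / 2 < r" "r \<le> 13 / 20" "0 \<le> k" "k \<le> 4 / 3 * (r - 1 / 2)"
  defines "Y \<equiv> 9 * r\<^sup>2 * (1 - k) / (1 + r)\<^sup>2"
  shows "1 < Y" and "0.6571 * (r\<^sup>2 * k) < (Y - r\<^sup>2) * (Y - 1)"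
proof -
  define e where "e = r - 1 / 2"
  have e: "0 < e" "e \<le> 3 / 20" "r = 1 / 2 + e" using assms by (auto simp: e_def)
  have ee: "e\<^sup>2 \<le> (3 / 20)\<^sup>2" using e by (intro power_mono) auto
  have r2: "r\<^sup>2 \<le> (13 / 20)\<^sup>2" using e by (intro power_mono) auto
  have t: "0 < (1 + r)\<^sup>2" "(1 + r)\<^sup>2 \<le> (33 / 20)\<^sup>2" using e by (auto intro!: power_mono)
  \<comment> \<open>The constant 0.78 is nearly the best for the interval: at
    \<open>e = 3 / 20\<close> the comparison below is 2.124 against 2.13.\<close>
  have "0.78 * e * (1 + r)\<^sup>2 \<le> 0.78 * e * (33 / 20)\<^sup>2" using t e by (intro mult_left_mono) auto
  also have "\<dots> \<le> e * (3 - 4 * e - 12 * e\<^sup>2)"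
  proof -
    have "0.78 * (33 / 20)\<^sup>2 \<le> 3 - 4 * e - 12 * e\<^sup>2" using e ee by (simp add: power2_eq_square)
    then show ?thesis using e mult_left_mono[of _ _ e] by (simp add: mult_ac)
  qed
  also have "\<dots> = 9 * r\<^sup>2 * (1 - 4 / 3 * e) - (1 + r)\<^sup>2"
    unfolding e(3) by (simp add: power2_eq_square algebra_simps)
  also have "\<dots> \<le> 9 * r\<^sup>2 * (1 - k) - (1 + r)\<^sup>2"
    using assms by (intro diff_right_mono mult_left_mono) (auto simp: e_def)
  also have "\<dots> = (Y - 1) * (1 + r)\<^sup>2" using t by (simp add: Y_def field_simps)
  finally have Y: "0.78 * e \<le> Y - 1" using t by simp
  then show "1 < Y" using e by simp
  have "0.6571 * (r\<^sup>2 * k) \<le> 0.6571 * ((13 / 20)\<^sup>2 * (4 / 3 * e))"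
    using r2 assms by (intro mult_left_mono mult_mono) (auto simp: e_def)
  also have "\<dots> < 0.5775 * (0.78 * e)" using e by (simp add: power2_eq_square)
  also have "\<dots> \<le> (Y - r\<^sup>2) * (Y - 1)"
    using Y r2 e by (intro mult_mono) (auto simp: power2_eq_square)
  finally show "0.6571 * (r\<^sup>2 * k) < (Y - r\<^sup>2) * (Y - 1)" .
qed

text \<open>Away from the degenerate point there is room to insert the worst value
  \<open>k = 1 / 5\<close> everywhere, which turns \<open>9 * (1 - k)\<close> into 7.2 and leaves
  the polynomial inequality \<open>poly_pos_2\<close> in \<open>r\<close>.\<close>

lemma det_L_far:
  fixes r k :: real
  assumes "13 / 20 \<le> r" "r \<le> 1" "0 \<le> k" "k \<le> 1 / 5"
  defines "Y \<equiv> 9 * r\<^sup>2 * (1 - k) / (1 + r)\<^sup>2"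
  shows "1 < Y" and "0.6571 * (r\<^sup>2 * k) < (Y - r\<^sup>2) * (Y - 1)"
proof -
  define t where "t = (1 + r)\<^sup>2"
  have t: "0 < t" using assms by (simp add: t_def)
  have r2: "r\<^sup>2 \<le> 1" using assms by (simp add: power_le_one)
  have u: "13 / 33 * (1 + r) \<le> r" using assms by simp
  then have "(13 / 33 * (1 + r))\<^sup>2 \<le> r\<^sup>2" using assms by (intro power_mono) auto
  moreover have "(13 / 33 * (1 + r))\<^sup>2 = 169 / 1089 * t" unfolding t_def by algebra
  ultimately have "169 / 1089 * t \<le> r\<^sup>2" by simp
  then have Y0: "t < 7.2 * r\<^sup>2" using t by simp
  have Y1: "7.2 * r\<^sup>2 \<le> Y * t" using assms t by (simp add: Y_def flip: t_def)
  have "t * 1 < t * Y" using Y0 Y1 by (simp add: mult_ac)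
  then show "1 < Y" using t by simp
  have t4: "t \<le> 4"
  proof -
    have "t \<le> 2\<^sup>2" unfolding t_def using assms by (intro power_mono) auto
    then show ?thesis by simp
  qed
  have Yr: "r\<^sup>2 * (7.2 - t) \<le> (Y - r\<^sup>2) * t" using Y1 by (simp add: algebra_simps)
  have YY: "7.2 * r\<^sup>2 - t \<le> (Y - 1) * t" using Y1 by (simp add: algebra_simps)
  have "0 \<le> r\<^sup>2 * (7.2 - t)" using t4 by (intro mult_nonneg_nonneg) auto
  then have Yr0: "0 \<le> (Y - r\<^sup>2) * t" using Yr by (rule order_trans)
  have "0.6571 * (r\<^sup>2 * k) * t\<^sup>2 \<le> 0.6571 * (r\<^sup>2 * (1 / 5)) * t\<^sup>2"
    using assms by (intro mult_right_mono mult_left_mono) auto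
  also have "\<dots> < r\<^sup>2 * ((7.2 - t) * (7.2 * r\<^sup>2 - t))"
  proof -
    have "13142 * t\<^sup>2 < 100000 * ((7.2 - t) * (7.2 * r\<^sup>2 - t))"
      using poly_pos_2[OF assms(1)] assms(2)
      by (simp add: t_def algebra_simps flip: power_mult)
    then have "0.6571 * (1 / 5) * t\<^sup>2 < (7.2 - t) * (7.2 * r\<^sup>2 - t)" by simp
    then show ?thesis using mult_strict_left_mono[of _ _ "r\<^sup>2"] assms(1) by (simp add: mult_ac)
  qed
  also have "\<dots> = r\<^sup>2 * (7.2 - t) * (7.2 * r\<^sup>2 - t)" by simp
  also have "\<dots> \<le> (Y - r\<^sup>2) * t * ((Y - 1) * t)"
    using Y0 by (intro mult_mono[OF Yr YY Yr0]) auto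
  also have "\<dots> = (Y - r\<^sup>2) * (Y - 1) * t\<^sup>2" by (simp add: power2_eq_square)
  finally show "0.6571 * (r\<^sup>2 * k) < (Y - r\<^sup>2) * (Y - 1)" by (rule mult_right_less_imp_less) simp
qed

text \<open>Either a diagonal entry or the determinant shows that M has an eigenvalue below
  \<open>T\<close>; 2.33 is 2048 / (9 pi^4) rounded down. The factor
  \<open>4 * r\<^sup>2 - Y\<close> vanishes at the degenerate point; for
  \<open>r \<le> 1 / 2\<close> it is bounded by a multiple of \<open>k\<close>, which cancels
  against the \<open>k\<close> on the right.\<close>

lemma det_M_small:
  fixes r k :: real
  assumes "0 < r" "r \<le> 1 / 2" "0 \<le> k" "k \<le> 1 / 5" "r < 1 / 2 \<or> 0 < k"
  defines "Y \<equiv> 9 * r\<^sup>2 * (1 - k) / (1 + r)\<^sup>2"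
  shows "4 * r\<^sup>2 < Y \<or> (1 + r\<^sup>2 - Y) * (4 * r\<^sup>2 - Y) < 2.33 * (r\<^sup>2 * k)"
proof (cases "4 * r\<^sup>2 < Y")
  case False
  define t where "t = (1 + r)\<^sup>2"
  define \<rho> where "\<rho> = 9 / t"
  have t: "0 < t" using assms by (simp add: t_def)
  have "t \<le> (3 / 2)\<^sup>2" unfolding t_def using assms by (intro power_mono) auto
  then have \<rho>4: "4 \<le> \<rho>" using t by (simp add: \<rho>_def field_simps power2_eq_square)
  have \<rho>4': "4 < \<rho>" if "r < 1 / 2"
  proof -
    have "t < (3 / 2)\<^sup>2" unfolding t_def using assms that by (intro power_strict_mono) auto
    then show ?thesis using t by (simp add: \<rho>_def field_simps power2_eq_square)
  qed
  have Y: "Y = r\<^sup>2 * (\<rho> * (1 - k))" by (simp add: Y_def \<rho>_def t_def)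
  have X: "\<rho> * (1 - k) \<le> 4" using False assms(1) by (simp add: Y mult.commute)
  have k: "0 < k"
  proof (rule ccontr)
    assume "\<not> 0 < k"
    then have "k = 0" "r < 1 / 2" using assms(3,5) by auto
    then show False using X \<rho>4' by simp
  qed
  \<comment> \<open>This is the linear bound in \<open>k\<close> announced above, with equality at
    \<open>k = 1 / 5\<close>.\<close>
  have "(\<rho> - 4) * (1 - 5 * k) \<ge> 0" using \<rho>4 assms by (intro mult_nonneg_nonneg) auto
  then have q: "4 - \<rho> * (1 - k) \<le> k * (20 - 4 * \<rho>)" by (simp add: algebra_simps)
  define P where "P = 1 + r\<^sup>2 - 0.8 * (r\<^sup>2 * \<rho>)"
  have p: "1 + r\<^sup>2 - Y \<le> P"
    using mult_left_mono[of "0.8" "1 - k" "r\<^sup>2 * \<rho>"] assms(4) \<rho>4 unfolding P_def Y by (simp add: mult_ac)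
  have P0: "0 \<le> P"
  proof -
    have "r * 3 \<le> 1 + r" using assms by simp
    then have "(r * 3)\<^sup>2 \<le> t" unfolding t_def using assms by (intro power_mono) auto
    then have "r\<^sup>2 * \<rho> \<le> 1" using t by (simp add: \<rho>_def field_simps power_mult_distrib)
    then show ?thesis unfolding P_def using zero_le_power2[of r] by linarith
  qed
  \<comment> \<open>For \<open>r \<le> 17 / 50\<close> the second factor is not positive, because
    \<open>\<rho>\<close> is at least 5; only the interval up to 1/2 calls for the polynomial
    bound.\<close>
  have main: "P * (20 - 4 * \<rho>) < 2.33"
  proof (cases "r \<le> 17 / 50")
    case True
    have "t \<le> (67 / 50)\<^sup>2" unfolding t_def using assms True by (intro power_mono) auto
    then have "5 \<le> \<rho>" using t by (simp add: \<rho>_def field_simps power2_eq_square)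
    then have "P * (20 - 4 * \<rho>) \<le> 0" using P0 by (simp add: mult_nonneg_nonpos)
    then show ?thesis by simp
  next
    case False
    have "0 < 233 * t\<^sup>2 - (10 * (1 + r\<^sup>2) * t - 72 * r\<^sup>2) * (200 * t - 360)"
      using poly_pos_1[of r] False assms(2) by (simp add: t_def flip: power_mult)
    also have "\<dots> = t\<^sup>2 * (233 - 100 * (P * (20 - 4 * \<rho>)))"
      using t by (simp add: P_def \<rho>_def field_simps power2_eq_square)
    finally show ?thesis using t by (simp add: zero_less_mult_iff)
  qed
  have "(1 + r\<^sup>2 - Y) * (4 - \<rho> * (1 - k)) \<le> P * (k * (20 - 4 * \<rho>))"
    using p q P0 X by (meson diff_ge_0_iff_ge mult_left_mono mult_right_mono order_trans)
  also have "\<dots> < 2.33 * k" using mult_strict_right_mono[OF main k] by (simp add: mult_ac)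
  finally have "r\<^sup>2 * ((1 + r\<^sup>2 - Y) * (4 - \<rho> * (1 - k))) < r\<^sup>2 * (2.33 * k)"
    using assms(1) by (intro mult_strict_left_mono) auto
  then show ?thesis by (simp add: Y algebra_simps)
qed simp

text \<open>For fixed \<open>r\<close> the difference of the two sides is a convex quadratic in
  \<open>k\<close>, so it suffices to look at the ends of the range,
  \<open>k1 = 4 / 3 * (r - 1 / 2)\<close> and 1/5. At \<open>k1\<close> it carries the factor
  \<open>2 * r - 1\<close>, hence is zero exactly at the degenerate point, which
  \<open>0 < k\<close> excludes.\<close>

lemma det_M_near:
  fixes r k :: real
  assumes "1 / 2 \<le> r" "r \<le> 13 / 20" "4 / 3 * (r - 1 / 2) \<le> k" "k \<le> 1 / 5" "0 < k"
  defines "Y \<equiv> 9 * r\<^sup>2 * (1 - k) / (1 + r)\<^sup>2"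
  shows "(1 + r\<^sup>2 - Y) * (4 * r\<^sup>2 - Y) < 2.33 * (r\<^sup>2 * k)"
proof -
  define t where "t = (1 + r)\<^sup>2"
  define \<rho> where "\<rho> = 9 / t"
  have t: "0 < t" using assms by (simp add: t_def)
  define f where "f k = (1 + r\<^sup>2 - r\<^sup>2 * \<rho> * (1 - k)) * (4 - \<rho> * (1 - k)) - 2.33 * k" for k
  define k1 where "k1 = 4 / 3 * (r - 1 / 2)"
  have k1: "0 \<le> k1" "k1 \<le> k" "k1 \<le> 1 / 5" using assms by (auto simp: k1_def)
  have f5: "f (1 / 5) < 0"
  proof -
    have "0 < 466 * t\<^sup>2 - (10 * (1 + r\<^sup>2) * t - 72 * r\<^sup>2) * (400 * t - 720)"
      using poly_pos_3[of r] assms(1,2) by (simp add: t_def flip: power_mult)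
    also have "\<dots> = - (t\<^sup>2 * 1000 * f (1 / 5))"
      using t by (simp add: f_def \<rho>_def field_simps power2_eq_square)
    finally show ?thesis using t by (simp add: mult_less_0_iff)
  qed
  have f1: "- (300 * t\<^sup>2 * f k1) =
      (2 * r - 1) / 2 * (932 * t\<^sup>2 - 300 * (2 * r\<^sup>2 * t - (2 * r - 1) * (3 - 2 * (2 * r - 1) - 3 * (2 * r - 1)\<^sup>2)) * (12 + (2 * r - 1)))"
  proof -
    have "t * (4 - \<rho> * (1 - k1)) = 4 * t - 9 * (1 - k1)" using t by (simp add: \<rho>_def field_simps)
    moreover have "t * (1 + r\<^sup>2 - r\<^sup>2 * \<rho> * (1 - k1)) = (1 + r\<^sup>2) * t - 9 * r\<^sup>2 * (1 - k1)"
      using t by (simp add: \<rho>_def field_simps)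
    moreover have "t\<^sup>2 * f k1 = (t * (1 + r\<^sup>2 - r\<^sup>2 * \<rho> * (1 - k1))) * (t * (4 - \<rho> * (1 - k1))) - 2.33 * k1 * t\<^sup>2"
      unfolding f_def by algebra
    ultimately have "t\<^sup>2 * f k1 = ((1 + r\<^sup>2) * t - 9 * r\<^sup>2 * (1 - k1)) * (4 * t - 9 * (1 - k1)) - 2.33 * k1 * t\<^sup>2"
      by simp
    then show ?thesis unfolding k1_def t_def by (simp add: field_simps) algebra
  qed
  have pos: "0 < 932 * t\<^sup>2 - 300 * (2 * r\<^sup>2 * t - (2 * r - 1) * (3 - 2 * (2 * r - 1) - 3 * (2 * r - 1)\<^sup>2)) * (12 + (2 * r - 1))"
    using poly_pos_4[of r] assms(1,2) by (simp add: t_def flip: power_mult)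
  have "0 \<le> - (300 * t\<^sup>2 * f k1)" unfolding f1 using pos assms(1) by (intro mult_nonneg_nonneg) auto
  then have fk1: "f k1 \<le> 0" using t by (simp add: mult_le_0_iff)
  have fk1': "f k1 < 0" if "1 / 2 < r"
  proof -
    have "0 < - (300 * t\<^sup>2 * f k1)" unfolding f1 using pos that by (intro mult_pos_pos) auto
    then show ?thesis using t by (simp add: mult_less_0_iff)
  qed
  have "f k < 0"
  proof (cases "k = k1")
    case True
    then have "1 / 2 < r" using assms(5) unfolding k1_def by simp
    then show ?thesis using fk1' True by simp
  next
    case False
    \<comment> \<open>Convexity as an identity: the chord minus a correction with the leading
      coefficient \<open>(r * \<rho>)\<^sup>2\<close>.\<close>
    have conv: "f k * (1 / 5 - k1) = f k1 * (1 / 5 - k) + f (1 / 5) * (k - k1) - (r * \<rho>)\<^sup>2 * ((1 / 5 - k1) * (1 / 5 - k) * (k - k1))"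
      unfolding f_def by algebra
    have "f k1 * (1 / 5 - k) \<le> 0" using fk1 assms(4) by (simp add: mult_nonpos_nonneg)
    moreover have "f (1 / 5) * (k - k1) < 0" using f5 False k1 by (simp add: mult_neg_pos)
    moreover have "0 \<le> (r * \<rho>)\<^sup>2 * ((1 / 5 - k1) * (1 / 5 - k) * (k - k1))" using k1 assms(4) by simp
    ultimately have "f k * (1 / 5 - k1) < 0" unfolding conv by linarith
    then show ?thesis using k1 by (simp add: mult_less_0_iff)
  qed
  then have "r\<^sup>2 * f k < 0" using assms(1) by (simp add: mult_less_0_iff)
  moreover have "Y = r\<^sup>2 * \<rho> * (1 - k)" by (simp add: Y_def \<rho>_def t_def)
  then have "(1 + r\<^sup>2 - Y) * (4 * r\<^sup>2 - Y) - 2.33 * (r\<^sup>2 * k) = r\<^sup>2 * f k"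
    unfolding f_def by algebra
  ultimately show ?thesis by linarith
qed

lemma pos_def_2:
  fixes p q g x y :: real
  assumes "0 < p" "g\<^sup>2 < p * q" "x \<noteq> 0 \<or> y \<noteq> 0"
  shows "0 < p * x\<^sup>2 + 2 * g * x * y + q * y\<^sup>2"
proof -
  have "p * (p * x\<^sup>2 + 2 * g * x * y + q * y\<^sup>2) = (p * x + g * y)\<^sup>2 + (p * q - g\<^sup>2) * y\<^sup>2"
    by (simp add: power2_eq_square algebra_simps)
  also have "\<dots> > 0"
    using assms by (cases "y = 0") (auto simp: add_nonneg_pos)
  finally show ?thesis using assms(1) by (simp add: zero_less_mult_iff)
qed

lemma indefinite_2:
  fixes p q g :: real
  assumes "p < 0 \<or> q < 0 \<or> p * q < g\<^sup>2"
  shows "\<exists>x y. (x \<noteq> 0 \<or> y \<noteq> 0) \<and> p * x\<^sup>2 - 2 * g * x * y + q * y\<^sup>2 < 0"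
proof -
  consider "p < 0" | "q < 0" | "p = 0" "0 \<le> q" "p * q < g\<^sup>2" | "0 < p" "p * q < g\<^sup>2"
    using assms by linarith
  then show ?thesis
  proof cases
    case 1
    then show ?thesis by (intro exI[of _ 1] exI[of _ 0]) simp
  next
    case 2
    then show ?thesis by (intro exI[of _ 0] exI[of _ 1]) simp
  next
    case 3
    then have "g \<noteq> 0" by auto
    then show ?thesis using 3 by (intro exI[of _ "(q + 1) / (2 * g)"] exI[of _ 1]) simp
  next
    case 4
    \<comment> \<open>For \<open>y = p\<close> the choice \<open>x = g\<close> minimises the form in
      \<open>x\<close>.\<close>
    have "p * g\<^sup>2 - 2 * g * g * p + q * p\<^sup>2 = p * (p * q - g\<^sup>2)" by (simp add: power2_eq_square algebra_simps)
    also have "\<dots> < 0" using 4 by (simp add: mult_pos_neg)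
    finally show ?thesis using 4 by (intro exI[of _ g] exI[of _ p]) simp
  qed
qed

text \<open>The forms are those of \<open>d\<^sup>2\<close> times the matrices. The first
  alternative makes both eigenvalues of L smaller than \<open>T\<close>. The second provides one
  vector in the M block below \<open>T\<close>, and the inequality for the entry
  \<open>pi\<^sup>2 * r\<^sup>2\<close> adds one in the L block.\<close>

lemma trial_regions:
  fixes c d :: real
  assumes c: "0 \<le> c" and d: "0 < d" and le: "c\<^sup>2 + d\<^sup>2 \<le> 1" and ne: "(c, d) \<noteq> (0, 1 / 2)"
    and k: "5 * c\<^sup>2 \<le> c\<^sup>2 + d\<^sup>2"
  defines "r \<equiv> sqrt (c\<^sup>2 + d\<^sup>2)"
  defines "T \<equiv> 9 * pi\<^sup>2 / (1 + r)\<^sup>2"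
  shows "pi\<^sup>2 * r\<^sup>2 < T * d\<^sup>2"
    and "(\<forall>x y. x \<noteq> 0 \<or> y \<noteq> 0 \<longrightarrow> pi\<^sup>2 * (r\<^sup>2 * x\<^sup>2 + y\<^sup>2) - 16 * c * x * y < T * d\<^sup>2 * (x\<^sup>2 + y\<^sup>2)) \<or>
      (\<exists>x y. (x \<noteq> 0 \<or> y \<noteq> 0) \<and>
         pi\<^sup>2 * ((1 + r\<^sup>2) * x\<^sup>2 + 4 * r\<^sup>2 * y\<^sup>2) - 64 * sqrt 2 / 3 * c * x * y < T * d\<^sup>2 * (x\<^sup>2 + y\<^sup>2))" (is ?P)
proof -
  have r2: "r\<^sup>2 = c\<^sup>2 + d\<^sup>2" by (simp add: r_def)
  have r0: "0 < r" using d by (simp add: r_def add_nonneg_pos)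
  have r1: "r \<le> 1" using le by (simp add: r_def)
  define k where "k = c\<^sup>2 / r\<^sup>2"
  have c2: "c\<^sup>2 = r\<^sup>2 * k" using r0 by (simp add: k_def)
  have d2: "d\<^sup>2 = r\<^sup>2 * (1 - k)" using r2 c2 by (simp add: algebra_simps)
  have k0: "0 \<le> k" by (simp add: k_def)
  have "5 * c\<^sup>2 \<le> r\<^sup>2" using assms(5) r2 by simp
  then have k5: "k \<le> 1 / 5" using r0 by (simp add: k_def divide_le_eq)
  define Y where "Y = 9 * r\<^sup>2 * (1 - k) / (1 + r)\<^sup>2"
  have TY: "T * d\<^sup>2 = pi\<^sup>2 * Y" by (simp add: T_def Y_def d2)
  have t4: "(1 + r)\<^sup>2 \<le> 4" using r0 r1 power_mono[of "1 + r" 2 2] by simp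
  have "1 * (1 + r)\<^sup>2 < 9 * (1 - k)" using t4 k5 by simp
  then have "r\<^sup>2 * (1 * (1 + r)\<^sup>2) < r\<^sup>2 * (9 * (1 - k))" using r0 by simp
  then have "r\<^sup>2 < Y" using r0 by (simp add: Y_def field_simps)
  then show "pi\<^sup>2 * r\<^sup>2 < T * d\<^sup>2" unfolding TY by simp
  have degenerate: "\<not> (r = 1 / 2 \<and> k = 0)"
  proof
    assume a: "r = 1 / 2 \<and> k = 0"
    then have "c = 0" using c2 by simp
    moreover have "d\<^sup>2 = (1 / 2)\<^sup>2" using d2 a by simp
    then have "d = 1 / 2" using d by (simp add: power2_eq_iff_nonneg)
    ultimately show False using ne by simp
  qed
  have L: ?P if Y: "1 < Y" "0.6571 * (r\<^sup>2 * k) < (Y - r\<^sup>2) * (Y - 1)"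
  proof -
    \<comment> \<open>The square of the scaled coupling \<open>8 * c / pi\<^sup>2\<close> is 64 /
      pi^4 times \<open>c\<^sup>2\<close>.\<close>
    have "64 \<le> 0.6571 * pi ^ 4" using pi_pow4_bounds by simp
    then have "64 * c\<^sup>2 \<le> 0.6571 * pi ^ 4 * c\<^sup>2" by (rule mult_right_mono) simp
    then have "(8 * c / pi\<^sup>2)\<^sup>2 \<le> 0.6571 * c\<^sup>2"
      by (simp add: power_divide power_mult_distrib field_simps flip: power_mult)
    then have g: "(8 * c / pi\<^sup>2)\<^sup>2 < (Y - r\<^sup>2) * (Y - 1)" using Y c2 by simp
    have "pi\<^sup>2 * (r\<^sup>2 * x\<^sup>2 + y\<^sup>2) - 16 * c * x * y < T * d\<^sup>2 * (x\<^sup>2 + y\<^sup>2)" if "x \<noteq> 0 \<or> y \<noteq> 0" for x y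
    proof -
      have "0 < pi\<^sup>2 * ((Y - r\<^sup>2) * x\<^sup>2 + 2 * (8 * c / pi\<^sup>2) * x * y + (Y - 1) * y\<^sup>2)"
        using pos_def_2[OF _ g that] \<open>r\<^sup>2 < Y\<close> by simp
      also have "\<dots> = T * d\<^sup>2 * (x\<^sup>2 + y\<^sup>2) - (pi\<^sup>2 * (r\<^sup>2 * x\<^sup>2 + y\<^sup>2) - 16 * c * x * y)"
        unfolding TY by (simp add: field_simps)
      finally show ?thesis by simp
    qed
    then show ?P by blast
  qed
  have M: ?P if Y: "4 * r\<^sup>2 < Y \<or> (1 + r\<^sup>2 - Y) * (4 * r\<^sup>2 - Y) < 2.33 * (r\<^sup>2 * k)"
  proof -
    define g where "g = 32 * sqrt 2 * c / (3 * pi\<^sup>2)"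
    \<comment> \<open>Here the coupling has to be large, so its square, 2048 / (9 pi^4) times
      \<open>c\<^sup>2\<close>, is bounded from below.\<close>
    have "2.33 * 9 * pi ^ 4 \<le> 2048" using pi_pow4_bounds by simp
    then have "2.33 * 9 * pi ^ 4 * c\<^sup>2 \<le> 2048 * c\<^sup>2" by (rule mult_right_mono) simp
    then have "2.33 * c\<^sup>2 \<le> g\<^sup>2"
      by (simp add: g_def power_divide power_mult_distrib field_simps flip: power_mult)
    then have "1 + r\<^sup>2 - Y < 0 \<or> 4 * r\<^sup>2 - Y < 0 \<or> (1 + r\<^sup>2 - Y) * (4 * r\<^sup>2 - Y) < g\<^sup>2"
      using Y c2 by auto
    from indefinite_2[OF this] obtain x y where xy: "x \<noteq> 0 \<or> y \<noteq> 0"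
      and less: "(1 + r\<^sup>2 - Y) * x\<^sup>2 - 2 * g * x * y + (4 * r\<^sup>2 - Y) * y\<^sup>2 < 0" by blast
    have "pi\<^sup>2 * ((1 + r\<^sup>2) * x\<^sup>2 + 4 * r\<^sup>2 * y\<^sup>2) - 64 * sqrt 2 / 3 * c * x * y - T * d\<^sup>2 * (x\<^sup>2 + y\<^sup>2)
        = pi\<^sup>2 * ((1 + r\<^sup>2 - Y) * x\<^sup>2 - 2 * g * x * y + (4 * r\<^sup>2 - Y) * y\<^sup>2)"
      unfolding TY g_def by (simp add: field_simps)
    also have "\<dots> < 0" using less by (simp add: mult_pos_neg)
    finally show ?P using xy by auto
  qed
  consider "r \<le> 1 / 2" | "1 / 2 < r" "r \<le> 13 / 20" "k \<le> 4 / 3 * (r - 1 / 2)"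
    | "1 / 2 < r" "r \<le> 13 / 20" "4 / 3 * (r - 1 / 2) < k" | "13 / 20 < r"
    by linarith
  then show ?P
  proof cases
    case 1
    have "r < 1 / 2 \<or> 0 < k" using 1 degenerate k0 by auto
    from det_M_small[OF r0 1 k0 k5 this] show ?P unfolding Y_def[symmetric] by (rule M)
  next
    case 2
    from det_L_near[OF 2(1,2) k0 2(3)] show ?P unfolding Y_def[symmetric] by (rule L)
  next
    case 3
    then have "1 / 2 \<le> r" "4 / 3 * (r - 1 / 2) \<le> k" "0 < k" by auto
    from det_M_near[OF this(1) 3(2) this(2) k5 this(3)] show ?P
      unfolding Y_def[symmetric] by (intro M disjI2)
  next
    case 4
    from det_L_far[OF less_imp_le[OF 4] r1 k0 k5] show ?P unfolding Y_def[symmetric] by (rule L)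
  qed
qed

section \<open>Trigonometric estimates for the trial functions along the diagonal\<close>

lemma cos_le_quartic: "cos x \<le> 1 - x\<^sup>2 / 2 + x ^ 4 / 24" for x :: real
proof -
  obtain t where t: "cos x = (\<Sum>m<4. cos_coeff m * x ^ m) + (cos (t + 1 / 2 * real 4 * pi) / fact 4) * x ^ 4"
    using Maclaurin_cos_expansion[of x 4] by blast
  have "(\<Sum>m<4. cos_coeff m * x ^ m) = 1 - x\<^sup>2 / 2"
    by (simp add: cos_coeff_def numeral_eq_Suc) presburger
  moreover have "(cos (t + 1 / 2 * real 4 * pi) / fact 4) * x ^ 4 \<le> x ^ 4 / 24"
  proof -
    have "cos (t + 1 / 2 * real 4 * pi) * x ^ 4 \<le> 1 * x ^ 4" by (intro mult_right_mono) auto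
    then show ?thesis by (simp add: fact_numeral)
  qed
  ultimately show ?thesis using t by linarith
qed

text \<open>With \<open>w = 1 - v\<close>, the square of twice the distance of
  \<open>\<alpha>\<close> from 1/2, the finer bound is \<open>1 - 1.2 * w + 0.2 * w\<^sup>2\<close>,
  to be compared with 1 - (pi^2 / 8) \<open>w\<close> + ... for the sine; pi^2 / 8 is about 1.2337.
  The coarser bound \<open>v\<close> suffices away from the centre.\<close>

lemma sin_pi_bound:
  fixes \<alpha> \<beta> :: real
  assumes "0 < \<beta>" "\<beta> \<le> \<alpha>" "\<alpha> + \<beta> = 1"
  defines "v \<equiv> 4 * \<alpha> * \<beta>"
  shows "0 \<le> sin (pi * \<alpha>)" "sin (pi * \<alpha>) \<le> v" "1 / 2 \<le> v \<Longrightarrow> sin (pi * \<alpha>) \<le> v * (4 + v) / 5"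
proof -
  show "0 \<le> sin (pi * \<alpha>)" using assms by (intro sin_ge_zero) auto
  define \<eta> where "\<eta> = \<alpha> - 1 / 2"
  have \<beta>: "\<beta> = 1 / 2 - \<eta>" and \<eta>: "0 \<le> \<eta>" "\<eta> < 1 / 2"
    using assms(1-3) by (auto simp: \<eta>_def)
  have v: "v = 1 - 4 * \<eta>\<^sup>2" unfolding v_def \<beta> \<eta>_def by algebra
  have sc: "sin (pi * \<alpha>) = cos (pi * \<eta>)"
    using sin_cos_eq[of "pi * \<alpha>"] cos_minus[of "pi * \<eta>"] by (simp add: \<eta>_def algebra_simps)
  have v1: "v \<le> 1" by (simp add: v)
  show big: "sin (pi * \<alpha>) \<le> v * (4 + v) / 5" if "1 / 2 \<le> v"
  proof -
    define w where "w = 4 * \<eta>\<^sup>2"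
    have w: "0 \<le> w" "w \<le> 1 / 2" using that by (auto simp: w_def v)
    have "cos (pi * \<eta>) \<le> 1 - pi\<^sup>2 / 8 * w + pi ^ 4 / 384 * w\<^sup>2"
      using cos_le_quartic[of "pi * \<eta>"] by (simp add: w_def power_mult_distrib)
    also have "\<dots> \<le> 1 - 1.2336 * w + 0.2538 * w\<^sup>2"
      using pi_sq_bounds pi_pow4_bounds w by (intro add_mono diff_left_mono mult_right_mono) auto
    also have "\<dots> \<le> 1 - 1.2 * w + 0.2 * w\<^sup>2"
      using mult_right_mono[of w "1 / 2" w] w by (simp add: power2_eq_square)
    also have "\<dots> = v * (4 + v) / 5" by (simp add: v w_def power2_eq_square field_simps)
    finally show ?thesis unfolding sc .
  qed
  show "sin (pi * \<alpha>) \<le> v"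
  proof (cases "1 / 2 \<le> v")
    case True
    have "v * (4 + v) \<le> v * 5" using v1 True by (intro mult_left_mono) auto
    then show ?thesis using big[OF True] by simp
  next
    case False
    \<comment> \<open>Then \<open>4 * \<alpha>\<close> exceeds 16/5, hence pi, and the bound of the
      sine by its argument is enough.\<close>
    have "\<beta> < 1 / 5"
    proof (rule ccontr)
      assume "\<not> \<beta> < 1 / 5"
      then have "0 \<le> (\<beta> - 1 / 5) * (4 / 5 - \<beta>)" using assms by (intro mult_nonneg_nonneg) auto
      moreover have "\<alpha> = 1 - \<beta>" using assms(3) by simp
      then have "v = 4 * ((\<beta> - 1 / 5) * (4 / 5 - \<beta>)) + 16 / 25" unfolding v_def by algebra
      ultimately show False using False by simp
    qed
    have "sin (pi * \<alpha>) = sin (pi * \<beta>)"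
    proof -
      have "\<alpha> = 1 - \<beta>" using assms(3) by simp
      then have "pi * \<alpha> = pi - pi * \<beta>" by (simp only: right_diff_distrib mult_1_right)
      then show ?thesis by simp
    qed
    also have "\<dots> \<le> pi * \<beta>" using assms(1) by (intro sin_x_le_x) auto
    also have "\<dots> \<le> (4 * \<alpha>) * \<beta>"
      using assms \<open>\<beta> < 1 / 5\<close> pi_approx by (intro mult_right_mono) auto
    finally show ?thesis by (simp add: v_def)
  qed
qed

text \<open>The last estimate says that the trial function \<open>cos 2\<theta> + m\<close> has a
  quotient below 64 times the inverse square of the long diagonal. As \<open>\<alpha>\<close> tends
  to 1/2, \<open>m\<close> tends to 4 / pi^2 and \<open>z\<close> to 1, and it becomes about 5.26
  against 6.13.\<close>

lemma trig_rayleigh_bound: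
  fixes \<alpha> \<beta> :: real
  assumes "0 < \<beta>" "\<beta> \<le> \<alpha>" "\<alpha> + \<beta> = 1"
  defines "z \<equiv> (sin (pi * \<alpha>))\<^sup>2" and "m \<equiv> (sin (pi * \<alpha>))\<^sup>2 / (pi\<^sup>2 * \<alpha> * \<beta>)"
  shows "0 \<le> m" "m \<le> 0.406" "0 \<le> z" "z \<le> 1" "(pi\<^sup>2 + 16) * (m * (1 - z)) + 32 * m\<^sup>2 < 16 - pi\<^sup>2"
proof -
  define v where "v = 4 * \<alpha> * \<beta>"
  have v0: "0 < v" using assms by (simp add: v_def)
  have v1: "v \<le> 1"
  proof -
    have "0 \<le> (\<alpha> - \<beta>)\<^sup>2" by simp
    moreover have "v = (\<alpha> + \<beta>)\<^sup>2 - (\<alpha> - \<beta>)\<^sup>2" unfolding v_def by algebra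
    ultimately show ?thesis using assms(3) by simp
  qed
  note s = sin_pi_bound[OF assms(1-3), folded v_def]
  define y where "y = z / v"
  have z0: "0 \<le> z" by (simp add: z_def)
  have z1: "z \<le> 1" unfolding z_def using s(1) by (simp add: power_le_one)
  have zv: "z \<le> v\<^sup>2" unfolding z_def using s by (intro power_mono) auto
  have y0: "0 \<le> y" using z0 v0 by (simp add: y_def)
  have yv: "y \<le> v" using zv v0 by (simp add: y_def power2_eq_square divide_le_eq)
  have z: "z = v * y" using v0 by (simp add: y_def)
  have m: "m = 4 / pi\<^sup>2 * y" unfolding m_def y_def z_def v_def by (simp add: mult_ac)
  have p: "4 / pi\<^sup>2 \<le> 0.40531" "0 < 4 / pi\<^sup>2" using pi_sq_bounds by (auto simp: field_simps)
  have my: "m \<le> 0.40531 * y" unfolding m using p y0 by (intro mult_right_mono) auto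
  show m0: "0 \<le> m" unfolding m using y0 by simp
  show "m \<le> 0.406" using my yv v1 by simp
  show "0 \<le> z" "z \<le> 1" by fact+
  \<comment> \<open>With \<open>m = 4 / pi\<^sup>2 * y\<close> and \<open>z = v * y\<close>,
    \<open>G\<close> is the left-hand side with its numerical coefficients rounded up; it remains to
    keep it below 6.13.\<close>
  define G where "G y = 10.486 * (y * (1 - v * y)) + 5.257 * y\<^sup>2" for y
  have "(pi\<^sup>2 + 16) * (m * (1 - z)) + 32 * m\<^sup>2 \<le> 25.8697 * ((0.40531 * y) * (1 - z)) + 32 * (0.40531 * y)\<^sup>2"
    using pi_sq_bounds m0 my z1 y0 by (intro add_mono mult_mono power_mono mult_nonneg_nonneg) auto
  also have "\<dots> = 25.8697 * 0.40531 * (y * (1 - z)) + 32 * 0.40531\<^sup>2 * y\<^sup>2"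
    by (simp only: power_mult_distrib mult.assoc)
  also have "\<dots> \<le> G y" unfolding G_def z[symmetric]
    using y0 z1 by (intro add_mono mult_right_mono) (auto simp: power2_eq_square)
  finally have le: "(pi\<^sup>2 + 16) * (m * (1 - z)) + 32 * m\<^sup>2 \<le> G y" .
  \<comment> \<open>Any upper bound for \<open>y\<close> that does not exceed \<open>v\<close> may
    thus be inserted into \<open>G\<close>.\<close>
  have mono: "G y \<le> G y'" if "y \<le> y'" "y' \<le> v" for y'
  proof -
    have "0 \<le> 10.486 * (1 - v * (y' + y)) + 5.257 * (y' + y)"
    proof -
      have "0 \<le> 10.486 * (1 - P) + 5.257 * S" if "P \<le> S" "S \<le> 2" for P S :: real
        using that by (simp add: field_simps)
      note lin = this
      have "v * (y' + y) \<le> 1 * (y' + y)" using v1 y0 that by (intro mult_right_mono) auto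
      then show ?thesis by (intro lin) (use that yv v1 in auto)
    qed
    then have "0 \<le> (y' - y) * (10.486 * (1 - v * (y' + y)) + 5.257 * (y' + y))"
      using that by (intro mult_nonneg_nonneg) auto
    also have "\<dots> = G y' - G y" unfolding G_def by algebra
    finally show ?thesis by simp
  qed
  have "G y < 6.13"
  proof (cases "1 / 2 \<le> v")
    case True
    \<comment> \<open>The finer bound for the sine is essential here: \<open>y \<le> v\<close> alone
      gives about 6.38 at \<open>v = 4 / 5\<close>.\<close>
    define y' where "y' = v * (4 + v)\<^sup>2 / 25"
    have "z \<le> (v * (4 + v) / 5)\<^sup>2" unfolding z_def using s(1) s(3)[OF True] by (intro power_mono) auto
    also have "\<dots> = v * y'" by (simp add: y'_def power2_eq_square)
    finally have "y \<le> y'" using v0 by (simp add: z)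
    moreover have "y' \<le> v"
    proof -
      have "(4 + v)\<^sup>2 \<le> 5\<^sup>2" using v0 v1 by (intro power_mono) auto
      then have "v * (4 + v)\<^sup>2 \<le> v * 5\<^sup>2" using v0 by (intro mult_left_mono) auto
      then show ?thesis by (simp add: y'_def)
    qed
    ultimately have "G y \<le> G y'" by (rule mono)
    moreover have "0 < 625000 * (6.13 - G y')"
    proof -
      have "0 < 3831250 - 262150 * (v * (4 + v)\<^sup>2) + 10486 * v * (v * (4 + v)\<^sup>2)\<^sup>2 - 5257 * (v * (4 + v)\<^sup>2)\<^sup>2"
        using poly_pos_5a[of v] poly_pos_5b[of v] True v1 by (cases "v \<le> 3 / 4") auto
      also have "\<dots> = 625000 * (6.13 - G y')" unfolding G_def y'_def by (simp add: field_simps) algebra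
      finally show ?thesis .
    qed
    ultimately show ?thesis by simp
  next
    case False
    have "0 \<le> (1 / 2 - v) * (3 / 4 - v / 2 - v\<^sup>2)"
    proof (intro mult_nonneg_nonneg)
      have "v\<^sup>2 \<le> (1 / 2)\<^sup>2" using v0 False by (intro power_mono) auto
      then show "0 \<le> 3 / 4 - v / 2 - v\<^sup>2" using False by (simp add: power2_eq_square)
    qed (use False in simp)
    moreover have "(1 / 2 - v) * (3 / 4 - v / 2 - v\<^sup>2) = 3 / 8 - v * (1 - v * v)" by algebra
    ultimately have "v * (1 - v * v) \<le> 3 / 8" by linarith
    moreover have "v\<^sup>2 \<le> (1 / 2)\<^sup>2" using v0 False by (intro power_mono) auto
    ultimately have "G v < 6.13" by (simp add: G_def power2_eq_square)
    then show ?thesis using mono[OF yv order_refl] by simp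
  qed
  also have "\<dots> < 16 - pi\<^sup>2" using pi_sq_bounds by simp
  finally show "(pi\<^sup>2 + 16) * (m * (1 - z)) + 32 * m\<^sup>2 < 16 - pi\<^sup>2" using le by simp
qed

section \<open>Smooth functions\<close>

lemma C_k_SucI:
  assumes "\<And>x. (f has_derivative D x) (at x)" and "\<And>b. b \<in> Basis \<Longrightarrow> C_k k (\<lambda>x. D x b)"
  shows "C_k (Suc k) f"
proof -
  have "frechet_derivative f (at x) = D x" for x
    using frechet_derivative_at[OF assms(1)] by simp
  then show ?thesis using assms by (auto simp: differentiable_def)
qed

lemma C_k_SucD:
  assumes "C_k (Suc k) f"
  shows "(f has_derivative frechet_derivative f (at x)) (at x)"
    and "b \<in> Basis \<Longrightarrow> C_k k (\<lambda>x. frechet_derivative f (at x) b)"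
  using assms by (auto simp: frechet_derivative_works)

lemma C_k_continuous: "C_k k f \<Longrightarrow> continuous_on UNIV f"
  by (cases k) (auto simp: continuous_on_eq_continuous_within differentiable_imp_continuous_within)

lemma C_k_Suc_imp: "C_k (Suc k) f \<Longrightarrow> C_k k f"
proof (induction k arbitrary: f)
  case 0
  show ?case using C_k_continuous[OF 0] by simp
next
  case (Suc k)
  then show ?case using C_k.simps(2)[of "Suc k" f] C_k.simps(2)[of k f] by blast
qed

lemma C_k_const: "C_k k (\<lambda>x. a)"
proof (induction k arbitrary: a)
  case (Suc k)
  show ?case by (rule C_k_SucI[where D = "\<lambda>_ _. 0"]) (auto intro: Suc)
qed simp

lemma C_k_add: "C_k k f \<Longrightarrow> C_k k g \<Longrightarrow> C_k k (\<lambda>x. f x + g x)"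
proof (induction k arbitrary: f g)
  case 0
  then show ?case by (auto intro: continuous_intros)
next
  case (Suc k)
  show ?case
    by (rule C_k_SucI[OF has_derivative_add[OF C_k_SucD(1)[OF Suc.prems(1)] C_k_SucD(1)[OF Suc.prems(2)]]])
       (use Suc in auto)
qed

lemma C_k_mult: "C_k k f \<Longrightarrow> C_k k g \<Longrightarrow> C_k k (\<lambda>x. f x * g x)"
proof (induction k arbitrary: f g)
  case 0
  then show ?case by (auto intro: continuous_intros)
next
  case (Suc k)
  have "C_k k (\<lambda>x. f x * frechet_derivative g (at x) b + frechet_derivative f (at x) b * g x)"
    if "b \<in> Basis" for b
    using Suc that C_k_Suc_imp C_k_SucD(2) by (intro C_k_add Suc.IH) blast+
  then show ?case
    by (intro C_k_SucI[OF has_derivative_mult[OF C_k_SucD(1)[OF Suc.prems(1)] C_k_SucD(1)[OF Suc.prems(2)]]])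
qed

lemma C_k_affine:
  fixes f :: "real \<Rightarrow> real" and a :: "'a::euclidean_space"
  shows "C_k k f \<Longrightarrow> C_k k (\<lambda>x. f (x \<bullet> a + b))"
proof (induction k arbitrary: f)
  case 0
  then have "continuous_on UNIV (f \<circ> (\<lambda>x. x \<bullet> a + b))"
    by (intro continuous_on_compose continuous_intros) (auto elim: continuous_on_subset)
  then show ?case by (simp add: o_def)
next
  case (Suc k)
  let ?f' = "\<lambda>y. frechet_derivative f (at y)"
  have "((\<lambda>x. f (x \<bullet> a + b)) has_derivative (\<lambda>h. ?f' (x \<bullet> a + b) (h \<bullet> a))) (at x)" for x
    by (rule has_derivative_compose[OF _ C_k_SucD(1)[OF Suc.prems], of "\<lambda>x. x \<bullet> a + b" "\<lambda>h. h \<bullet> a", unfolded o_def])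
       (auto intro!: derivative_eq_intros)
  moreover have "?f' y h = h * ?f' y 1" for y h
  proof -
    have "linear (?f' y)" using C_k_SucD(1)[OF Suc.prems] by (rule has_derivative_linear)
    then have "?f' y (h *\<^sub>R 1) = h *\<^sub>R ?f' y 1" by (simp only: linear_scale)
    then show ?thesis by simp
  qed
  then have "(\<lambda>x. ?f' (x \<bullet> a + b) (e \<bullet> a)) = (\<lambda>x. (e \<bullet> a) * ?f' (x \<bullet> a + b) 1)" for e
    by (intro ext)
  then have "C_k k (\<lambda>x. ?f' (x \<bullet> a + b) (e \<bullet> a))" for e
    using C_k_SucD(2)[OF Suc.prems, of 1] Suc.IH by (auto intro!: C_k_mult C_k_const)
  ultimately show ?case by (rule C_k_SucI)
qed

lemma C_k_SucI_real:
  fixes f :: "real \<Rightarrow> real"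
  assumes "\<And>x. (f has_real_derivative D x) (at x)" and "C_k k D"
  shows "C_k (Suc k) f"
  by (rule C_k_SucI[where D = "\<lambda>x h. D x * h"]) (use assms in \<open>auto simp: has_field_derivative_def\<close>)

lemma C_k_trig: "C_k k (\<lambda>x::real. a * sin x + b * cos x)"
proof (induction k arbitrary: a b)
  case 0
  then show ?case by (auto intro!: continuous_intros)
next
  case (Suc k)
  show ?case
    by (rule C_k_SucI_real[where D = "\<lambda>x. (- b) * sin x + a * cos x"])
       (use Suc[of "- b" a] in \<open>auto intro!: derivative_eq_intros\<close>)
qed

lemma C_k_sin: "C_k k (\<lambda>x::real. sin (a * x))" and C_k_cos: "C_k k (\<lambda>x::real. cos (a * x))"
  using C_k_affine[of k sin a 0] C_k_affine[of k cos a 0] C_k_trig[of k 1 0] C_k_trig[of k 0 1]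
  by (auto simp: mult.commute)

text \<open>\<open>flat 1\<close> is the classical smooth function exp (-1/x). The polynomial factor
  makes the family closed under differentiation, so that smoothness is one induction over all
  \<open>p\<close>.\<close>

definition flat :: "real poly \<Rightarrow> real \<Rightarrow> real" where
  "flat p x = (if 0 < x then poly p (1 / x) * exp (- (1 / x)) else 0)"

lemma poly_exp_tendsto: "((\<lambda>t. poly p t * exp (- t)) \<longlongrightarrow> 0) at_top" for p :: "real poly"
proof -
  have "((\<lambda>t. \<Sum>i\<le>degree p. coeff p i * (t ^ i / exp t)) \<longlongrightarrow> (\<Sum>i\<le>degree p. coeff p i * 0)) at_top"
    by (intro tendsto_intros tendsto_power_div_exp_0)
  then show ?thesis
    by (simp add: poly_altdef sum_distrib_right exp_minus divide_inverse mult.assoc)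
qed

lemma flat_tendsto: "(flat p \<longlongrightarrow> 0) (at 0)"
proof -
  have "((\<lambda>x. poly p (1 / x) * exp (- (1 / x))) \<longlongrightarrow> 0) (at_right 0)"
    using filterlim_compose[OF poly_exp_tendsto filterlim_inverse_at_top_right]
    by (simp add: inverse_eq_divide)
  then have "(flat p \<longlongrightarrow> 0) (at_right 0)"
    by (rule tendsto_cong[THEN iffD1, rotated])
       (auto simp: flat_def eventually_at_right_field intro: exI[of _ 1])
  moreover have "(flat p \<longlongrightarrow> 0) (at_left 0)"
    by (rule tendsto_eventually) (auto simp: flat_def eventually_at_left_field intro: exI[of _ "-1"])
  ultimately show ?thesis by (simp add: filterlim_split_at)
qed

lemma DERIV_flat: "(flat p has_real_derivative flat ([:0, 0, 1:] * (p - pderiv p)) x) (at x)"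
proof -
  consider "0 < x" | "x < 0" | "x = 0" by linarith
  then show ?thesis
  proof cases
    case 1
    have "((\<lambda>x. poly p (1 / x) * exp (- (1 / x))) has_real_derivative
        poly ([:0, 0, 1:] * (p - pderiv p)) (1 / x) * exp (- (1 / x))) (at x)"
      using 1 by (auto intro!: derivative_eq_intros simp: field_simps power2_eq_square)
    then have "(flat p has_real_derivative poly ([:0, 0, 1:] * (p - pderiv p)) (1 / x) * exp (- (1 / x))) (at x)"
      by (rule has_field_derivative_transform_within_open[where S = "{0<..}"]) (use 1 in \<open>auto simp: flat_def\<close>)
    then show ?thesis using 1 by (simp add: flat_def)
  next
    case 2
    have "((\<lambda>x. 0) has_real_derivative 0) (at x)" by simp
    then have "(flat p has_real_derivative 0) (at x)"
      by (rule has_field_derivative_transform_within_open[where S = "{..<0}"]) (use 2 in \<open>auto simp: flat_def\<close>)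
    then show ?thesis using 2 by (simp add: flat_def)
  next
    case 3
    \<comment> \<open>The difference quotient at 0 is again a member of the family, with
      \<open>p\<close> multiplied by the variable, so it tends to 0.\<close>
    have "((\<lambda>h. (flat p (0 + h) - flat p 0) / h) \<longlongrightarrow> 0) (at 0)"
      by (rule tendsto_cong[THEN iffD1, OF _ flat_tendsto[of "[:0, 1:] * p"]])
         (auto simp: flat_def eventually_at_filter)
    then have "(flat p has_real_derivative 0) (at 0)" by (simp add: DERIV_def)
    then show ?thesis using 3 by (simp add: flat_def)
  qed
qed

lemma C_k_flat: "C_k k (flat p)"
proof (induction k arbitrary: p)
  case 0
  have "continuous_on UNIV (flat p)"
    using DERIV_flat DERIV_isCont by (metis continuous_on_eq_continuous_at open_UNIV)
  then show ?case by simp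
next
  case (Suc k)
  show ?case by (rule C_k_SucI_real[OF DERIV_flat]) (rule Suc)
qed

text \<open>A smooth cut-off that vanishes outside \<open>{1/N<..<1 - 1/N}\<close>. It equals no constant inside, but
  tends to 1 pointwise, and its derivative is controlled by the inverse distance to the endpoints.\<close>

definition cutoff :: "nat \<Rightarrow> real \<Rightarrow> real" where
  "cutoff N x = flat 1 (real N * x - 1) * flat 1 (real N * (1 - x) - 1)"

definition cutoff' :: "nat \<Rightarrow> real \<Rightarrow> real" where
  "cutoff' N x = real N * flat [:0, 0, 1:] (real N * x - 1) * flat 1 (real N * (1 - x) - 1)
     - flat 1 (real N * x - 1) * (real N * flat [:0, 0, 1:] (real N * (1 - x) - 1))"

lemma DERIV_flat_1: "(flat 1 has_real_derivative flat [:0, 0, 1:] x) (at x)"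
  using DERIV_flat[of 1 x] by simp

lemma DERIV_cutoff: "(cutoff N has_real_derivative cutoff' N x) (at x)"
  unfolding cutoff_def cutoff'_def
  by (rule derivative_eq_intros DERIV_chain2[OF DERIV_flat_1] refl)+ (simp add: algebra_simps)

lemma C_k_cutoff: "C_k k (cutoff N)"
proof -
  have "C_k k (\<lambda>x. flat 1 (x \<bullet> real N + (-1)) * flat 1 (x \<bullet> (- real N) + (real N - 1)))"
    by (intro C_k_mult C_k_affine C_k_flat)
  also have "(\<lambda>x. flat 1 (x \<bullet> real N + (-1)) * flat 1 (x \<bullet> (- real N) + (real N - 1))) = cutoff N"
    by (auto simp: cutoff_def fun_eq_iff algebra_simps)
  finally show ?thesis .
qed

lemma flat_1_bounds: "0 \<le> flat 1 x" "flat 1 x \<le> 1"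
  by (auto simp: flat_def)

lemma flat_2_nonneg: "0 \<le> flat [:0, 0, 1:] x"
  by (auto simp: flat_def)

text \<open>With \<open>t = 1 / x\<close> the product is \<open>(t + t\<^sup>2) * exp (- t)\<close>.
  At \<open>x = N * s - 1\<close> the factor \<open>x + 1\<close> is \<open>N * s\<close>, so the
  derivative of the cut-off times the distance \<open>s\<close> to the endpoint is bounded uniformly
  in \<open>N\<close>.\<close>

lemma flat_2_bound: "\<bar>(x + 1) * flat [:0, 0, 1:] x\<bar> \<le> 3"
proof (cases "0 < x")
  case True
  define t where "t = 1 / x"
  have t: "0 < t" "x = 1 / t" using True by (auto simp: t_def)
  have "flat [:0, 0, 1:] x = t\<^sup>2 * exp (- t)"
    using True by (simp add: flat_def t_def power2_eq_square)
  then have "(x + 1) * flat [:0, 0, 1:] x = (t * (t * x) + t\<^sup>2) * exp (- t)"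
    by (simp add: power2_eq_square algebra_simps)
  then have "(x + 1) * flat [:0, 0, 1:] x = (t + t\<^sup>2) * exp (- t)"
    using t by simp
  moreover have "(t + t\<^sup>2) \<le> 3 * exp t"
  proof -
    have "1 + t + t\<^sup>2 / 2 \<le> exp t" using t by (intro exp_lower_Taylor_quadratic) simp
    then show ?thesis using t(1) zero_le_power2[of t] by linarith
  qed
  then have "(t + t\<^sup>2) * exp (- t) \<le> 3" by (simp add: exp_minus field_simps)
  moreover have "0 \<le> (t + t\<^sup>2) * exp (- t)" using t by simp
  ultimately show ?thesis by simp
qed (simp add: flat_def)

lemma cutoff_bounds: "0 \<le> cutoff N x" "cutoff N x \<le> 1"
  using flat_1_bounds by (auto simp: cutoff_def intro!: mult_le_one)

lemma cutoff_nonzeroD: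
  assumes "cutoff N x \<noteq> 0"
  shows "1 / real N < x" "x < 1 - 1 / real N" "0 < N"
proof -
  have "real N * x > 1" "real N * (1 - x) > 1" using assms by (auto simp: cutoff_def flat_def split: if_splits)
  then have N: "0 < N" by (cases N) auto
  then show "1 / real N < x" "x < 1 - 1 / real N" "0 < N"
    using \<open>real N * x > 1\<close> \<open>real N * (1 - x) > 1\<close> by (auto simp: field_simps)
qed

lemma flat_seq_tendsto:
  assumes "0 < x"
  shows "(\<lambda>N. flat 1 (real N * x - 1)) \<longlonglongrightarrow> 1"
    and "(\<lambda>N. real N * flat [:0, 0, 1:] (real N * x - 1)) \<longlonglongrightarrow> 0"
proof -
  have top: "filterlim (\<lambda>N. real N * x - 1) at_top sequentially"
    using assms by real_asymp
  have "((\<lambda>y. exp (- (1 / y))) \<longlongrightarrow> (1::real)) at_top" by real_asymp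
  then have "(flat 1 \<longlongrightarrow> 1) at_top"
    by (rule tendsto_cong[THEN iffD1, rotated]) (auto simp: flat_def intro: eventually_mono[OF eventually_gt_at_top[of 0]])
  then show "(\<lambda>N. flat 1 (real N * x - 1)) \<longlonglongrightarrow> 1"
    using top by (rule filterlim_compose)
  have "((\<lambda>y. (y + 1) * ((1 / y)\<^sup>2 * exp (- (1 / y)))) \<longlongrightarrow> (0::real)) at_top" by real_asymp
  then have "((\<lambda>y. (y + 1) * flat [:0, 0, 1:] y) \<longlongrightarrow> 0) at_top"
    by (rule tendsto_cong[THEN iffD1, rotated])
       (auto simp: flat_def power2_eq_square intro: eventually_mono[OF eventually_gt_at_top[of 0]])
  from filterlim_compose[OF this top]
  have "(\<lambda>N. real N * x * flat [:0, 0, 1:] (real N * x - 1)) \<longlonglongrightarrow> 0" by simp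
  from tendsto_mult_left[OF this, of "1 / x"] show "(\<lambda>N. real N * flat [:0, 0, 1:] (real N * x - 1)) \<longlonglongrightarrow> 0"
    using assms by simp
qed

lemma cutoff_tendsto:
  assumes "0 < x" "x < 1"
  shows "(\<lambda>N. cutoff N x) \<longlonglongrightarrow> 1" and "(\<lambda>N. cutoff' N x) \<longlonglongrightarrow> 0"
proof -
  note l = flat_seq_tendsto[of x] flat_seq_tendsto[of "1 - x"]
  show "(\<lambda>N. cutoff N x) \<longlonglongrightarrow> 1"
    using tendsto_mult[OF l(1) l(3)] assms by (simp add: cutoff_def)
  show "(\<lambda>N. cutoff' N x) \<longlonglongrightarrow> 0"
    using tendsto_diff[OF tendsto_mult[OF l(2) l(3)] tendsto_mult[OF l(1) l(4)]] assms
    by (simp add: cutoff'_def)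
qed

text \<open>The derivative of the cut-off is unbounded as \<open>N\<close> grows, but a factor
  \<open>a\<close> that vanishes linearly at both endpoints compensates for this. The result is the
  dominating constant in the integration by parts.\<close>

lemma cutoff'_bound:
  assumes "0 < x" "x < 1" and F: "\<bar>a\<bar> \<le> K * x" "\<bar>a\<bar> \<le> K * (1 - x)"
  shows "\<bar>a * cutoff' N x\<bar> \<le> 6 * K"
proof -
  have K: "0 \<le> K" using F(1) assms(1) by (smt (verit) zero_le_mult_iff)
  have *: "\<bar>a\<bar> * (real N * flat [:0, 0, 1:] (real N * y - 1)) \<le> 3 * K"
    if "0 < y" "\<bar>a\<bar> \<le> K * y" for y
  proof -
    have "\<bar>a\<bar> * (real N * flat [:0, 0, 1:] (real N * y - 1)) \<le> K * y * (real N * flat [:0, 0, 1:] (real N * y - 1))"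
      using that flat_2_nonneg by (intro mult_right_mono) auto
    also have "\<dots> = K * ((real N * y - 1 + 1) * flat [:0, 0, 1:] (real N * y - 1))" by simp
    also have "\<dots> \<le> K * 3" using K flat_2_bound[of "real N * y - 1"] by (intro mult_left_mono) auto
    finally show ?thesis by simp
  qed
  let ?A = "real N * flat [:0, 0, 1:] (real N * x - 1)" and ?B = "real N * flat [:0, 0, 1:] (real N * (1 - x) - 1)"
  have AB: "0 \<le> ?A" "0 \<le> ?B" using flat_2_nonneg by auto
  have "\<bar>a * cutoff' N x\<bar> = \<bar>a\<bar> * \<bar>?A * flat 1 (real N * (1 - x) - 1) - flat 1 (real N * x - 1) * ?B\<bar>"
    by (simp add: cutoff'_def abs_mult)
  also have "\<dots> \<le> \<bar>a\<bar> * (?A * 1 + 1 * ?B)"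
  proof (rule mult_left_mono)
    have "?A * flat 1 (real N * (1 - x) - 1) \<le> ?A * 1" "flat 1 (real N * x - 1) * ?B \<le> 1 * ?B"
      using AB flat_1_bounds by (intro mult_left_mono mult_right_mono; blast)+
    moreover have "0 \<le> ?A * flat 1 (real N * (1 - x) - 1)" "0 \<le> flat 1 (real N * x - 1) * ?B"
      using AB flat_1_bounds by (auto intro: mult_nonneg_nonneg)
    ultimately show "\<bar>?A * flat 1 (real N * (1 - x) - 1) - flat 1 (real N * x - 1) * ?B\<bar> \<le> ?A * 1 + 1 * ?B"
      by linarith
  qed simp
  also have "\<dots> = \<bar>a\<bar> * ?A + \<bar>a\<bar> * ?B" by (simp add: distrib_left)
  also have "\<dots> \<le> 3 * K + 3 * K" using assms by (intro add_mono *) auto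
  finally show ?thesis by simp
qed

section \<open>Square integrable functions and \<open>H\<^sup>1\<close>\<close>

text \<open>\<open>L2\<close> for a general measure and for scalar and vector values alike, so that
  one set of Hilbert space facts covers functions and gradients.\<close>

definition sqint :: "'a measure \<Rightarrow> ('a \<Rightarrow> 'b::euclidean_space) \<Rightarrow> bool" where
  "sqint M u \<longleftrightarrow> u \<in> borel_measurable M \<and> integrable M (\<lambda>x. (norm (u x))\<^sup>2)"

lemma L2_iff_sqint: "u \<in> L2 S \<longleftrightarrow> sqint (lebesgue_on S) u"
  by (simp add: L2_def sqint_def)

lemma sqint_inner:
  assumes "sqint M u" "sqint M v"
  shows "integrable M (\<lambda>x. u x \<bullet> v x)"
proof (rule Bochner_Integration.integrable_bound)
  show "integrable M (\<lambda>x. (norm (u x))\<^sup>2 + (norm (v x))\<^sup>2)"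
    using assms by (auto simp: sqint_def)
  show "(\<lambda>x. u x \<bullet> v x) \<in> borel_measurable M"
    using assms by (auto simp: sqint_def intro: borel_measurable_inner)
  show "AE x in M. norm (u x \<bullet> v x) \<le> norm ((norm (u x))\<^sup>2 + (norm (v x))\<^sup>2)"
  proof (rule AE_I2)
    fix x
    have "0 \<le> (norm (u x) - norm (v x))\<^sup>2" by simp
    moreover have "0 \<le> norm (u x) * norm (v x)" by simp
    ultimately have "norm (u x) * norm (v x) \<le> (norm (u x))\<^sup>2 + (norm (v x))\<^sup>2"
      unfolding power2_diff by linarith
    then show "norm (u x \<bullet> v x) \<le> norm ((norm (u x))\<^sup>2 + (norm (v x))\<^sup>2)"
      using Cauchy_Schwarz_ineq2[of "u x" "v x"] by simp
  qed
qed

lemma sqint_lin: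
  assumes "sqint M u" "sqint M v"
  shows "sqint M (\<lambda>x. a *\<^sub>R u x + b *\<^sub>R v x)"
  unfolding sqint_def
proof
  show m: "(\<lambda>x. a *\<^sub>R u x + b *\<^sub>R v x) \<in> borel_measurable M"
    using assms by (auto simp: sqint_def)
  show "integrable M (\<lambda>x. (norm (a *\<^sub>R u x + b *\<^sub>R v x))\<^sup>2)"
  proof (rule Bochner_Integration.integrable_bound)
    show "integrable M (\<lambda>x. 2 * a\<^sup>2 * (norm (u x))\<^sup>2 + 2 * b\<^sup>2 * (norm (v x))\<^sup>2)"
      using assms by (auto simp: sqint_def)
    show "(\<lambda>x. (norm (a *\<^sub>R u x + b *\<^sub>R v x))\<^sup>2) \<in> borel_measurable M"
      using m by measurable
    show "AE x in M. norm ((norm (a *\<^sub>R u x + b *\<^sub>R v x))\<^sup>2) \<le> norm (2 * a\<^sup>2 * (norm (u x))\<^sup>2 + 2 * b\<^sup>2 * (norm (v x))\<^sup>2)"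
    proof (rule AE_I2)
      fix x
      have "(norm (a *\<^sub>R u x + b *\<^sub>R v x))\<^sup>2 \<le> (\<bar>a\<bar> * norm (u x) + \<bar>b\<bar> * norm (v x))\<^sup>2"
        using norm_triangle_ineq[of "a *\<^sub>R u x" "b *\<^sub>R v x"] by (intro power_mono) auto
      also have "\<dots> \<le> 2 * (\<bar>a\<bar> * norm (u x))\<^sup>2 + 2 * (\<bar>b\<bar> * norm (v x))\<^sup>2"
        using zero_le_power2[of "\<bar>a\<bar> * norm (u x) - \<bar>b\<bar> * norm (v x)"] by (simp add: power2_sum power2_diff)
      finally show "norm ((norm (a *\<^sub>R u x + b *\<^sub>R v x))\<^sup>2) \<le> norm (2 * a\<^sup>2 * (norm (u x))\<^sup>2 + 2 * b\<^sup>2 * (norm (v x))\<^sup>2)"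
        by (simp add: power_mult_distrib)
    qed
  qed
qed

lemma sqint_diff: "sqint M u \<Longrightarrow> sqint M v \<Longrightarrow> sqint M (\<lambda>x. u x - v x)"
  using sqint_lin[of M u v 1 "-1"] by simp

lemma sqint_norm: "sqint M u \<Longrightarrow> sqint M (\<lambda>x. norm (u x))"
  by (auto simp: sqint_def)

lemma integral_inner_lin:
  assumes "sqint M u" "sqint M v" "sqint M w"
  shows "(LINT x|M. (a *\<^sub>R u x + b *\<^sub>R v x) \<bullet> w x) = a * (LINT x|M. u x \<bullet> w x) + b * (LINT x|M. v x \<bullet> w x)"
  using assms by (simp add: inner_add_left sqint_inner)

lemma sqint_Cauchy_Schwarz:
  assumes "sqint M u" "sqint M v"
  shows "\<bar>LINT x|M. u x \<bullet> v x\<bar> \<le> sqrt ((LINT x|M. u x \<bullet> u x) * (LINT x|M. v x \<bullet> v x))"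
proof (rule psd_Cauchy_Schwarz)
  fix a b
  have "0 \<le> (LINT x|M. (a *\<^sub>R u x + b *\<^sub>R v x) \<bullet> (a *\<^sub>R u x + b *\<^sub>R v x))"
    by (rule integral_nonneg_AE) auto
  also have "\<dots> = a * (LINT x|M. u x \<bullet> (a *\<^sub>R u x + b *\<^sub>R v x)) + b * (LINT x|M. v x \<bullet> (a *\<^sub>R u x + b *\<^sub>R v x))"
    by (rule integral_inner_lin[OF assms sqint_lin[OF assms]])
  also have "(LINT x|M. u x \<bullet> (a *\<^sub>R u x + b *\<^sub>R v x)) = a * (LINT x|M. u x \<bullet> u x) + b * (LINT x|M. u x \<bullet> v x)"
    using assms by (simp add: inner_add_right sqint_inner)
  also have "(LINT x|M. v x \<bullet> (a *\<^sub>R u x + b *\<^sub>R v x)) = a * (LINT x|M. u x \<bullet> v x) + b * (LINT x|M. v x \<bullet> v x)"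
  proof -
    have "(LINT x|M. v x \<bullet> u x) = (LINT x|M. u x \<bullet> v x)"
      by (rule Bochner_Integration.integral_cong) (auto simp: inner_commute)
    then show ?thesis using assms by (simp add: inner_add_right sqint_inner)
  qed
  also have "a * (a * (LINT x|M. u x \<bullet> u x) + b * (LINT x|M. u x \<bullet> v x)) + b * (a * (LINT x|M. u x \<bullet> v x) + b * (LINT x|M. v x \<bullet> v x))
      = a\<^sup>2 * (LINT x|M. u x \<bullet> u x) + 2 * a * b * (LINT x|M. u x \<bullet> v x) + b\<^sup>2 * (LINT x|M. v x \<bullet> v x)"
    by (simp add: power2_eq_square algebra_simps)
  finally show "0 \<le> a\<^sup>2 * (LINT x|M. u x \<bullet> u x) + 2 * a * b * (LINT x|M. u x \<bullet> v x) + b\<^sup>2 * (LINT x|M. v x \<bullet> v x)" .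
qed (auto intro!: integral_nonneg_AE)

lemma sqint_tendsto_inner:
  assumes u: "\<And>n. sqint M (u n)" and w: "sqint M w" and v: "sqint M v"
    and lim: "(\<lambda>n. LINT x|M. (u n x - w x) \<bullet> (u n x - w x)) \<longlonglongrightarrow> 0"
  shows "(\<lambda>n. LINT x|M. u n x \<bullet> v x) \<longlonglongrightarrow> (LINT x|M. w x \<bullet> v x)"
proof (rule LIM_zero_cancel, rule tendsto_rabs_zero_cancel, rule tendsto_sandwich[OF _ _ tendsto_const])
  have "(LINT x|M. u n x \<bullet> v x) - (LINT x|M. w x \<bullet> v x) = (LINT x|M. (u n x - w x) \<bullet> v x)" for n
    using integral_inner_lin[OF u w v, where a = 1 and b = "-1"] by simp
  then show "\<forall>\<^sub>F n in sequentially. \<bar>(LINT x|M. u n x \<bullet> v x) - (LINT x|M. w x \<bullet> v x)\<bar>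
      \<le> sqrt ((LINT x|M. (u n x - w x) \<bullet> (u n x - w x)) * (LINT x|M. v x \<bullet> v x))"
    using sqint_Cauchy_Schwarz[OF sqint_diff[OF u w] v] by simp
  show "(\<lambda>n. sqrt ((LINT x|M. (u n x - w x) \<bullet> (u n x - w x)) * (LINT x|M. v x \<bullet> v x))) \<longlonglongrightarrow> 0"
    using tendsto_real_sqrt[OF tendsto_mult_left_zero[OF lim]] by simp
qed simp

lemma (in finite_measure) sqint_bounded:
  assumes "u \<in> borel_measurable M" "\<And>x. x \<in> space M \<Longrightarrow> norm (u x) \<le> C"
  shows "sqint M u"
  unfolding sqint_def
proof
  show "integrable M (\<lambda>x. (norm (u x))\<^sup>2)"
  proof (rule integrable_const_bound[where B = "C\<^sup>2"])
    show "AE x in M. norm ((norm (u x))\<^sup>2) \<le> C\<^sup>2"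
      using assms(2) by (intro AE_I2) (auto intro: power_mono)
  qed (use assms(1) in measurable)
qed fact

lemma (in finite_measure) sqint_integrable:
  assumes "sqint M u"
  shows "integrable M u"
proof (rule Bochner_Integration.integrable_bound[where f = "\<lambda>x. 1 + (norm (u x))\<^sup>2"])
  show "integrable M (\<lambda>x. 1 + (norm (u x))\<^sup>2)" using assms by (auto simp: sqint_def)
  show "AE x in M. norm (u x) \<le> norm (1 + (norm (u x))\<^sup>2)"
  proof (rule AE_I2)
    fix x
    have "0 \<le> (norm (u x) - 1)\<^sup>2" by simp
    then have "2 * norm (u x) \<le> 1 + (norm (u x))\<^sup>2" by (simp add: power2_diff)
    moreover have "0 \<le> norm (u x)" by simp
    ultimately have "norm (u x) \<le> 1 + (norm (u x))\<^sup>2" by linarith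
    then show "norm (u x) \<le> norm (1 + (norm (u x))\<^sup>2)" by simp
  qed
qed (use assms in \<open>auto simp: sqint_def\<close>)

text \<open>Riesz-Fischer: as the measure is finite, the sequence is Cauchy in L1, so a subsequence
  converges almost everywhere. Fatou's lemma along this subsequence turns the Cauchy bound into a
  bound for the distance to the limit.\<close>

theorem (in finite_measure) sqint_complete:
  fixes u :: "nat \<Rightarrow> 'a \<Rightarrow> 'b::euclidean_space"
  assumes u: "\<And>n. sqint M (u n)"
    and Cauchy: "\<And>e. e > 0 \<Longrightarrow> \<exists>N. \<forall>m\<ge>N. \<forall>n\<ge>N. (LINT x|M. (u m x - u n x) \<bullet> (u m x - u n x)) < e"
  obtains w where "sqint M w" "(\<lambda>n. LINT x|M. (u n x - w x) \<bullet> (u n x - w x)) \<longlonglongrightarrow> 0"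
proof -
  have meas[measurable]: "u n \<in> borel_measurable M" for n using u by (simp add: sqint_def)
  have "\<exists>N. \<forall>i\<ge>N. \<forall>j\<ge>N. (LINT x|M. norm (u i x - u j x)) < e" if "e > 0" for e
  proof -
    define K where "K = measure M (space M) + 1"
    have K: "0 < K" by (simp add: K_def add_nonneg_pos)
    obtain N where N: "\<And>m n. m \<ge> N \<Longrightarrow> n \<ge> N \<Longrightarrow> (LINT x|M. (u m x - u n x) \<bullet> (u m x - u n x)) < e\<^sup>2 / K"
      using Cauchy[of "e\<^sup>2 / K"] K \<open>e > 0\<close> by auto
    have "(LINT x|M. norm (u i x - u j x)) < e" if "i \<ge> N" "j \<ge> N" for i j
    proof -
      have d: "sqint M (\<lambda>x. norm (u i x - u j x))" by (intro sqint_norm sqint_diff u)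
      have one: "sqint M (\<lambda>x. 1 :: real)" by (rule sqint_bounded[where C = 1]) auto
      have "(LINT x|M. norm (u i x - u j x)) \<le> sqrt ((LINT x|M. (u i x - u j x) \<bullet> (u i x - u j x)) * measure M (space M))"
        using sqint_Cauchy_Schwarz[OF d one] by (simp add: dot_square_norm power2_eq_square abs_le_iff)
      also have "\<dots> \<le> sqrt ((LINT x|M. (u i x - u j x) \<bullet> (u i x - u j x)) * K)"
        by (intro real_sqrt_le_mono mult_left_mono integral_nonneg_AE) (auto simp: K_def)
      also have "\<dots> < sqrt (e\<^sup>2 / K * K)"
        using N[OF that] K by (intro real_sqrt_less_mono mult_strict_right_mono) auto
      also have "\<dots> = e" using K \<open>e > 0\<close> by simp
      finally show ?thesis .
    qed
    then show ?thesis by blast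
  qed
  then obtain r where r: "strict_mono r" "AE x in M. Cauchy (\<lambda>i. u (r i) x)"
    using cauchy_L1_AE_cauchy_subseq[of M u] sqint_integrable[OF u] by blast
  define w where "w x = lim (\<lambda>i. u (r i) x)" for x
  have w[measurable]: "w \<in> borel_measurable M"
    unfolding w_def by (rule borel_measurable_lim_metric) measurable
  have AE: "AE x in M. (\<lambda>i. u (r i) x) \<longlonglongrightarrow> w x"
    using r(2) by eventually_elim (simp add: w_def Cauchy_convergent_iff convergent_LIMSEQ_iff)
  have bound: "(\<integral>\<^sup>+x. ennreal ((norm (u n x - w x))\<^sup>2) \<partial>M) \<le> ennreal e"
    if N: "\<And>m n. m \<ge> N \<Longrightarrow> n \<ge> N \<Longrightarrow> (LINT x|M. (u m x - u n x) \<bullet> (u m x - u n x)) < e"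
      and n: "n \<ge> N" for n N e
  proof -
    have "(\<integral>\<^sup>+x. ennreal ((norm (u n x - w x))\<^sup>2) \<partial>M) \<le> (\<integral>\<^sup>+x. liminf (\<lambda>i. ennreal ((norm (u n x - u (r i) x))\<^sup>2)) \<partial>M)"
    proof (rule nn_integral_mono_AE)
      show "AE x in M. ennreal ((norm (u n x - w x))\<^sup>2) \<le> liminf (\<lambda>i. ennreal ((norm (u n x - u (r i) x))\<^sup>2))"
        using AE
      proof eventually_elim
        case (elim x)
        then have "(\<lambda>i. ennreal ((norm (u n x - u (r i) x))\<^sup>2)) \<longlonglongrightarrow> ennreal ((norm (u n x - w x))\<^sup>2)"
          by (intro tendsto_intros)
        from lim_imp_Liminf[OF sequentially_bot this] show ?case by simp
      qed
    qed
    also have "\<dots> \<le> liminf (\<lambda>i. \<integral>\<^sup>+x. ennreal ((norm (u n x - u (r i) x))\<^sup>2) \<partial>M)"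
      by (rule nn_integral_liminf) measurable
    also have "\<dots> \<le> ennreal e"
    proof (rule Liminf_le)
      show "\<forall>\<^sub>F i in sequentially. (\<integral>\<^sup>+x. ennreal ((norm (u n x - u (r i) x))\<^sup>2) \<partial>M) \<le> ennreal e"
      proof (rule eventually_sequentiallyI[of N])
        fix i assume "N \<le> i"
        then have "r i \<ge> N" using strict_mono_imp_increasing[OF r(1), of i] by linarith
        have "integrable M (\<lambda>x. (norm (u n x - u (r i) x))\<^sup>2)"
          using sqint_diff[OF u u] by (simp add: sqint_def)
        then have "(\<integral>\<^sup>+x. ennreal ((norm (u n x - u (r i) x))\<^sup>2) \<partial>M) = ennreal (LINT x|M. (norm (u n x - u (r i) x))\<^sup>2)"
          by (intro nn_integral_eq_integral) auto
        also have "\<dots> \<le> ennreal e"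
          using N[OF n \<open>r i \<ge> N\<close>] by (intro ennreal_leI) (simp add: power2_norm_eq_inner)
        finally show "(\<integral>\<^sup>+x. ennreal ((norm (u n x - u (r i) x))\<^sup>2) \<partial>M) \<le> ennreal e" .
      qed
    qed simp
    finally show ?thesis .
  qed
  have d: "sqint M (\<lambda>x. u n x - w x) \<and> (LINT x|M. (u n x - w x) \<bullet> (u n x - w x)) \<le> e"
    if N: "\<And>m n. m \<ge> N \<Longrightarrow> n \<ge> N \<Longrightarrow> (LINT x|M. (u m x - u n x) \<bullet> (u m x - u n x)) < e"
      and n: "n \<ge> N" and e: "0 < e" for n N e
  proof
    have b: "(\<integral>\<^sup>+x. ennreal ((norm (u n x - w x))\<^sup>2) \<partial>M) \<le> ennreal e" using bound[OF N n] .
    have i: "integrable M (\<lambda>x. (norm (u n x - w x))\<^sup>2)"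
      by (rule integrableI_bounded) (use b in \<open>auto simp: less_top[symmetric] top_unique\<close>)
    then show "sqint M (\<lambda>x. u n x - w x)" by (simp add: sqint_def)
    have "ennreal (LINT x|M. (norm (u n x - w x))\<^sup>2) = (\<integral>\<^sup>+x. ennreal ((norm (u n x - w x))\<^sup>2) \<partial>M)"
      using i by (intro nn_integral_eq_integral[symmetric]) auto
    then have "ennreal (LINT x|M. (norm (u n x - w x))\<^sup>2) \<le> ennreal e" using b by simp
    then show "(LINT x|M. (u n x - w x) \<bullet> (u n x - w x)) \<le> e"
      using e by (simp add: ennreal_le_iff power2_norm_eq_inner)
  qed
  obtain N where N: "\<And>m n. m \<ge> N \<Longrightarrow> n \<ge> N \<Longrightarrow> (LINT x|M. (u m x - u n x) \<bullet> (u m x - u n x)) < 1"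
    using Cauchy[of 1] by auto
  have "sqint M (\<lambda>x. u N x - (u N x - w x))"
    using sqint_diff[OF u conjunct1[OF d[OF N order_refl zero_less_one]]] .
  then have sw: "sqint M w" by simp
  moreover have "(\<lambda>n. LINT x|M. (u n x - w x) \<bullet> (u n x - w x)) \<longlonglongrightarrow> 0"
  proof (rule LIMSEQ_I)
    fix e :: real assume "0 < e"
    then obtain N where N: "\<And>m n. m \<ge> N \<Longrightarrow> n \<ge> N \<Longrightarrow> (LINT x|M. (u m x - u n x) \<bullet> (u m x - u n x)) < e / 2"
      using Cauchy[of "e / 2"] by auto
    have "norm ((LINT x|M. (u n x - w x) \<bullet> (u n x - w x)) - 0) < e" if "n \<ge> N" for n
    proof -
      have "0 \<le> (LINT x|M. (u n x - w x) \<bullet> (u n x - w x))" by (rule integral_nonneg_AE) auto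
      then show ?thesis using d[OF N that] \<open>0 < e\<close> by simp
    qed
    then show "\<exists>N. \<forall>n\<ge>N. norm ((LINT x|M. (u n x - w x) \<bullet> (u n x - w x)) - 0) < e" by blast
  qed
  ultimately show thesis by (rule that)
qed

lemma continuous_sqint:
  fixes f :: "'a::euclidean_space \<Rightarrow> 'b::euclidean_space"
  assumes S: "bounded S" "S \<in> sets lebesgue" and f: "continuous_on UNIV f"
  shows "sqint (lebesgue_on S) f"
proof -
  have "S \<in> lmeasurable" using S by (simp add: bounded_set_imp_lmeasurable)
  then interpret finite_measure "lebesgue_on S" by (rule finite_measure_lebesgue_on)
  have "compact (f ` closure S)"
    using S f by (intro compact_continuous_image) (auto simp: compact_closure elim: continuous_on_subset)
  then obtain C where C: "\<And>y. y \<in> f ` closure S \<Longrightarrow> norm y \<le> C"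
    using compact_imp_bounded bounded_iff by metis
  show ?thesis
  proof (rule sqint_bounded)
    show "f \<in> borel_measurable (lebesgue_on S)"
      using S f by (intro continuous_imp_measurable_on_sets_lebesgue) (auto elim: continuous_on_subset)
    show "norm (f x) \<le> C" if "x \<in> space (lebesgue_on S)" for x
      using that closure_subset by (intro C) auto
  qed
qed

lemma derivative_zero_outside_support:
  assumes "(\<phi> has_derivative \<phi>') (at x)" "x \<notin> closure {x. \<phi> x \<noteq> (0::real)}"
  shows "\<phi>' h = 0"
proof -
  have "((\<lambda>x. 0) has_derivative (\<lambda>h. 0)) (at x)" by simp
  then have "(\<phi> has_derivative (\<lambda>h. 0)) (at x)"
    by (rule has_derivative_transform_within_open[where s = "- closure {x. \<phi> x \<noteq> 0}"])
       (use assms(2) closure_subset[of "{x. \<phi> x \<noteq> 0}"] in auto)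
  then have "\<phi>' = (\<lambda>h. 0)" using assms(1) has_derivative_unique by blast
  then show ?thesis by simp
qed

text \<open>The integral of a translate of \<open>\<psi>\<close> does not depend on the translation; differentiate
  in the direction \<open>b\<close>.\<close>

lemma integral_derivative_zero:
  fixes \<psi> :: "'a::euclidean_space \<Rightarrow> real"
  assumes der: "\<And>x. (\<psi> has_derivative \<psi>' x) (at x)"
    and cont: "continuous_on UNIV (\<lambda>x. \<psi>' x b)"
    and supp: "bounded {x. \<psi> x \<noteq> 0}"
  shows "(LINT x|lborel. \<psi>' x b) = 0"
proof -
  obtain R where R: "\<And>x. \<psi> x \<noteq> 0 \<Longrightarrow> norm x \<le> R" "0 < R"
    using supp bounded_pos[of "{x. \<psi> x \<noteq> 0}"] by auto
  have D0: "\<psi>' x b = 0" if "R < norm x" for x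
  proof (rule derivative_zero_outside_support[OF der])
    have "closure {x. \<psi> x \<noteq> 0} \<subseteq> cball 0 R"
      by (rule closure_minimal) (use R in auto)
    then show "x \<notin> closure {x. \<psi> x \<noteq> 0}" using that by auto
  qed
  have "compact ((\<lambda>x. \<psi>' x b) ` cball 0 R)"
    using cont by (intro compact_continuous_image) (auto elim: continuous_on_subset)
  then obtain C where C: "\<And>y. y \<in> (\<lambda>x. \<psi>' x b) ` cball 0 R \<Longrightarrow> norm y \<le> C"
    using compact_imp_bounded bounded_iff by metis
  have bound: "\<bar>\<psi>' x b\<bar> \<le> max C 0" for x
  proof (cases "R < norm x")
    case True
    then show ?thesis using D0 by simp
  next
    case False
    then have "\<psi>' x b \<in> (\<lambda>x. \<psi>' x b) ` cball 0 R" by (intro imageI) simp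
    from C[OF this] show ?thesis by simp
  qed
  have psi_cont: "continuous_on UNIV \<psi>"
    using der has_derivative_continuous by (metis continuous_on_eq_continuous_at open_UNIV)
  have psi_meas[measurable]: "\<psi> \<in> borel_measurable lborel"
    using borel_measurable_continuous_onI[OF psi_cont] by simp
  have psi_int: "integrable lborel \<psi>"
  proof -
    have "integrable lborel (\<lambda>x. indicator (cball 0 R) x *\<^sub>R \<psi> x)"
      using psi_cont by (intro borel_integrable_compact) (auto elim: continuous_on_subset)
    moreover have "(\<lambda>x. indicator (cball 0 R) x *\<^sub>R \<psi> x) = \<psi>"
      using R(1) by (auto simp: indicator_def fun_eq_iff)
    ultimately show ?thesis by (simp only:)
  qed
  define h where "h n = 1 / real (Suc n)" for n
  have h: "0 < h n" "h n \<le> 1" for n by (auto simp: h_def)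
  have shift: "integrable lborel (\<lambda>x. \<psi> (x + t))" "(LINT x|lborel. \<psi> (x + t)) = (LINT x|lborel. \<psi> x)" for t
  proof -
    have eq: "distr lborel borel ((+) t) = lborel" by (rule lborel_distr_plus)
    show "integrable lborel (\<lambda>x. \<psi> (x + t))"
      using integrable_distr[of "(+) t" lborel borel \<psi>] psi_int eq by (simp add: add.commute)
    show "(LINT x|lborel. \<psi> (x + t)) = (LINT x|lborel. \<psi> x)"
      using integral_distr[of "(+) t" lborel borel \<psi>] eq by (simp add: add.commute)
  qed
  define f where "f n x = (\<psi> (x + h n *\<^sub>R b) - \<psi> x) / h n" for n x
  have lim: "(\<lambda>n. LINT x|lborel. f n x) \<longlonglongrightarrow> (LINT x|lborel. \<psi>' x b)"
  proof (rule integral_dominated_convergence)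
    show "(\<lambda>x. \<psi>' x b) \<in> borel_measurable lborel"
      using borel_measurable_continuous_onI[OF cont] by simp
    show "f n \<in> borel_measurable lborel" for n
      unfolding f_def using borel_measurable_integrable[OF shift(1)] by measurable
    \<comment> \<open>Since \<open>h n \<le> 1\<close>, the difference quotients vanish outside the
      ball enlarged by \<open>norm b\<close>; inside, the mean value theorem bounds them by the
      supremum of the derivative.\<close>
    show "integrable lborel (\<lambda>x. indicator (cball 0 (R + norm b)) x *\<^sub>R max C 0)"
      by (intro borel_integrable_compact) auto
    show "AE x in lborel. norm (f n x) \<le> indicator (cball 0 (R + norm b)) x *\<^sub>R max C 0" for n
    proof (rule AE_I2)
      fix x
      show "norm (f n x) \<le> indicator (cball 0 (R + norm b)) x *\<^sub>R max C 0"
      proof (cases "x \<in> cball 0 (R + norm b)")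
        case False
        have "norm (h n *\<^sub>R b) \<le> norm b" using h[of n] by (simp add: mult_left_le_one_le)
        then have "R < norm (x + h n *\<^sub>R b)"
          using False norm_triangle_ineq2[of x "- (h n *\<^sub>R b)"] by simp
        moreover have "R < norm x" using False norm_ge_zero[of b] by (simp del: norm_ge_zero)
        ultimately have "\<psi> (x + h n *\<^sub>R b) = 0" "\<psi> x = 0" using R(1) by (meson not_le)+
        then show ?thesis using False by (simp add: f_def)
      next
        case True
        have "((\<lambda>t. \<psi> (x + t *\<^sub>R b)) has_real_derivative \<psi>' (x + t *\<^sub>R b) b) (at t)" for t
        proof -
          have "((\<lambda>t. x + t *\<^sub>R b) has_derivative (\<lambda>s. s *\<^sub>R b)) (at t)"
            by (auto intro!: derivative_eq_intros)
          from has_derivative_compose[OF this der]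
          have "((\<lambda>t. \<psi> (x + t *\<^sub>R b)) has_derivative (\<lambda>s. \<psi>' (x + t *\<^sub>R b) (s *\<^sub>R b))) (at t)" .
          moreover have "\<psi>' (x + t *\<^sub>R b) (s *\<^sub>R b) = \<psi>' (x + t *\<^sub>R b) b * s" for s
            using linear_scale[OF has_derivative_linear[OF der]] by simp
          ultimately show ?thesis by (simp add: has_field_derivative_def)
        qed
        then obtain z where "\<psi> (x + h n *\<^sub>R b) - \<psi> (x + 0 *\<^sub>R b) = (h n - 0) * \<psi>' (x + z *\<^sub>R b) b"
          using MVT2[of 0 "h n" "\<lambda>t. \<psi> (x + t *\<^sub>R b)" "\<lambda>t. \<psi>' (x + t *\<^sub>R b) b"] h by blast
        then have "f n x = \<psi>' (x + z *\<^sub>R b) b" using h[of n] by (simp add: f_def)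
        then show ?thesis using bound True by simp
      qed
    qed
    show "AE x in lborel. (\<lambda>n. f n x) \<longlonglongrightarrow> \<psi>' x b"
    proof (rule AE_I2)
      fix x
      have "((\<lambda>t. \<psi> (x + t *\<^sub>R b)) has_real_derivative \<psi>' x b) (at 0)"
      proof -
        have "((\<lambda>t. x + t *\<^sub>R b) has_derivative (\<lambda>s. s *\<^sub>R b)) (at 0)"
          by (auto intro!: derivative_eq_intros)
        from has_derivative_compose[OF this der]
        have "((\<lambda>t. \<psi> (x + t *\<^sub>R b)) has_derivative (\<lambda>s. \<psi>' x (s *\<^sub>R b))) (at 0)" by simp
        moreover have "\<psi>' x (s *\<^sub>R b) = \<psi>' x b * s" for s
          using linear_scale[OF has_derivative_linear[OF der]] by simp
        ultimately show ?thesis by (simp add: has_field_derivative_def)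
      qed
      then have "((\<lambda>t. (\<psi> (x + t *\<^sub>R b) - \<psi> x) / t) \<longlongrightarrow> \<psi>' x b) (at 0)"
        by (simp add: DERIV_def)
      moreover have "h \<longlonglongrightarrow> 0"
        unfolding h_def using LIMSEQ_inverse_real_of_nat by (simp only: inverse_eq_divide)
      then have "filterlim h (at 0) sequentially"
        using h(1) by (auto simp: filterlim_at less_imp_neq[symmetric])
      ultimately show "(\<lambda>n. f n x) \<longlonglongrightarrow> \<psi>' x b"
        unfolding f_def by (rule filterlim_compose)
    qed
  qed
  have "(LINT x|lborel. f n x) = 0" for n
    unfolding f_def using shift psi_int by simp
  then show ?thesis using lim LIMSEQ_unique[OF _ tendsto_const] by simp
qed

text \<open>The definitions use Lebesgue measure on the domain, while translation invariance and
  Fubini are applied to \<open>lborel\<close>; this is the passage between them.\<close>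

lemma integral_lebesgue_on_eq_lborel:
  fixes f :: "'a::euclidean_space \<Rightarrow> real"
  assumes "S \<in> sets borel" "(\<lambda>x. indicator S x * f x) \<in> borel_measurable borel"
  shows "(LINT x|lebesgue_on S. f x) = (LINT x|lborel. indicator S x * f x)"
proof -
  have "(LINT x|lebesgue_on S. f x) = (LINT x|lebesgue. indicator S x *\<^sub>R f x)"
    using assms(1) by (intro integral_restrict_space) auto
  also have "\<dots> = (LINT x|lborel. indicator S x * f x)"
    using assms(2) by (subst integral_completion) auto
  finally show ?thesis .
qed

lemma test_function_facts:
  assumes "\<phi> \<in> test_functions S"
  shows "(\<phi> has_derivative frechet_derivative \<phi> (at x)) (at x)"
    and "b \<in> Basis \<Longrightarrow> continuous_on UNIV (\<lambda>x. frechet_derivative \<phi> (at x) b)"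
    and "continuous_on UNIV \<phi>"
    and "x \<notin> S \<Longrightarrow> \<phi> x = 0" "x \<notin> S \<Longrightarrow> frechet_derivative \<phi> (at x) b = 0"
    and "bounded {x. \<phi> x \<noteq> 0}"
proof -
  have C: "C_k k \<phi>" for k using assms by (simp add: test_functions_def)
  show d: "(\<phi> has_derivative frechet_derivative \<phi> (at x)) (at x)" for x using C_k_SucD(1)[OF C] .
  show "continuous_on UNIV (\<lambda>x. frechet_derivative \<phi> (at x) b)" if "b \<in> Basis"
    using C_k_continuous[OF C_k_SucD(2)[OF C that]] .
  show "continuous_on UNIV \<phi>" using C_k_continuous[OF C] .
  have cl: "closure {x. \<phi> x \<noteq> 0} \<subseteq> S" "compact (closure {x. \<phi> x \<noteq> 0})"
    using assms by (auto simp: test_functions_def)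
  show "\<phi> x = 0" if "x \<notin> S"
    using subsetD[OF closure_subset, of x "{x. \<phi> x \<noteq> 0}"] cl(1) that by auto
  show "frechet_derivative \<phi> (at x) b = 0" if "x \<notin> S"
    by (rule derivative_zero_outside_support[OF d]) (use cl(1) that in auto)
  show "bounded {x. \<phi> x \<noteq> 0}"
    by (rule bounded_subset[OF compact_imp_bounded[OF cl(2)] closure_subset])
qed

text \<open>The product of \<open>u\<close> with a test function has bounded support, so its
  directional derivative integrates to zero; the product rule then gives the defining
  identity.\<close>

lemma weak_gradient_C1:
  fixes u :: "'a::euclidean_space \<Rightarrow> real"
  assumes S: "open S" "bounded S"
    and der: "\<And>x. (u has_derivative (\<lambda>h. G x \<bullet> h)) (at x)" and G: "continuous_on UNIV G"
  shows "weak_gradient S u G"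
  unfolding weak_gradient_def
proof (intro ballI)
  fix \<phi> and b :: 'a assume \<phi>: "\<phi> \<in> test_functions S" and b: "b \<in> Basis"
  note t = test_function_facts[OF \<phi>]
  define D where "D x = u x * frechet_derivative \<phi> (at x) b + G x \<bullet> b * \<phi> x" for x
  have u: "continuous_on UNIV u"
    using der has_derivative_continuous by (metis continuous_on_eq_continuous_at open_UNIV)
  have c1: "continuous_on UNIV (\<lambda>x. u x * frechet_derivative \<phi> (at x) b)"
    using u t(2)[OF b] by (intro continuous_intros)
  have c2: "continuous_on UNIV (\<lambda>x. G x \<bullet> b * \<phi> x)"
    using G t(3) by (intro continuous_intros)
  have Sl: "S \<in> sets lebesgue" "S \<in> sets borel" using S by auto
  then interpret finite_measure "lebesgue_on S"
    using S by (intro finite_measure_lebesgue_on bounded_set_imp_lmeasurable)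
  have "(LINT x|lborel. D x) = 0"
    unfolding D_def
  proof (rule integral_derivative_zero[where \<psi> = "\<lambda>x. u x * \<phi> x"
      and \<psi>' = "\<lambda>x h. u x * frechet_derivative \<phi> (at x) h + G x \<bullet> h * \<phi> x"])
    show "((\<lambda>x. u x * \<phi> x) has_derivative (\<lambda>h. u x * frechet_derivative \<phi> (at x) h + G x \<bullet> h * \<phi> x)) (at x)" for x
      by (rule has_derivative_mult[OF der t(1)])
    show "continuous_on UNIV (\<lambda>x. u x * frechet_derivative \<phi> (at x) b + G x \<bullet> b * \<phi> x)"
      using c1 c2 by (rule continuous_on_add)
    show "bounded {x. u x * \<phi> x \<noteq> 0}"
      by (rule bounded_subset[OF t(6)]) auto
  qed
  also have "(LINT x|lborel. D x) = (LINT x|lborel. indicator S x * D x)"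
    using t(4,5) by (intro Bochner_Integration.integral_cong) (auto simp: D_def indicator_def)
  also have "\<dots> = (LINT x|lebesgue_on S. D x)"
  proof (rule integral_lebesgue_on_eq_lborel[symmetric])
    have "D \<in> borel_measurable borel"
      unfolding D_def using c1 c2 by (intro borel_measurable_continuous_onI continuous_on_add)
    then show "(\<lambda>x. indicator S x * D x) \<in> borel_measurable borel"
      using Sl by measurable
  qed (use Sl in simp)
  also have "\<dots> = (LINT x|lebesgue_on S. u x * frechet_derivative \<phi> (at x) b) + (LINT x|lebesgue_on S. G x \<bullet> b * \<phi> x)"
    unfolding D_def
    by (intro Bochner_Integration.integral_add sqint_integrable continuous_sqint S Sl c1 c2)
  finally show "(LINT x|lebesgue_on S. u x * frechet_derivative \<phi> (at x) b) = - (LINT x|lebesgue_on S. G x \<bullet> b * \<phi> x)"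
    by simp
qed

text \<open>A function is carried together with a chosen representative of its gradient, because the
  weak gradient is determined only almost everywhere; linear combinations are taken in both
  components.\<close>

definition pair_lin ::
    "real \<Rightarrow> ('a \<Rightarrow> real) \<times> ('a \<Rightarrow> 'b::real_vector) \<Rightarrow> real \<Rightarrow> ('a \<Rightarrow> real) \<times> ('a \<Rightarrow> 'b) \<Rightarrow> ('a \<Rightarrow> real) \<times> ('a \<Rightarrow> 'b)" where
  "pair_lin a p b q = ((\<lambda>x. a *\<^sub>R fst p x + b *\<^sub>R fst q x), (\<lambda>x. a *\<^sub>R snd p x + b *\<^sub>R snd q x))"

lemma H1_lin:
  assumes S: "open S" "bounded S" and p: "H1 S u g" and q: "H1 S v h"
  shows "H1 S (\<lambda>x. a *\<^sub>R u x + b *\<^sub>R v x) (\<lambda>x. a *\<^sub>R g x + b *\<^sub>R h x)"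
  unfolding H1_def
proof (intro conjI)
  have s: "sqint (lebesgue_on S) u" "sqint (lebesgue_on S) v" "sqint (lebesgue_on S) g" "sqint (lebesgue_on S) h"
    using p q by (auto simp: H1_def L2_iff_sqint)
  show "(\<lambda>x. a *\<^sub>R u x + b *\<^sub>R v x) \<in> L2 S" "(\<lambda>x. a *\<^sub>R g x + b *\<^sub>R h x) \<in> L2 S"
    using s by (auto simp: L2_iff_sqint simp del: real_scaleR_def intro: sqint_lin)
  show "weak_gradient S (\<lambda>x. a *\<^sub>R u x + b *\<^sub>R v x) (\<lambda>x. a *\<^sub>R g x + b *\<^sub>R h x)"
    unfolding weak_gradient_def
  proof (intro ballI)
    fix \<phi> and e :: 'a assume \<phi>: "\<phi> \<in> test_functions S" and e: "e \<in> Basis"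
    note t = test_function_facts[OF \<phi>]
    have w: "(LINT x|lebesgue_on S. u x * frechet_derivative \<phi> (at x) e) = - (LINT x|lebesgue_on S. g x \<bullet> e * \<phi> x)"
      "(LINT x|lebesgue_on S. v x * frechet_derivative \<phi> (at x) e) = - (LINT x|lebesgue_on S. h x \<bullet> e * \<phi> x)"
      using p q \<phi> e by (auto simp: H1_def weak_gradient_def)
    have st: "sqint (lebesgue_on S) (\<lambda>x. frechet_derivative \<phi> (at x) e)" "sqint (lebesgue_on S) (\<lambda>x. \<phi> x *\<^sub>R e)"
      using S t(2)[OF e] t(3) by (auto intro!: continuous_sqint continuous_intros)
    have "(LINT x|lebesgue_on S. (a *\<^sub>R u x + b *\<^sub>R v x) \<bullet> frechet_derivative \<phi> (at x) e)
        = - (LINT x|lebesgue_on S. (a *\<^sub>R g x + b *\<^sub>R h x) \<bullet> (\<phi> x *\<^sub>R e))"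
      using integral_inner_lin[OF s(1,2) st(1), of a b] integral_inner_lin[OF s(3,4) st(2), of a b] w
      by (simp add: mult.commute)
    then show "(LINT x|lebesgue_on S. (a *\<^sub>R u x + b *\<^sub>R v x) * frechet_derivative \<phi> (at x) e)
        = - (LINT x|lebesgue_on S. (a *\<^sub>R g x + b *\<^sub>R h x) \<bullet> e * \<phi> x)"
      by (simp add: mult.commute)
  qed
qed

text \<open>Both sides of the weak gradient identity are L2 products with fixed functions, so the
  identity survives the limits of the functions and of their gradients.\<close>

lemma H1_complete:
  assumes S: "open S" "bounded S" and H: "\<And>n. H1 S (u n) (g n)"
    and Cu: "\<And>e. e > 0 \<Longrightarrow> \<exists>N. \<forall>m\<ge>N. \<forall>n\<ge>N. (LINT x|lebesgue_on S. (u m x - u n x) \<bullet> (u m x - u n x)) < e"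
    and Cg: "\<And>e. e > 0 \<Longrightarrow> \<exists>N. \<forall>m\<ge>N. \<forall>n\<ge>N. (LINT x|lebesgue_on S. (g m x - g n x) \<bullet> (g m x - g n x)) < e"
  shows "\<exists>v h. H1 S v h \<and> (\<lambda>n. LINT x|lebesgue_on S. (u n x - v x) \<bullet> (u n x - v x)) \<longlonglongrightarrow> 0
     \<and> (\<lambda>n. LINT x|lebesgue_on S. (g n x - h x) \<bullet> (g n x - h x)) \<longlonglongrightarrow> 0"
proof -
  interpret finite_measure "lebesgue_on S"
    using S by (intro finite_measure_lebesgue_on bounded_set_imp_lmeasurable) auto
  have s: "sqint (lebesgue_on S) (u n)" "sqint (lebesgue_on S) (g n)" for n
    using H by (auto simp: H1_def L2_iff_sqint)
  obtain v where v: "sqint (lebesgue_on S) v" "(\<lambda>n. LINT x|lebesgue_on S. (u n x - v x) \<bullet> (u n x - v x)) \<longlonglongrightarrow> 0"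
    using sqint_complete[OF s(1) Cu] by blast
  obtain h where h: "sqint (lebesgue_on S) h" "(\<lambda>n. LINT x|lebesgue_on S. (g n x - h x) \<bullet> (g n x - h x)) \<longlonglongrightarrow> 0"
    using sqint_complete[OF s(2) Cg] by blast
  have "weak_gradient S v h"
    unfolding weak_gradient_def
  proof (intro ballI)
    fix \<phi> and e :: 'a assume \<phi>: "\<phi> \<in> test_functions S" and e: "e \<in> Basis"
    note t = test_function_facts[OF \<phi>]
    have st: "sqint (lebesgue_on S) (\<lambda>x. frechet_derivative \<phi> (at x) e)" "sqint (lebesgue_on S) (\<lambda>x. \<phi> x *\<^sub>R e)"
      using S t(2)[OF e] t(3) by (auto intro!: continuous_sqint continuous_intros)
    have "(LINT x|lebesgue_on S. u n x * frechet_derivative \<phi> (at x) e) = - (LINT x|lebesgue_on S. g n x \<bullet> e * \<phi> x)" for n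
      using H \<phi> e by (auto simp: H1_def weak_gradient_def)
    then have "(\<lambda>n. LINT x|lebesgue_on S. u n x \<bullet> frechet_derivative \<phi> (at x) e)
        = (\<lambda>n. - (LINT x|lebesgue_on S. g n x \<bullet> (\<phi> x *\<^sub>R e)))"
      by (simp add: mult.commute)
    then have "(LINT x|lebesgue_on S. v x \<bullet> frechet_derivative \<phi> (at x) e) = - (LINT x|lebesgue_on S. h x \<bullet> (\<phi> x *\<^sub>R e))"
      using sqint_tendsto_inner[OF s(1) v(1) st(1) v(2)] tendsto_minus[OF sqint_tendsto_inner[OF s(2) h(1) st(2) h(2)]]
      by (metis (no_types, lifting) LIMSEQ_unique)
    then show "(LINT x|lebesgue_on S. v x * frechet_derivative \<phi> (at x) e) = - (LINT x|lebesgue_on S. h x \<bullet> e * \<phi> x)"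
      by (simp add: mult.commute)
  qed
  then show ?thesis using v h by (auto simp: H1_def L2_iff_sqint)
qed

section \<open>Compactness on the parallelogram\<close>

lemma sqint_sum:
  assumes "\<And>i. i \<in> F \<Longrightarrow> sqint M (e i)"
  shows "sqint M (\<lambda>x. \<Sum>i\<in>F. a i * e i x :: real)"
  using assms
proof (induction F rule: infinite_finite_induct)
  case (insert j F)
  then show ?case using sqint_lin[of M "e j" "\<lambda>x. \<Sum>i\<in>F. a i * e i x" "a j" 1] by simp
qed (auto simp: sqint_def)

lemma sqint_real_mult: "sqint M u \<Longrightarrow> sqint M v \<Longrightarrow> integrable M (\<lambda>x. u x * v x :: real)"
  using sqint_inner[of M u v] by simp

lemma integral_orthogonal_approx:
  fixes e :: "'i \<Rightarrow> 'a \<Rightarrow> real"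
  assumes F: "finite F" and w: "sqint M w" and e: "\<And>i. i \<in> F \<Longrightarrow> sqint M (e i)"
    and orth: "\<And>i j. i \<in> F \<Longrightarrow> j \<in> F \<Longrightarrow> (LINT x|M. e i x * e j x) = (if i = j then n i else 0)"
  shows "(LINT x|M. (w x - (\<Sum>i\<in>F. a i * e i x))\<^sup>2)
    = (LINT x|M. (w x)\<^sup>2) - 2 * (\<Sum>i\<in>F. a i * (LINT x|M. w x * e i x)) + (\<Sum>i\<in>F. (a i)\<^sup>2 * n i)"
proof -
  define z where "z x = (\<Sum>i\<in>F. a i * e i x)" for x
  have z: "sqint M z" unfolding z_def using e by (rule sqint_sum)
  have wz: "(LINT x|M. w x * z x) = (\<Sum>i\<in>F. a i * (LINT x|M. w x * e i x))"
  proof -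
    have "(LINT x|M. w x * z x) = (LINT x|M. (\<Sum>i\<in>F. a i * (w x * e i x)))"
      by (simp add: z_def sum_distrib_left mult_ac)
    also have "\<dots> = (\<Sum>i\<in>F. (LINT x|M. a i * (w x * e i x)))"
      using e w by (intro Bochner_Integration.integral_sum integrable_mult_right sqint_real_mult)
    finally show ?thesis by simp
  qed
  have ze: "(LINT x|M. z x * e i x) = a i * n i" if i: "i \<in> F" for i
  proof -
    have "(LINT x|M. z x * e i x) = (LINT x|M. (\<Sum>j\<in>F. a j * (e j x * e i x)))"
      by (simp only: z_def sum_distrib_right mult.assoc)
    also have "\<dots> = (\<Sum>j\<in>F. (LINT x|M. a j * (e j x * e i x)))"
      using e i by (intro Bochner_Integration.integral_sum integrable_mult_right sqint_real_mult)
    also have "\<dots> = (\<Sum>j\<in>F. if j = i then a i * n i else 0)"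
      using i orth by (intro sum.cong) auto
    finally show ?thesis using F i by simp
  qed
  have zz: "(LINT x|M. z x * z x) = (\<Sum>i\<in>F. (a i)\<^sup>2 * n i)"
  proof -
    have "(LINT x|M. z x * z x) = (LINT x|M. (\<Sum>i\<in>F. a i * (z x * e i x)))"
    proof -
      have "z x * z x = (\<Sum>i\<in>F. a i * (z x * e i x))" for x
        by (subst (2) z_def) (simp add: sum_distrib_left mult_ac)
      then show ?thesis by simp
    qed
    also have "\<dots> = (\<Sum>i\<in>F. (LINT x|M. a i * (z x * e i x)))"
      using e z by (intro Bochner_Integration.integral_sum integrable_mult_right sqint_real_mult)
    also have "\<dots> = (\<Sum>i\<in>F. (a i)\<^sup>2 * n i)"
      by (intro sum.cong) (auto simp: ze power2_eq_square)
    finally show ?thesis .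
  qed
  have int: "integrable M (\<lambda>x. w x * w x)" "integrable M (\<lambda>x. w x * z x)" "integrable M (\<lambda>x. z x * z x)"
    using w z by (auto intro: sqint_real_mult)
  have "(LINT x|M. (w x - z x)\<^sup>2) = (LINT x|M. w x * w x - 2 * (w x * z x) + z x * z x)"
    by (simp add: power2_eq_square algebra_simps)
  also have "\<dots> = (LINT x|M. w x * w x) - 2 * (LINT x|M. w x * z x) + (LINT x|M. z x * z x)"
    using int by simp
  finally show ?thesis unfolding wz zz by (simp add: z_def power2_eq_square)
qed

text \<open>The \<open>e i\<close> are orthogonal with squared norms \<open>n i\<close>. The second
  estimate holds for arbitrary coefficients \<open>a\<close>, since the Fourier coefficients give
  the best approximation; combined with a density statement it replaces Parseval's identity.\<close>

lemma Bessel_ineq: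
  fixes e :: "'i \<Rightarrow> 'a \<Rightarrow> real"
  assumes F: "finite F" and w: "sqint M w" and e: "\<And>i. i \<in> F \<Longrightarrow> sqint M (e i)"
    and orth: "\<And>i j. i \<in> F \<Longrightarrow> j \<in> F \<Longrightarrow> (LINT x|M. e i x * e j x) = (if i = j then n i else 0)"
    and n: "\<And>i. i \<in> F \<Longrightarrow> 0 < n i"
  shows "(\<Sum>i\<in>F. (LINT x|M. w x * e i x)\<^sup>2 / n i) \<le> (LINT x|M. (w x)\<^sup>2)"
    and "(LINT x|M. (w x)\<^sup>2) \<le> (\<Sum>i\<in>F. (LINT x|M. w x * e i x)\<^sup>2 / n i) + (LINT x|M. (w x - (\<Sum>i\<in>F. a i * e i x))\<^sup>2)"
proof -
  note ap = integral_orthogonal_approx[OF F w e orth]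
  define c where "c i = (LINT x|M. w x * e i x)" for i
  have "0 \<le> (LINT x|M. (w x - (\<Sum>i\<in>F. c i / n i * e i x))\<^sup>2)" by (rule integral_nonneg_AE) auto
  also have "\<dots> = (LINT x|M. (w x)\<^sup>2) - 2 * (\<Sum>i\<in>F. c i / n i * c i) + (\<Sum>i\<in>F. (c i / n i)\<^sup>2 * n i)"
    unfolding c_def by (rule ap)
  also have "(\<Sum>i\<in>F. (c i / n i)\<^sup>2 * n i) = (\<Sum>i\<in>F. (c i)\<^sup>2 / n i)"
    using n by (intro sum.cong) (auto simp: power2_eq_square)
  finally show "(\<Sum>i\<in>F. (LINT x|M. w x * e i x)\<^sup>2 / n i) \<le> (LINT x|M. (w x)\<^sup>2)"
    by (simp add: c_def power2_eq_square)
  have "2 * (\<Sum>i\<in>F. a i * c i) - (\<Sum>i\<in>F. (a i)\<^sup>2 * n i) \<le> (\<Sum>i\<in>F. (c i)\<^sup>2 / n i)"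
    unfolding sum_distrib_left sum_subtractf[symmetric]
  proof (rule sum_mono)
    fix i assume "i \<in> F"
    then have "0 < n i" using n by simp
    have "0 \<le> (c i - a i * n i)\<^sup>2 / n i" using \<open>0 < n i\<close> by simp
    also have "\<dots> = (c i)\<^sup>2 / n i - (2 * (a i * c i) - (a i)\<^sup>2 * n i)"
      using \<open>0 < n i\<close> by (simp add: power2_eq_square field_simps)
    finally show "2 * (a i * c i) - (a i)\<^sup>2 * n i \<le> (c i)\<^sup>2 / n i" by simp
  qed
  then show "(LINT x|M. (w x)\<^sup>2) \<le> (\<Sum>i\<in>F. (LINT x|M. w x * e i x)\<^sup>2 / n i) + (LINT x|M. (w x - (\<Sum>i\<in>F. a i * e i x))\<^sup>2)"
    using ap[of a] unfolding c_def by simp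
qed

lemma integral_FTC:
  fixes F f :: "real \<Rightarrow> real"
  assumes "\<And>x. (F has_real_derivative f x) (at x)"
  shows "integral {0..1} f = F 1 - F 0"
proof -
  have "(f has_integral (F 1 - F 0)) {0..1}"
    using assms by (intro fundamental_theorem_of_calculus)
      (auto intro: has_field_derivative_at_within simp: has_real_derivative_iff_has_vector_derivative[symmetric])
  then show ?thesis by (rule integral_unique)
qed

lemma integral_cos_affine: "(a::real) \<noteq> 0 \<Longrightarrow> integral {0..1} (\<lambda>s. cos (a * s + b)) = (sin (a + b) - sin b) / a"
  by (subst integral_FTC[where F = "\<lambda>s. sin (a * s + b) / a"])
     (auto intro!: derivative_eq_intros simp: diff_divide_distrib)

lemma integral_sin_affine: "(a::real) \<noteq> 0 \<Longrightarrow> integral {0..1} (\<lambda>s. sin (a * s + b)) = (cos b - cos (a + b)) / a"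
  by (subst integral_FTC[where F = "\<lambda>s. - cos (a * s + b) / a"])
     (auto intro!: derivative_eq_intros simp: diff_divide_distrib)

lemma integral_cos_nat: "integral {0..1} (\<lambda>s. cos (real n * pi * s)) = (if n = 0 then 1 else 0)"
  using integral_cos_affine[of "real n * pi" 0] by simp

lemma cos_nat_diff: "cos (real m * x - real n * x) = cos (real (nat \<bar>int m - int n\<bar>) * x)"
proof (cases "m \<ge> n")
  case True
  then show ?thesis by (simp add: left_diff_distrib of_nat_diff nat_diff_distrib')
next
  case False
  have "cos (real m * x - real n * x) = cos (real n * x - real m * x)"
    using cos_minus[of "real m * x - real n * x"] by simp
  then show ?thesis using False by (simp add: left_diff_distrib of_nat_diff nat_diff_distrib' abs_if)
qed

lemma integral_cos_cos: "integral {0..1} (\<lambda>s. cos (real m * pi * s) * cos (real n * pi * s))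
    = (if m = n then if m = 0 then 1 else 1 / 2 else 0)" (is ?C)
  and integral_sin_sin: "integral {0..1} (\<lambda>s. sin (real m * pi * s) * sin (real n * pi * s))
    = (if m = n \<and> m \<noteq> 0 then 1 / 2 else 0)" (is ?S)
proof -
  let ?k = "nat \<bar>int m - int n\<bar>"
  have d: "cos (real m * pi * s - real n * pi * s) = cos (real ?k * pi * s)" for s
    using cos_nat_diff[of m "pi * s" n] by (simp add: mult.assoc)
  have a: "cos (real m * pi * s + real n * pi * s) = cos (real (m + n) * pi * s)" for s
    by (simp add: algebra_simps)
  have i: "(\<lambda>s. cos (real k * pi * s)) integrable_on {0..1}" for k
    by (intro integrable_continuous_real continuous_intros)
  have "integral {0..1} (\<lambda>s. cos (real m * pi * s) * cos (real n * pi * s))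
      = integral {0..1} (\<lambda>s. (cos (real ?k * pi * s) + cos (real (m + n) * pi * s)) / 2)"
    by (simp only: cos_times_cos d a)
  also have "\<dots> = (integral {0..1} (\<lambda>s. cos (real ?k * pi * s)) + integral {0..1} (\<lambda>s. cos (real (m + n) * pi * s))) / 2"
    using i by (simp only: integral_divide Henstock_Kurzweil_Integration.integral_add)
  finally show ?C unfolding integral_cos_nat by auto
  have "integral {0..1} (\<lambda>s. sin (real m * pi * s) * sin (real n * pi * s))
      = integral {0..1} (\<lambda>s. (cos (real ?k * pi * s) - cos (real (m + n) * pi * s)) / 2)"
    by (simp only: sin_times_sin d a)
  also have "\<dots> = (integral {0..1} (\<lambda>s. cos (real ?k * pi * s)) - integral {0..1} (\<lambda>s. cos (real (m + n) * pi * s))) / 2"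
    using i by (simp only: integral_divide Henstock_Kurzweil_Integration.integral_diff)
  finally show ?S unfolding integral_cos_nat by (auto split: if_splits)
qed

section \<open>The parallelogram and its affine coordinates\<close>

locale parallelogram_domain =
  fixes c d :: real
  assumes d_pos: "0 < d"
begin

abbreviation "\<Omega> \<equiv> parallelogram c d"
abbreviation "M \<equiv> lebesgue_on \<Omega>"

text \<open>\<open>a1\<close>, \<open>a2\<close> is the basis dual to \<open>e1\<close>, \<open>e2\<close>, so that \<open>x \<bullet> a1\<close> and \<open>x \<bullet> a2\<close>
  are the affine coordinates on the parallelogram.\<close>

definition e1 :: "real \<times> real" where "e1 = (1, 0)"
definition e2 :: "real \<times> real" where "e2 = (c, d)"
definition a1 :: "real \<times> real" where "a1 = (1, - c / d)"
definition a2 :: "real \<times> real" where "a2 = (0, 1 / d)"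

lemma dual: "e1 \<bullet> a1 = 1" "e1 \<bullet> a2 = 0" "e2 \<bullet> a1 = 0" "e2 \<bullet> a2 = 1"
  using d_pos by (auto simp: e1_def e2_def a1_def a2_def)

lemma decomp: "x = (x \<bullet> a1) *\<^sub>R e1 + (x \<bullet> a2) *\<^sub>R e2"
  using d_pos by (cases x) (auto simp: e1_def e2_def a1_def a2_def)

lemma in_parallelogram: "x \<in> \<Omega> \<longleftrightarrow> 0 < x \<bullet> a1 \<and> x \<bullet> a1 < 1 \<and> 0 < x \<bullet> a2 \<and> x \<bullet> a2 < 1"
proof
  assume "x \<in> \<Omega>"
  then obtain s t where "x = s *\<^sub>R e1 + t *\<^sub>R e2" "0 < s" "s < 1" "0 < t" "t < 1"
    by (auto simp: parallelogram_def e1_def e2_def)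
  then show "0 < x \<bullet> a1 \<and> x \<bullet> a1 < 1 \<and> 0 < x \<bullet> a2 \<and> x \<bullet> a2 < 1"
    by (simp add: inner_add_left dual)
next
  assume "0 < x \<bullet> a1 \<and> x \<bullet> a1 < 1 \<and> 0 < x \<bullet> a2 \<and> x \<bullet> a2 < 1"
  then show "x \<in> \<Omega>"
    unfolding parallelogram_def using decomp[of x] unfolding e1_def e2_def by blast
qed

lemma open_parallelogram: "open \<Omega>"
proof -
  have "\<Omega> = {x. 0 < x \<bullet> a1} \<inter> {x. x \<bullet> a1 < 1} \<inter> {x. 0 < x \<bullet> a2} \<inter> {x. x \<bullet> a2 < 1}"
    using in_parallelogram by auto
  then show ?thesis by (auto intro!: open_Int open_Collect_less continuous_intros)
qed

lemma bounded_parallelogram: "bounded \<Omega>"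
proof (rule boundedI)
  fix x assume x: "x \<in> \<Omega>"
  have "norm ((x \<bullet> a1) *\<^sub>R e1 + (x \<bullet> a2) *\<^sub>R e2) \<le> norm ((x \<bullet> a1) *\<^sub>R e1) + norm ((x \<bullet> a2) *\<^sub>R e2)"
    by (rule norm_triangle_ineq)
  also have "\<dots> \<le> 1 * norm e1 + 1 * norm e2"
    using x unfolding in_parallelogram norm_scaleR by (intro add_mono mult_right_mono) auto
  finally show "norm x \<le> 1 * norm e1 + 1 * norm e2" using decomp[of x] by simp
qed

lemma sets_parallelogram: "\<Omega> \<in> sets lebesgue" "\<Omega> \<in> sets borel"
  using open_parallelogram by auto

sublocale finite_measure M
  using bounded_parallelogram sets_parallelogram
  by (intro finite_measure_lebesgue_on bounded_set_imp_lmeasurable)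

lemma continuous_sqint_M: "continuous_on UNIV f \<Longrightarrow> sqint M f"
  using bounded_parallelogram sets_parallelogram by (intro continuous_sqint)

lemma continuous_coord: "continuous_on UNIV f \<Longrightarrow> continuous_on UNIV (\<lambda>x. f (x \<bullet> a))"
  for f :: "real \<Rightarrow> real" and a :: "real \<times> real"
  by (rule continuous_on_compose2[where f = "\<lambda>x. x \<bullet> a" and t = UNIV]) (auto intro: continuous_intros)

text \<open>In affine coordinates the domain is the unit square and the Jacobian is
  \<open>d\<close>. It appears in two steps: a shear, harmless by translation invariance, and a
  scaling by \<open>d\<close>.\<close>

lemma integral_product:
  fixes f g :: "real \<Rightarrow> real"
  assumes f: "continuous_on UNIV f" and g: "continuous_on UNIV g"
  shows "(LINT x|M. f (x \<bullet> a1) * g (x \<bullet> a2)) = d * (integral {0..1} f * integral {0..1} g)"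
proof -
  define F where "F x = indicator \<Omega> x * (f (x \<bullet> a1) * g (x \<bullet> a2))" for x
  define \<phi> where "\<phi> s = indicator {0<..<1} s * f s" for s
  define \<psi> where "\<psi> t = indicator {0<..<1} t * g t" for t
  have cont: "continuous_on UNIV (\<lambda>x. f (x \<bullet> a1) * g (x \<bullet> a2))"
    using f g by (intro continuous_on_mult continuous_coord)
  have meas: "F \<in> borel_measurable borel"
    unfolding F_def using borel_measurable_continuous_onI[OF cont] sets_parallelogram by measurable
  have "(LINT x|M. f (x \<bullet> a1) * g (x \<bullet> a2)) = (LINT x|lborel. F x)"
    unfolding F_def by (rule integral_lebesgue_on_eq_lborel[OF sets_parallelogram(2) meas[unfolded F_def[abs_def]]])
  also have "\<dots> = (LINT x|(lborel \<Otimes>\<^sub>M lborel). F x)" by (simp add: lborel_prod)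
  also have "F = (\<lambda>(x, y). \<phi> (x - c / d * y) * \<psi> (y / d))"
    by (auto simp: F_def \<phi>_def \<psi>_def fun_eq_iff indicator_def in_parallelogram a1_def a2_def mult.commute)
  also have "(LINT p|(lborel \<Otimes>\<^sub>M lborel). (case p of (x, y) \<Rightarrow> \<phi> (x - c / d * y) * \<psi> (y / d)))
     = (LINT y|lborel. LINT x|lborel. \<phi> (x - c / d * y) * \<psi> (y / d))"
  proof (rule lborel_pair.integral_snd[symmetric])
    have "integrable lborel (\<lambda>x. indicator (closure \<Omega>) x *\<^sub>R (f (x \<bullet> a1) * g (x \<bullet> a2)))"
      using cont bounded_parallelogram
      by (intro borel_integrable_compact) (auto simp: compact_closure elim: continuous_on_subset)
    then have "integrable lborel F"
    proof (rule Bochner_Integration.integrable_bound)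
      show "AE x in lborel. norm (F x) \<le> norm (indicator (closure \<Omega>) x *\<^sub>R (f (x \<bullet> a1) * g (x \<bullet> a2)))"
        using closure_subset[of \<Omega>] by (intro AE_I2) (auto simp: F_def indicator_def)
    qed (use meas in simp)
    moreover have "F = (\<lambda>(x, y). \<phi> (x - c / d * y) * \<psi> (y / d))"
      by (auto simp: F_def \<phi>_def \<psi>_def fun_eq_iff indicator_def in_parallelogram a1_def a2_def mult.commute)
    ultimately show "integrable (lborel \<Otimes>\<^sub>M lborel) (\<lambda>(x, y). \<phi> (x - c / d * y) * \<psi> (y / d))"
      by (simp add: lborel_prod)
  qed
  also have "\<dots> = (LINT y|lborel. (LINT x|lborel. \<phi> x) * \<psi> (y / d))"
  proof -
    have "(LINT x|lborel. \<phi> (x - c / d * y)) = (LINT x|lborel. \<phi> x)" for y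
      using lborel_integral_real_affine[of 1 \<phi> "- (c / d * y)"] by simp
    then show ?thesis by simp
  qed
  also have "\<dots> = (LINT x|lborel. \<phi> x) * (LINT y|lborel. \<psi> (y / d))" by simp
  also have "(LINT y|lborel. \<psi> (y / d)) = d * (LINT y|lborel. \<psi> y)"
    using lborel_integral_real_affine[of d "\<lambda>y. \<psi> (y / d)" 0] d_pos by simp
  finally have eq: "(LINT x|M. f (x \<bullet> a1) * g (x \<bullet> a2)) = (LINT x|lborel. \<phi> x) * (d * (LINT y|lborel. \<psi> y))" .
  have one: "(LINT s|lborel. indicator {0<..<1} s * h s) = integral {0..1} h" if h: "continuous_on UNIV h" for h :: "real \<Rightarrow> real"
  proof -
    have "set_integrable lborel {0..1} h"
      unfolding set_integrable_def using h by (intro borel_integrable_compact) (auto elim: continuous_on_subset)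
    then have "set_integrable lborel {0<..<1} h" by (rule set_integrable_subset) auto
    then have "(LINT s:{0<..<1}|lborel. h s) = integral {0<..<1} h" by (rule set_borel_integral_eq_integral(2))
    then show ?thesis by (simp add: set_lebesgue_integral_def integral_open_interval_real)
  qed
  show ?thesis unfolding eq \<phi>_def \<psi>_def one[OF f] one[OF g] by simp
qed

lemma cutoff'_continuous: "continuous_on UNIV (cutoff' N)"
proof -
  have "continuous_on UNIV (\<lambda>x. flat p (a * x + b))" for p a b
  proof -
    have "continuous_on UNIV (flat p)" by (rule C_k_continuous[OF C_k_flat])
    then show ?thesis
      by (rule continuous_on_compose2[where f = "\<lambda>x. a * x + b" and s = UNIV]) (auto intro!: continuous_intros)
  qed
  from this[of _ "real N" "-1"] this[of _ "- real N" "real N - 1"] show ?thesis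
    unfolding cutoff'_def by (intro continuous_intros) (auto simp: algebra_simps)
qed

text \<open>Integration by parts without boundary terms against a vector field \<open>F(p) G(q) E\<close> that is
  tangential to \<open>\<partial>\<Omega>\<close>: it is a limit of compactly supported fields.\<close>

lemma boundary_integration_by_parts:
  fixes F F' G :: "real \<Rightarrow> real"
  assumes H: "H1 \<Omega> u g"
    and E: "E \<bullet> p = 1" "E \<bullet> q = 0" and pq: "\<And>x. x \<in> \<Omega> \<longleftrightarrow> 0 < x \<bullet> p \<and> x \<bullet> p < 1 \<and> 0 < x \<bullet> q \<and> x \<bullet> q < 1"
    and F: "\<And>k. C_k k F" "\<And>s. (F has_real_derivative F' s) (at s)" "continuous_on UNIV F'" "\<And>s. \<bar>F' s\<bar> \<le> B"
    and FK: "\<And>s. 0 < s \<Longrightarrow> s < 1 \<Longrightarrow> \<bar>F s\<bar> \<le> K * s \<and> \<bar>F s\<bar> \<le> K * (1 - s)"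
    and G: "\<And>k. C_k k G" "\<And>s. \<bar>G s\<bar> \<le> 1"
  shows "(LINT x|M. (g x \<bullet> E) * (F (x \<bullet> p) * G (x \<bullet> q))) = - (LINT x|M. u x * (F' (x \<bullet> p) * G (x \<bullet> q)))"
proof -
  have su: "sqint M u" and sg: "sqint M g" and wg: "weak_gradient \<Omega> u g"
    using H by (auto simp: H1_def L2_iff_sqint)
  have mu[measurable]: "u \<in> borel_measurable M" and mg[measurable]: "g \<in> borel_measurable M"
    using su sg by (auto simp: sqint_def)
  define \<theta> where "\<theta> = cutoff"
  define \<phi> where "\<phi> N x = (F (x \<bullet> p) * \<theta> N (x \<bullet> p)) * (G (x \<bullet> q) * \<theta> N (x \<bullet> q))" for N x
  define A where "A N x = (F' (x \<bullet> p) * \<theta> N (x \<bullet> p) + F (x \<bullet> p) * cutoff' N (x \<bullet> p)) * (G (x \<bullet> q) * \<theta> N (x \<bullet> q))" for N x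
  have C1: "C_k k (\<lambda>x. h (x \<bullet> a))" if "C_k k h" for h :: "real \<Rightarrow> real" and a :: "real \<times> real" and k
    using C_k_affine[OF that, of a 0] by simp
  have Ck: "C_k k (\<phi> N)" for k N
    unfolding \<phi>_def[abs_def] \<theta>_def by (intro C_k_mult C1 F G C_k_cutoff)
  have test: "\<phi> N \<in> test_functions \<Omega>" for N
  proof -
    define Q where "Q = {x. 1 / real N \<le> x \<bullet> p} \<inter> {x. x \<bullet> p \<le> 1 - 1 / real N} \<inter> {x. 1 / real N \<le> x \<bullet> q} \<inter> {x. x \<bullet> q \<le> 1 - 1 / real N}"
    have "closed Q" unfolding Q_def by (intro closed_Int closed_Collect_le continuous_intros)
    have supp: "N > 0 \<and> x \<in> Q" if "\<phi> N x \<noteq> 0" for x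
      using that cutoff_nonzeroD[of N "x \<bullet> p"] cutoff_nonzeroD[of N "x \<bullet> q"]
      by (auto simp: \<phi>_def \<theta>_def Q_def)
    have cl: "closure {x. \<phi> N x \<noteq> 0} \<subseteq> \<Omega>"
    proof (cases "N = 0")
      case True
      then have "{x. \<phi> N x \<noteq> 0} = {}" using supp by auto
      then show ?thesis by (simp only: closure_empty empty_subsetI)
    next
      case False
      have "closure {x. \<phi> N x \<noteq> 0} \<subseteq> Q" using supp \<open>closed Q\<close> by (intro closure_minimal) auto
      also have "Q \<subseteq> \<Omega>"
      proof
        fix x assume "x \<in> Q"
        moreover have "0 < 1 / real N" using False by simp
        ultimately show "x \<in> \<Omega>" unfolding pq Q_def Int_iff mem_Collect_eq by linarith
      qed
      finally show ?thesis .
    qed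
    moreover have "compact (closure {x. \<phi> N x \<noteq> 0})"
      using bounded_subset[OF bounded_parallelogram cl] by (simp add: compact_eq_bounded_closed)
    ultimately show ?thesis using Ck by (simp add: test_functions_def)
  qed
  note tf = test_function_facts[OF test]
  \<comment> \<open>Because \<open>E \<bullet> q = 0\<close>, the factor in
    \<open>x \<bullet> q\<close> is not differentiated. The derivative of its cut-off, which
    \<open>G\<close> could not compensate, therefore does not occur.\<close>
  have deriv: "frechet_derivative (\<phi> N) (at x) E = A N x" for N x
  proof -
    have lin: "((\<lambda>x. x \<bullet> a) has_derivative (\<lambda>h. h \<bullet> a)) (at x)" for a :: "real \<times> real"
      by (auto intro!: derivative_eq_intros)
    have "((\<lambda>s. F s * \<theta> N s) has_real_derivative F' s * \<theta> N s + cutoff' N s * F s) (at s)" for s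
      unfolding \<theta>_def by (rule DERIV_mult[OF F(2) DERIV_cutoff])
    from has_derivative_compose[OF lin this[unfolded has_field_derivative_def]]
    have dp: "((\<lambda>x. F (x \<bullet> p) * \<theta> N (x \<bullet> p)) has_derivative
        (\<lambda>h. (F' (x \<bullet> p) * \<theta> N (x \<bullet> p) + cutoff' N (x \<bullet> p) * F (x \<bullet> p)) * (h \<bullet> p))) (at x)" .
    have "C_k (Suc 0) (\<lambda>s. G s * \<theta> N s)" unfolding \<theta>_def by (intro C_k_mult G C_k_cutoff)
    note g' = C_k_SucD(1)[OF this]
    define g' where "g' = frechet_derivative (\<lambda>s. G s * \<theta> N s) (at (x \<bullet> q))"
    have g': "((\<lambda>s. G s * \<theta> N s) has_derivative g') (at (x \<bullet> q))" unfolding g'_def by (rule g')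
    from has_derivative_compose[OF lin this]
    have dq: "((\<lambda>x. G (x \<bullet> q) * \<theta> N (x \<bullet> q)) has_derivative (\<lambda>h. g' (h \<bullet> q))) (at x)" .
    have "g' 0 = 0" using linear_0[OF has_derivative_linear[OF g']] .
    then show ?thesis
      using frechet_derivative_at[OF has_derivative_mult[OF dp dq], symmetric] E
      by (simp add: \<phi>_def[abs_def] A_def mult.commute)
  qed
  have contA: "continuous_on UNIV (A N)" for N
    unfolding A_def[abs_def] \<theta>_def
    by (intro continuous_intros continuous_coord C_k_continuous[OF F(1)] C_k_continuous[OF G(1)] F(3)
        C_k_continuous[OF C_k_cutoff] cutoff'_continuous)
  have weak: "(LINT x|M. u x * A N x) = - (LINT x|M. (g x \<bullet> E) * \<phi> N x)" for N
  proof -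
    have su': "integrable M (\<lambda>x. u x * frechet_derivative (\<phi> N) (at x) b)" if "b \<in> Basis" for b
      by (intro sqint_real_mult su continuous_sqint_M tf(2) that)
    have sg': "integrable M (\<lambda>x. g x \<bullet> b * \<phi> N x)" for b
    proof -
      have "integrable M (\<lambda>x. g x \<bullet> (\<phi> N x *\<^sub>R b))"
        by (intro sqint_inner sg continuous_sqint_M continuous_intros tf(3))
      then show ?thesis by (simp add: mult.commute)
    qed
    \<comment> \<open>The weak gradient is defined along coordinate directions, so the direction
      \<open>E\<close> is expanded in the standard basis.\<close>
    have "A N x = (\<Sum>b\<in>Basis. (E \<bullet> b) * frechet_derivative (\<phi> N) (at x) b)" for x
    proof -
      have "frechet_derivative (\<phi> N) (at x) E = frechet_derivative (\<phi> N) (at x) (\<Sum>b\<in>Basis. (E \<bullet> b) *\<^sub>R b)"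
        by (simp add: euclidean_representation)
      also have "\<dots> = (\<Sum>b\<in>Basis. (E \<bullet> b) * frechet_derivative (\<phi> N) (at x) b)"
        using has_derivative_linear[OF tf(1)] by (simp add: linear_sum linear_scale)
      finally show ?thesis using deriv by simp
    qed
    then have "(LINT x|M. u x * A N x) = (LINT x|M. (\<Sum>b\<in>Basis. (E \<bullet> b) * (u x * frechet_derivative (\<phi> N) (at x) b)))"
      by (simp add: sum_distrib_left mult_ac)
    also have "\<dots> = (\<Sum>b\<in>Basis. (E \<bullet> b) * (LINT x|M. u x * frechet_derivative (\<phi> N) (at x) b))"
      using su' by (subst Bochner_Integration.integral_sum) auto
    also have "\<dots> = (\<Sum>b\<in>Basis. (E \<bullet> b) * - (LINT x|M. g x \<bullet> b * \<phi> N x))"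
      using wg test by (intro sum.cong refl) (auto simp: weak_gradient_def)
    also have "\<dots> = - (\<Sum>b\<in>Basis. (LINT x|M. (E \<bullet> b) * (g x \<bullet> b * \<phi> N x)))"
      by (simp add: sum_negf)
    also have "\<dots> = - (LINT x|M. (\<Sum>b\<in>Basis. (E \<bullet> b) * (g x \<bullet> b * \<phi> N x)))"
      using sg' by (subst Bochner_Integration.integral_sum) auto
    also have "(\<lambda>x. \<Sum>b\<in>Basis. (E \<bullet> b) * (g x \<bullet> b * \<phi> N x)) = (\<lambda>x. (g x \<bullet> E) * \<phi> N x)"
      by (rule ext, subst euclidean_inner[of _ E], simp only: sum_distrib_right, rule sum.cong) auto
    finally show ?thesis .
  qed
  have l1: "(\<lambda>N. LINT x|M. u x * A N x) \<longlonglongrightarrow> (LINT x|M. u x * (F' (x \<bullet> p) * G (x \<bullet> q)))"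
  proof (rule integral_dominated_convergence)
    show "(\<lambda>x. u x * (F' (x \<bullet> p) * G (x \<bullet> q))) \<in> borel_measurable M"
      by (intro borel_measurable_times mu borel_measurable_integrable[OF sqint_integrable] continuous_sqint_M
          continuous_intros continuous_coord C_k_continuous[OF G(1)] F(3))
    show "(\<lambda>x. u x * A N x) \<in> borel_measurable M" for N
      by (intro borel_measurable_times mu borel_measurable_integrable[OF sqint_integrable] continuous_sqint_M contA)
    \<comment> \<open>\<open>B\<close> accounts for the derivative of \<open>F\<close>, and
      \<open>6 * K\<close> for the derivative of the cut-off, where \<open>F\<close> vanishes
      linearly.\<close>
    show "integrable M (\<lambda>x. norm (u x) * (B + 6 * K))"
      using sqint_integrable[OF su] by (intro integrable_mult_left Bochner_Integration.integrable_norm)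
    show "AE x in M. norm (u x * A N x) \<le> norm (u x) * (B + 6 * K)" for N
    proof (rule AE_I2)
      fix x assume "x \<in> space M"
      then have x: "0 < x \<bullet> p" "x \<bullet> p < 1" using pq by auto
      have "\<bar>F' (x \<bullet> p) * \<theta> N (x \<bullet> p)\<bar> \<le> B * 1"
        unfolding abs_mult using cutoff_bounds F(4)[of "x \<bullet> p"] by (intro mult_mono) (auto simp: \<theta>_def)
      moreover have "\<bar>F (x \<bullet> p) * cutoff' N (x \<bullet> p)\<bar> \<le> 6 * K"
        using cutoff'_bound[OF x] FK[OF x] by blast
      ultimately have a: "\<bar>F' (x \<bullet> p) * \<theta> N (x \<bullet> p) + F (x \<bullet> p) * cutoff' N (x \<bullet> p)\<bar> \<le> B + 6 * K" by linarith
      have "\<bar>G (x \<bullet> q) * \<theta> N (x \<bullet> q)\<bar> \<le> 1 * 1"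
        unfolding abs_mult using cutoff_bounds G(2) by (intro mult_mono) (auto simp: \<theta>_def)
      then have "\<bar>A N x\<bar> \<le> (B + 6 * K) * 1"
        unfolding A_def abs_mult using a by (intro mult_mono) auto
      then show "norm (u x * A N x) \<le> norm (u x) * (B + 6 * K)"
        by (simp add: abs_mult mult_left_mono)
    qed
    show "AE x in M. (\<lambda>N. u x * A N x) \<longlonglongrightarrow> u x * (F' (x \<bullet> p) * G (x \<bullet> q))"
    proof (rule AE_I2)
      fix x assume "x \<in> space M"
      then have x: "0 < x \<bullet> p" "x \<bullet> p < 1" "0 < x \<bullet> q" "x \<bullet> q < 1" using pq by auto
      have "(\<lambda>N. A N x) \<longlonglongrightarrow> (F' (x \<bullet> p) * 1 + F (x \<bullet> p) * 0) * (G (x \<bullet> q) * 1)"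
        unfolding A_def \<theta>_def using x by (intro tendsto_intros cutoff_tendsto)
      then show "(\<lambda>N. u x * A N x) \<longlonglongrightarrow> u x * (F' (x \<bullet> p) * G (x \<bullet> q))"
        by (intro tendsto_mult tendsto_const) simp
    qed
  qed
  have l2: "(\<lambda>N. LINT x|M. (g x \<bullet> E) * \<phi> N x) \<longlonglongrightarrow> (LINT x|M. (g x \<bullet> E) * (F (x \<bullet> p) * G (x \<bullet> q)))"
  proof (rule integral_dominated_convergence)
    have mgE: "(\<lambda>x. g x \<bullet> E) \<in> borel_measurable M" by measurable
    show "(\<lambda>x. (g x \<bullet> E) * (F (x \<bullet> p) * G (x \<bullet> q))) \<in> borel_measurable M"
      by (intro borel_measurable_times mgE borel_measurable_integrable[OF sqint_integrable] continuous_sqint_M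
          continuous_intros continuous_coord C_k_continuous[OF G(1)] C_k_continuous[OF F(1)])
    show "(\<lambda>x. (g x \<bullet> E) * \<phi> N x) \<in> borel_measurable M" for N
      by (intro borel_measurable_times mgE borel_measurable_integrable[OF sqint_integrable] continuous_sqint_M tf(3))
    show "integrable M (\<lambda>x. norm (g x \<bullet> E) * K)"
      using sqint_integrable[OF sg] by (intro integrable_mult_left Bochner_Integration.integrable_norm integrable_inner_left)
    show "AE x in M. norm ((g x \<bullet> E) * \<phi> N x) \<le> norm (g x \<bullet> E) * K" for N
    proof (rule AE_I2)
      fix x assume "x \<in> space M"
      then have x: "0 < x \<bullet> p" "x \<bullet> p < 1" using pq by auto
      have FK': "\<bar>F (x \<bullet> p)\<bar> \<le> K"
      proof -
        have "\<bar>F (x \<bullet> p)\<bar> \<le> K * (x \<bullet> p)" using FK[OF x] by simp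
        moreover have "0 \<le> K" using FK[OF x] x by (smt (verit) mult_neg_pos)
        then have "K * (x \<bullet> p) \<le> K * 1" using x by (intro mult_left_mono) auto
        ultimately show ?thesis by simp
      qed
      have "\<bar>\<phi> N x\<bar> \<le> (K * 1) * (1 * 1)"
        unfolding \<phi>_def abs_mult using cutoff_bounds G(2) FK' by (intro mult_mono mult_nonneg_nonneg) (auto simp: \<theta>_def)
      then show "norm ((g x \<bullet> E) * \<phi> N x) \<le> norm (g x \<bullet> E) * K"
        by (simp add: abs_mult mult_left_mono)
    qed
    show "AE x in M. (\<lambda>N. (g x \<bullet> E) * \<phi> N x) \<longlonglongrightarrow> (g x \<bullet> E) * (F (x \<bullet> p) * G (x \<bullet> q))"
    proof (rule AE_I2)
      fix x assume "x \<in> space M"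
      then have x: "0 < x \<bullet> p" "x \<bullet> p < 1" "0 < x \<bullet> q" "x \<bullet> q < 1" using pq by auto
      have "(\<lambda>N. \<phi> N x) \<longlonglongrightarrow> (F (x \<bullet> p) * 1) * (G (x \<bullet> q) * 1)"
        unfolding \<phi>_def \<theta>_def using x by (intro tendsto_intros cutoff_tendsto)
      then show "(\<lambda>N. (g x \<bullet> E) * \<phi> N x) \<longlonglongrightarrow> (g x \<bullet> E) * (F (x \<bullet> p) * G (x \<bullet> q))"
        by (intro tendsto_mult tendsto_const) simp
    qed
  qed
  have "(\<lambda>N. LINT x|M. u x * A N x) \<longlonglongrightarrow> - (LINT x|M. (g x \<bullet> E) * (F (x \<bullet> p) * G (x \<bullet> q)))"
    unfolding weak by (rule tendsto_minus[OF l2])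
  from LIMSEQ_unique[OF this l1] show ?thesis by simp
qed

end

text \<open>Cantor's diagonal argument: one subsequence serves all coefficients
  simultaneously.\<close>

lemma bounded_coefficients_subseq:
  fixes X :: "nat \<Rightarrow> nat \<Rightarrow> real"
  assumes "\<And>n k. \<bar>X n k\<bar> \<le> C n"
  obtains r where "strict_mono r" "\<And>n. convergent (\<lambda>k. X n (r k))"
proof -
  interpret subseqs "\<lambda>n s. convergent (\<lambda>k. X n (s k))"
  proof
    fix n and s :: "nat \<Rightarrow> nat"
    have "bounded (range (\<lambda>k. X n (s k)))"
      using assms by (intro boundedI[where B = "C n"]) auto
    then obtain l r where "strict_mono r" "((\<lambda>k. X n (s k)) \<circ> r) \<longlonglongrightarrow> l"
      using bounded_imp_convergent_subsequence by blast
    then show "\<exists>r'. strict_mono r' \<and> convergent (\<lambda>k. X n ((s \<circ> r') k))"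
      by (auto simp: convergent_def o_def)
  qed
  have "convergent (\<lambda>k. X n (diagseq k))" for n
  proof -
    have "convergent (\<lambda>k. X n ((diagseq \<circ> (+) (Suc n)) k))"
    proof (rule diagseq_holds)
      fix r s :: "nat \<Rightarrow> nat" and n assume r: "strict_mono r" "convergent (\<lambda>k. X n (s k))"
      then show "convergent (\<lambda>k. X n ((s \<circ> r) k))"
        using convergent_subseq_convergent[OF r(2,1)] by (simp add: o_def)
    qed
    then have "convergent (\<lambda>k. X n (diagseq (k + Suc n)))" by (simp add: add.commute)
    then show ?thesis using convergent_ignore_initial_segment[of "\<lambda>k. X n (diagseq k)" "Suc n"] by simp
  qed
  then show thesis using that subseq_diagseq by blast
qed

section \<open>The cosine basis, its derivatives and its density\<close>

lemma cos_nat_mult: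
  "cos (real m * x) * cos (real n * x) = (cos (real (nat \<bar>int m - int n\<bar>) * x) + cos (real (m + n) * x)) / 2"
  using cos_nat_diff[of m x n] by (simp add: cos_times_cos distrib_right)

context parallelogram_domain
begin

definition eb :: "nat \<times> nat \<Rightarrow> real \<times> real \<Rightarrow> real" where
  "eb p x = cos (real (fst p) * pi * (x \<bullet> a1)) * cos (real (snd p) * pi * (x \<bullet> a2))"

text \<open>Up to the factors \<open>- m * pi\<close> and \<open>- n * pi\<close>,
  \<open>eb1\<close> and \<open>eb2\<close> are the derivatives of \<open>eb\<close> along
  \<open>e1\<close> and \<open>e2\<close>. Their sines vanish on the pair of sides to which the
  respective direction is transversal.\<close>

definition eb1 :: "nat \<times> nat \<Rightarrow> real \<times> real \<Rightarrow> real" where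
  "eb1 p x = sin (real (fst p) * pi * (x \<bullet> a1)) * cos (real (snd p) * pi * (x \<bullet> a2))"

definition eb2 :: "nat \<times> nat \<Rightarrow> real \<times> real \<Rightarrow> real" where
  "eb2 p x = cos (real (fst p) * pi * (x \<bullet> a1)) * sin (real (snd p) * pi * (x \<bullet> a2))"

definition nrm :: "nat \<times> nat \<Rightarrow> real" where
  "nrm p = d * ((if fst p = 0 then 1 else 1 / 2) * (if snd p = 0 then 1 else 1 / 2))"

lemma nrm_pos: "0 < nrm p"
  using d_pos by (simp add: nrm_def)

lemma eb_sqint: "sqint M (eb p)" "sqint M (eb1 p)" "sqint M (eb2 p)"
  unfolding eb_def[abs_def] eb1_def[abs_def] eb2_def[abs_def]
  by (auto intro!: continuous_sqint_M continuous_intros)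

lemma eb_orth: "(LINT x|M. eb p x * eb q x) = (if p = q then nrm p else 0)"
proof -
  have "(LINT x|M. eb p x * eb q x) = (LINT x|M.
     (\<lambda>s. cos (real (fst p) * pi * s) * cos (real (fst q) * pi * s)) (x \<bullet> a1)
     * (\<lambda>t. cos (real (snd p) * pi * t) * cos (real (snd q) * pi * t)) (x \<bullet> a2))"
    by (simp add: eb_def mult_ac)
  also have "\<dots> = d * (integral {0..1} (\<lambda>s. cos (real (fst p) * pi * s) * cos (real (fst q) * pi * s))
     * integral {0..1} (\<lambda>t. cos (real (snd p) * pi * t) * cos (real (snd q) * pi * t)))"
    by (intro integral_product continuous_intros)
  finally show ?thesis unfolding integral_cos_cos by (auto simp: nrm_def prod_eq_iff)
qed

lemma eb1_orth: "fst p \<noteq> 0 \<Longrightarrow> (LINT x|M. eb1 p x * eb1 q x) = (if p = q then nrm p else 0)"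
proof -
  assume p: "fst p \<noteq> 0"
  have "(LINT x|M. eb1 p x * eb1 q x) = (LINT x|M.
     (\<lambda>s. sin (real (fst p) * pi * s) * sin (real (fst q) * pi * s)) (x \<bullet> a1)
     * (\<lambda>t. cos (real (snd p) * pi * t) * cos (real (snd q) * pi * t)) (x \<bullet> a2))"
    by (simp add: eb1_def mult_ac)
  also have "\<dots> = d * (integral {0..1} (\<lambda>s. sin (real (fst p) * pi * s) * sin (real (fst q) * pi * s))
     * integral {0..1} (\<lambda>t. cos (real (snd p) * pi * t) * cos (real (snd q) * pi * t)))"
    by (intro integral_product continuous_intros)
  finally show ?thesis using p unfolding integral_cos_cos integral_sin_sin by (auto simp: nrm_def prod_eq_iff)
qed

lemma eb2_orth: "snd p \<noteq> 0 \<Longrightarrow> (LINT x|M. eb2 p x * eb2 q x) = (if p = q then nrm p else 0)"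
proof -
  assume p: "snd p \<noteq> 0"
  have "(LINT x|M. eb2 p x * eb2 q x) = (LINT x|M.
     (\<lambda>s. cos (real (fst p) * pi * s) * cos (real (fst q) * pi * s)) (x \<bullet> a1)
     * (\<lambda>t. sin (real (snd p) * pi * t) * sin (real (snd q) * pi * t)) (x \<bullet> a2))"
    by (simp add: eb2_def mult_ac)
  also have "\<dots> = d * (integral {0..1} (\<lambda>s. cos (real (fst p) * pi * s) * cos (real (fst q) * pi * s))
     * integral {0..1} (\<lambda>t. sin (real (snd p) * pi * t) * sin (real (snd q) * pi * t)))"
    by (intro integral_product continuous_intros)
  finally show ?thesis using p unfolding integral_cos_cos integral_sin_sin by (auto simp: nrm_def prod_eq_iff)
qed

lemma sin_nat_pi_bound:
  assumes "0 < s" "s < 1"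
  shows "\<bar>sin (real m * pi * s)\<bar> \<le> real m * pi * s \<and> \<bar>sin (real m * pi * s)\<bar> \<le> real m * pi * (1 - s)"
proof
  show "\<bar>sin (real m * pi * s)\<bar> \<le> real m * pi * s"
    using abs_sin_x_le_abs_x[of "real m * pi * s"] assms by simp
  have "sin (real m * pi * (1 - s)) = sin (real m * pi - real m * pi * s)" by (simp add: algebra_simps)
  also have "\<dots> = - (cos (real m * pi) * sin (real m * pi * s))" by (simp add: sin_diff)
  finally have "\<bar>sin (real m * pi * (1 - s))\<bar> = \<bar>sin (real m * pi * s)\<bar>"
    by (simp add: abs_mult power_abs)
  then show "\<bar>sin (real m * pi * s)\<bar> \<le> real m * pi * (1 - s)"
    using abs_sin_x_le_abs_x[of "real m * pi * (1 - s)"] assms by simp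
qed

text \<open>The fields with components \<open>eb1\<close> along \<open>e1\<close> and
  \<open>eb2\<close> along \<open>e2\<close> are tangential to the boundary, so the identity holds
  for every H1 function. A bounded gradient thus forces the cosine coefficients to decay like the
  inverse frequency.\<close>

lemma gradient_coefficients:
  assumes H: "H1 \<Omega> u g"
  shows "(LINT x|M. (g x \<bullet> e1) * eb1 p x) = - (real (fst p) * pi) * (LINT x|M. u x * eb p x)"
    and "(LINT x|M. (g x \<bullet> e2) * eb2 p x) = - (real (snd p) * pi) * (LINT x|M. u x * eb p x)"
proof -
  have deriv: "((\<lambda>s. sin (real m * pi * s)) has_real_derivative real m * pi * cos (real m * pi * s)) (at s)" for m s
    by (auto intro!: derivative_eq_intros)
  have b: "\<bar>real m * pi * cos (real m * pi * s)\<bar> \<le> real m * pi" for m s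
    using mult_left_mono[of "\<bar>cos (real m * pi * s)\<bar>" 1 "real m * pi"] by (simp add: abs_mult)
  have c: "continuous_on UNIV (\<lambda>s. real m * pi * cos (real m * pi * s))" for m
    by (intro continuous_intros)
  have "(LINT x|M. (g x \<bullet> e1) * (sin (real (fst p) * pi * (x \<bullet> a1)) * cos (real (snd p) * pi * (x \<bullet> a2))))
     = - (LINT x|M. u x * (real (fst p) * pi * cos (real (fst p) * pi * (x \<bullet> a1)) * cos (real (snd p) * pi * (x \<bullet> a2))))"
    by (rule boundary_integration_by_parts[OF H dual(1,2) in_parallelogram C_k_sin deriv c b sin_nat_pi_bound C_k_cos]) auto
  also have "\<dots> = - (real (fst p) * pi) * (LINT x|M. u x * eb p x)"
    by (simp add: eb_def mult_ac flip: integral_mult_right_zero)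
  finally show "(LINT x|M. (g x \<bullet> e1) * eb1 p x) = - (real (fst p) * pi) * (LINT x|M. u x * eb p x)"
    by (simp add: eb1_def)
  have in': "x \<in> \<Omega> \<longleftrightarrow> 0 < x \<bullet> a2 \<and> x \<bullet> a2 < 1 \<and> 0 < x \<bullet> a1 \<and> x \<bullet> a1 < 1" for x
    using in_parallelogram by auto
  have "(LINT x|M. (g x \<bullet> e2) * (sin (real (snd p) * pi * (x \<bullet> a2)) * cos (real (fst p) * pi * (x \<bullet> a1))))
     = - (LINT x|M. u x * (real (snd p) * pi * cos (real (snd p) * pi * (x \<bullet> a2)) * cos (real (fst p) * pi * (x \<bullet> a1))))"
    by (rule boundary_integration_by_parts[OF H dual(4,3) in' C_k_sin deriv c b sin_nat_pi_bound C_k_cos]) auto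
  also have "\<dots> = - (real (snd p) * pi) * (LINT x|M. u x * eb p x)"
    by (simp add: eb_def mult_ac flip: integral_mult_right_zero)
  finally show "(LINT x|M. (g x \<bullet> e2) * eb2 p x) = - (real (snd p) * pi) * (LINT x|M. u x * eb p x)"
    by (simp add: eb2_def mult.commute)
qed

text \<open>Finite cosine sums form an algebra, since a product of two cosines is a sum of cosines
  with the difference and the sum of the frequencies; this prepares Stone-Weierstrass.\<close>

definition trigpoly :: "(real \<times> real \<Rightarrow> real) \<Rightarrow> bool" where
  "trigpoly f \<longleftrightarrow> (\<exists>F a. finite F \<and> f = (\<lambda>x. \<Sum>p\<in>F. a p * eb p x))"

lemma trigpoly_eb: "trigpoly (eb p)"
  unfolding trigpoly_def by (intro exI[of _ "{p}"] exI[of _ "\<lambda>_. 1"]) auto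

lemma trigpoly_scale:
  assumes "trigpoly f"
  shows "trigpoly (\<lambda>x. b * f x)"
proof -
  obtain F a where "finite F" "f = (\<lambda>x. \<Sum>p\<in>F. a p * eb p x)" using assms by (auto simp: trigpoly_def)
  then show ?thesis unfolding trigpoly_def
    by (intro exI[of _ F] exI[of _ "\<lambda>p. b * a p"]) (auto simp: sum_distrib_left mult_ac)
qed

lemma trigpoly_add:
  assumes "trigpoly f" "trigpoly g"
  shows "trigpoly (\<lambda>x. f x + g x)"
proof -
  obtain F a where F: "finite F" "f = (\<lambda>x. \<Sum>p\<in>F. a p * eb p x)" using assms by (auto simp: trigpoly_def)
  obtain G b where G: "finite G" "g = (\<lambda>x. \<Sum>p\<in>G. b p * eb p x)" using assms by (auto simp: trigpoly_def)
  have f: "f x = (\<Sum>p\<in>F \<union> G. (if p \<in> F then a p else 0) * eb p x)" for x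
    unfolding F(2) using F(1) G(1) by (intro sum.mono_neutral_cong_left) auto
  have g: "g x = (\<Sum>p\<in>F \<union> G. (if p \<in> G then b p else 0) * eb p x)" for x
    unfolding G(2) using F(1) G(1) by (intro sum.mono_neutral_cong_left) auto
  have "f x + g x = (\<Sum>p\<in>F \<union> G. ((if p \<in> F then a p else 0) + (if p \<in> G then b p else 0)) * eb p x)" for x
    unfolding f g sum.distrib[symmetric] by (rule sum.cong) (auto simp: distrib_right)
  then show ?thesis unfolding trigpoly_def using F(1) G(1)
    by (intro exI[of _ "F \<union> G"] exI[of _ "\<lambda>p. (if p \<in> F then a p else 0) + (if p \<in> G then b p else 0)"]) auto
qed

lemma trigpoly_const: "trigpoly (\<lambda>x. a)"
  using trigpoly_scale[OF trigpoly_eb[of "(0, 0)"], of a] by (simp add: eb_def)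

lemma trigpoly_sum:
  assumes "\<And>i. i \<in> I \<Longrightarrow> trigpoly (f i)"
  shows "trigpoly (\<lambda>x. \<Sum>i\<in>I. f i x)"
  using assms by (induction I rule: infinite_finite_induct) (auto intro: trigpoly_const trigpoly_add)

lemma eb_mult: "trigpoly (\<lambda>x. eb p x * eb q x)"
proof -
  let ?m = "nat \<bar>int (fst p) - int (fst q)\<bar>" and ?n = "nat \<bar>int (snd p) - int (snd q)\<bar>"
  let ?m' = "fst p + fst q" and ?n' = "snd p + snd q"
  have "eb p x * eb q x = (1 / 4) * eb (?m, ?n) x + ((1 / 4) * eb (?m, ?n') x
      + ((1 / 4) * eb (?m', ?n) x + (1 / 4) * eb (?m', ?n') x))" for x
  proof -
    have "eb p x * eb q x = (cos (real (fst p) * (pi * (x \<bullet> a1))) * cos (real (fst q) * (pi * (x \<bullet> a1))))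
       * (cos (real (snd p) * (pi * (x \<bullet> a2))) * cos (real (snd q) * (pi * (x \<bullet> a2))))"
      by (simp add: eb_def mult_ac)
    also have "\<dots> = (1 / 4) * eb (?m, ?n) x + ((1 / 4) * eb (?m, ?n') x
      + ((1 / 4) * eb (?m', ?n) x + (1 / 4) * eb (?m', ?n') x))"
      unfolding cos_nat_mult eb_def fst_conv snd_conv by (simp add: field_simps)
    finally show ?thesis .
  qed
  then have "(\<lambda>x. eb p x * eb q x) = (\<lambda>x. (1 / 4) * eb (?m, ?n) x + ((1 / 4) * eb (?m, ?n') x
      + ((1 / 4) * eb (?m', ?n) x + (1 / 4) * eb (?m', ?n') x)))" by (rule ext)
  then show ?thesis by (simp only:) (intro trigpoly_add trigpoly_scale trigpoly_eb)
qed

lemma trigpoly_mult: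
  assumes "trigpoly f" "trigpoly g"
  shows "trigpoly (\<lambda>x. f x * g x)"
proof -
  obtain F a where F: "f = (\<lambda>x. \<Sum>p\<in>F. a p * eb p x)" using assms by (auto simp: trigpoly_def)
  obtain G b where G: "g = (\<lambda>x. \<Sum>p\<in>G. b p * eb p x)" using assms by (auto simp: trigpoly_def)
  have "(\<lambda>x. f x * g x) = (\<lambda>x. \<Sum>p\<in>F. \<Sum>q\<in>G. (a p * b q) * (eb p x * eb q x))"
    by (rule ext) (simp add: F G sum_product mult_ac)
  then show ?thesis by (simp only:) (intro trigpoly_sum trigpoly_scale eb_mult)
qed

lemma trigpoly_continuous: "trigpoly f \<Longrightarrow> continuous_on UNIV f"
  by (auto simp: trigpoly_def eb_def[abs_def] intro!: continuous_intros)

lemma closure_parallelogram: "x \<in> closure \<Omega> \<Longrightarrow> 0 \<le> x \<bullet> a1 \<and> x \<bullet> a1 \<le> 1 \<and> 0 \<le> x \<bullet> a2 \<and> x \<bullet> a2 \<le> 1"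
proof -
  let ?Q = "{x. 0 \<le> x \<bullet> a1} \<inter> {x. x \<bullet> a1 \<le> 1} \<inter> {x. 0 \<le> x \<bullet> a2} \<inter> {x. x \<bullet> a2 \<le> 1}"
  have "closed ?Q" by (intro closed_Int closed_Collect_le continuous_intros)
  then have "closure \<Omega> \<subseteq> ?Q" by (rule closure_minimal[rotated]) (auto simp: in_parallelogram)
  then show "x \<in> closure \<Omega> \<Longrightarrow> 0 \<le> x \<bullet> a1 \<and> x \<bullet> a1 \<le> 1 \<and> 0 \<le> x \<bullet> a2 \<and> x \<bullet> a2 \<le> 1" by auto
qed

text \<open>Points of the closed parallelogram are separated by \<open>eb (1, 0)\<close> and
  \<open>eb (0, 1)\<close>, as cosine is injective on the interval from 0 to pi.\<close>

lemma trigpoly_uniform_approx: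
  assumes f: "continuous_on UNIV f" and "0 < e"
  obtains g where "trigpoly g" "\<And>x. x \<in> \<Omega> \<Longrightarrow> \<bar>f x - g x\<bar> < e"
proof -
  have "\<exists>g. trigpoly g \<and> (\<forall>x\<in>closure \<Omega>. \<bar>f x - g x\<bar> < e)"
  proof (rule Stone_Weierstrass_HOL)
    show "compact (closure \<Omega>)" using bounded_parallelogram by (simp add: compact_closure)
    show "continuous_on (closure \<Omega>) g" if "trigpoly g" for g
      using trigpoly_continuous[OF that] by (rule continuous_on_subset) simp
    show "continuous_on (closure \<Omega>) f" using f by (rule continuous_on_subset) simp
    show "\<exists>g. trigpoly g \<and> g x \<noteq> g y" if xy: "x \<in> closure \<Omega> \<and> y \<in> closure \<Omega> \<and> x \<noteq> y" for x y
    proof -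
      note b = closure_parallelogram[of x] closure_parallelogram[of y]
      have inj: "s = t" if "0 \<le> s" "s \<le> 1" "0 \<le> t" "t \<le> 1" "cos (pi * s) = cos (pi * t)" for s t
        using cos_inj_pi[of "pi * s" "pi * t"] that by (simp add: mult_left_le)
      have "x \<bullet> a1 \<noteq> y \<bullet> a1 \<or> x \<bullet> a2 \<noteq> y \<bullet> a2"
        using xy decomp[of x] decomp[of y] by metis
      then have "eb (1, 0) x \<noteq> eb (1, 0) y \<or> eb (0, 1) x \<noteq> eb (0, 1) y"
        using inj[of "x \<bullet> a1" "y \<bullet> a1"] inj[of "x \<bullet> a2" "y \<bullet> a2"] b xy by (auto simp: eb_def)
      then show ?thesis using trigpoly_eb by blast
    qed
  qed (use assms(2) in \<open>auto intro: trigpoly_const trigpoly_add trigpoly_mult\<close>)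
  then show thesis using that closure_subset by blast
qed

lemma sq_dist_triangle:
  assumes "sqint M u" "sqint M v" "sqint M w"
  shows "(LINT x|M. (u x - w x)\<^sup>2) \<le> 2 * (LINT x|M. (u x - v x)\<^sup>2) + 2 * (LINT x|M. (v x - w x :: real)\<^sup>2)"
proof -
  have i: "integrable M (\<lambda>x. (f x - g x)\<^sup>2)" if "sqint M f" "sqint M g" for f g :: "_ \<Rightarrow> real"
    using sqint_diff[OF that] by (simp add: sqint_def)
  have "(LINT x|M. (u x - w x)\<^sup>2) \<le> (LINT x|M. 2 * (u x - v x)\<^sup>2 + 2 * (v x - w x)\<^sup>2)"
  proof (rule integral_mono)
    fix x
    have "0 \<le> ((u x - v x) - (v x - w x))\<^sup>2" by simp
    then show "(u x - w x)\<^sup>2 \<le> 2 * (u x - v x)\<^sup>2 + 2 * (v x - w x)\<^sup>2"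
      by (simp add: power2_eq_square algebra_simps)
  qed (use i assms in auto)
  also have "\<dots> = 2 * (LINT x|M. (u x - v x)\<^sup>2) + 2 * (LINT x|M. (v x - w x)\<^sup>2)"
    using i assms by simp
  finally show ?thesis .
qed

definition clamp1 :: "real \<Rightarrow> real \<Rightarrow> real" where "clamp1 k y = max (- k) (min k y)"

lemma clamp1_bound: "0 \<le> k \<Longrightarrow> \<bar>clamp1 k y\<bar> \<le> k"
  by (auto simp: clamp1_def)

lemma clamp1_id: "\<bar>y\<bar> \<le> k \<Longrightarrow> clamp1 k y = y"
  by (auto simp: clamp1_def)

lemma continuous_clamp1: "continuous_on UNIV (clamp1 k)"
  unfolding clamp1_def[abs_def] by (intro continuous_intros)

lemma bounded_approx:
  fixes u :: "real \<times> real \<Rightarrow> real"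
  assumes u: "sqint M u" and "0 < e"
  obtains v k where "v \<in> borel_measurable M" "0 \<le> k" "\<And>x. \<bar>v x\<bar> \<le> k" "(LINT x|M. (u x - v x)\<^sup>2) < e"
proof -
  have mu[measurable]: "u \<in> borel_measurable M" using u by (simp add: sqint_def)
  have mc[measurable]: "(\<lambda>x. clamp1 k (u x)) \<in> borel_measurable M" for k
    unfolding clamp1_def by measurable
  have "(\<lambda>k. LINT x|M. (u x - clamp1 (real k) (u x))\<^sup>2) \<longlonglongrightarrow> (LINT x|M. 0)"
  proof (rule integral_dominated_convergence)
    show "integrable M (\<lambda>x. (u x)\<^sup>2)" using u by (simp add: sqint_def)
    show "AE x in M. norm ((u x - clamp1 (real k) (u x))\<^sup>2) \<le> (u x)\<^sup>2" for k
      by (intro AE_I2) (auto simp: clamp1_def abs_le_square_iff[symmetric])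
    show "AE x in M. (\<lambda>k. (u x - clamp1 (real k) (u x))\<^sup>2) \<longlonglongrightarrow> 0"
    proof (rule AE_I2)
      fix x
      obtain K :: nat where K: "\<bar>u x\<bar> \<le> real K" using real_arch_simple by blast
      then have "(u x - clamp1 (real k) (u x))\<^sup>2 = 0" if "k \<ge> K" for k
        using that clamp1_id[of "u x" "real k"] by simp
      then show "(\<lambda>k. (u x - clamp1 (real k) (u x))\<^sup>2) \<longlonglongrightarrow> 0"
        by (intro tendsto_eventually eventually_sequentiallyI[of K])
    qed
  qed auto
  then have "\<forall>\<^sub>F k in sequentially. (LINT x|M. (u x - clamp1 (real k) (u x))\<^sup>2) < e"
    using assms(2) by (intro order_tendstoD(2)[where y = "LINT x|M. 0"]) auto
  then obtain k where "(LINT x|M. (u x - clamp1 (real k) (u x))\<^sup>2) < e"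
    by (auto simp: eventually_sequentially)
  then show thesis using that[of "\<lambda>x. clamp1 (real k) (u x)" "real k"] clamp1_bound mc by simp
qed

text \<open>A measurable function is an almost everywhere limit of continuous ones, in the sense of
  \<open>measurable_on\<close>. Clamping these at the bound \<open>k\<close> of \<open>v\<close>
  does not affect the limit and yields a constant dominating function.\<close>

lemma continuous_approx:
  assumes v: "v \<in> borel_measurable M" and k: "0 \<le> k" "\<And>x. \<bar>v x\<bar> \<le> k" and "0 < e"
  obtains h where "continuous_on UNIV h" "(LINT x|M. (v x - h x :: real)\<^sup>2) < e"
proof -
  define v0 where "v0 x = (if x \<in> \<Omega> then v x else 0)" for x
  have "v0 \<in> borel_measurable lebesgue"
    unfolding v0_def[abs_def] using v sets_parallelogram by (simp add: borel_measurable_if)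
  then have "v0 measurable_on \<Omega>" using sets_parallelogram by (intro lebesgue_measurable_imp_measurable_on)
  then obtain N g where N: "negligible N" and g: "\<And>n. continuous_on UNIV (g n)"
    and lim: "\<And>x. x \<notin> N \<Longrightarrow> (\<lambda>n. g n x) \<longlonglongrightarrow> (if x \<in> \<Omega> then v0 x else 0)"
    unfolding measurable_on_def by blast
  define h where "h n x = clamp1 k (g n x)" for n x
  have hc: "continuous_on UNIV (h n)" for n
    unfolding h_def[abs_def] by (rule continuous_on_compose2[OF continuous_clamp1 g]) auto
  have "AE x in M. x \<notin> N"
    using N sets_parallelogram
    by (subst AE_restrict_space_iff) (auto simp: negligible_iff_null_sets intro!: AE_not_in[THEN eventually_mono])
  then have AE: "AE x in M. (\<lambda>n. h n x) \<longlonglongrightarrow> v x"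
  proof (rule AE_mp, intro AE_I2 impI)
    fix x assume x: "x \<in> space M" "x \<notin> N"
    then have "(\<lambda>n. g n x) \<longlonglongrightarrow> v x" using lim[OF x(2)] by (simp add: v0_def)
    then have "(\<lambda>n. h n x) \<longlonglongrightarrow> clamp1 k (v x)"
      unfolding h_def clamp1_def by (intro tendsto_intros)
    then show "(\<lambda>n. h n x) \<longlonglongrightarrow> v x" using k(2)[of x] by (simp add: clamp1_id)
  qed
  have mh: "h n \<in> borel_measurable M" for n
    using continuous_sqint_M[OF hc] by (simp add: sqint_def)
  have "(\<lambda>n. LINT x|M. (v x - h n x)\<^sup>2) \<longlonglongrightarrow> (LINT x|M. 0)"
  proof (rule integral_dominated_convergence)
    show "(\<lambda>x. (v x - h n x)\<^sup>2) \<in> borel_measurable M" for n using v mh by measurable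
    show "integrable M (\<lambda>x. (2 * k)\<^sup>2)" by simp
    show "AE x in M. norm ((v x - h n x)\<^sup>2) \<le> (2 * k)\<^sup>2" for n
    proof (rule AE_I2)
      fix x
      have "\<bar>v x - h n x\<bar> \<le> \<bar>2 * k\<bar>"
        using k(2)[of x] clamp1_bound[OF k(1), of "g n x"] unfolding h_def by linarith
      then show "norm ((v x - h n x)\<^sup>2) \<le> (2 * k)\<^sup>2" by (simp only: abs_le_square_iff real_norm_def abs_power2)
    qed
    show "AE x in M. (\<lambda>n. (v x - h n x)\<^sup>2) \<longlonglongrightarrow> 0"
      using AE
    proof eventually_elim
      case (elim x)
      have "(\<lambda>n. (v x - h n x)\<^sup>2) \<longlonglongrightarrow> (v x - v x)\<^sup>2" by (intro tendsto_intros elim)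
      then show ?case by simp
    qed
  qed auto
  then have "\<forall>\<^sub>F n in sequentially. (LINT x|M. (v x - h n x)\<^sup>2) < e"
    using assms(4) by (intro order_tendstoD(2)[where y = "LINT x|M. 0"]) auto
  then obtain n where "(LINT x|M. (v x - h n x)\<^sup>2) < e"
    by (auto simp: eventually_sequentially)
  then show thesis using that hc by blast
qed

lemma trigpoly_dense:
  assumes u: "sqint M u" and e: "0 < e"
  obtains f where "trigpoly f" "(LINT x|M. (u x - f x)\<^sup>2) < e"
proof -
  \<comment> \<open>Two uses of \<open>sq_dist_triangle\<close> weight the three errors by 4, 4 and
    2; with the sizes e/16, e/16 and e/8 the total is 3e/4.\<close>
  have e8: "0 < e / 16" using e by simp
  obtain v k where v: "v \<in> borel_measurable M" "0 \<le> k" "\<And>x. \<bar>v x\<bar> \<le> k" "(LINT x|M. (u x - v x)\<^sup>2) < e / 16"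
    using bounded_approx[OF u e8] by blast
  obtain h where h: "continuous_on UNIV h" "(LINT x|M. (v x - h x)\<^sup>2) < e / 16"
    using continuous_approx[OF v(1-3) e8] by blast
  define \<mu> where "\<mu> = measure M (space M)"
  have \<mu>: "0 \<le> \<mu>" by (simp add: \<mu>_def)
  define \<delta> where "\<delta> = sqrt (e / (8 * (\<mu> + 1)))"
  have \<delta>: "0 < \<delta>" "\<delta>\<^sup>2 = e / (8 * (\<mu> + 1))" using e \<mu> by (auto simp: \<delta>_def)
  obtain f where f: "trigpoly f" "\<And>x. x \<in> \<Omega> \<Longrightarrow> \<bar>h x - f x\<bar> < \<delta>"
    using trigpoly_uniform_approx[OF h(1) \<delta>(1)] by blast
  have s: "sqint M v" "sqint M h" "sqint M f"
    using sqint_bounded[OF v(1)] v(3) continuous_sqint_M[OF h(1)] continuous_sqint_M[OF trigpoly_continuous[OF f(1)]]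
    by auto
  have "(LINT x|M. (h x - f x)\<^sup>2) \<le> (LINT x|M. \<delta>\<^sup>2)"
  proof (rule integral_mono)
    show "integrable M (\<lambda>x. (h x - f x)\<^sup>2)" using sqint_diff[OF s(2,3)] by (simp add: sqint_def)
    fix x assume "x \<in> space M"
    then have "\<bar>h x - f x\<bar> \<le> \<bar>\<delta>\<bar>" using f(2)[of x] by simp
    then show "(h x - f x)\<^sup>2 \<le> \<delta>\<^sup>2" by (simp only: abs_le_square_iff)
  qed simp
  also have "\<dots> = e / 8 * (\<mu> / (\<mu> + 1))" using \<delta> by (simp add: \<mu>_def)
  also have "\<dots> \<le> e / 8 * 1" using e \<mu> by (intro mult_left_mono) auto
  finally have hf: "(LINT x|M. (h x - f x)\<^sup>2) \<le> e / 8" by simp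
  have "(LINT x|M. (v x - f x)\<^sup>2) \<le> 2 * (LINT x|M. (v x - h x)\<^sup>2) + 2 * (LINT x|M. (h x - f x)\<^sup>2)"
    by (rule sq_dist_triangle[OF s])
  moreover have "(LINT x|M. (u x - h x)\<^sup>2) \<le> 2 * (LINT x|M. (u x - v x)\<^sup>2) + 2 * (LINT x|M. (v x - h x)\<^sup>2)"
    by (rule sq_dist_triangle[OF u s(1,2)])
  moreover have "(LINT x|M. (u x - f x)\<^sup>2) \<le> 2 * (LINT x|M. (u x - h x)\<^sup>2) + 2 * (LINT x|M. (h x - f x)\<^sup>2)"
    by (rule sq_dist_triangle[OF u s(2,3)])
  ultimately have "(LINT x|M. (u x - f x)\<^sup>2) \<le> 4 * (LINT x|M. (u x - v x)\<^sup>2) + 4 * (LINT x|M. (v x - h x)\<^sup>2) + 2 * (LINT x|M. (h x - f x)\<^sup>2)"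
    by linarith
  then have "(LINT x|M. (u x - f x)\<^sup>2) < e"
    using v h hf e by linarith
  then show thesis using that f(1) by blast
qed

lemma directional_bound:
  assumes g: "sqint M g"
  shows "sqint M (\<lambda>x. g x \<bullet> e)" and "(LINT x|M. (g x \<bullet> e)\<^sup>2) \<le> (norm e)\<^sup>2 * (LINT x|M. g x \<bullet> g x)"
proof -
  have le: "(g x \<bullet> e)\<^sup>2 \<le> (norm e)\<^sup>2 * (g x \<bullet> g x)" for x
    using Cauchy_Schwarz_ineq[of "g x" e] by (simp add: power2_norm_eq_inner mult.commute)
  have m: "(\<lambda>x. g x \<bullet> e) \<in> borel_measurable M" using g by (auto simp: sqint_def)
  have gg: "integrable M (\<lambda>x. (norm e)\<^sup>2 * (g x \<bullet> g x))" using sqint_inner[OF g g] by simp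
  have i: "integrable M (\<lambda>x. (g x \<bullet> e)\<^sup>2)"
    by (rule Bochner_Integration.integrable_bound[OF gg]) (use m le in \<open>auto intro!: AE_I2\<close>)
  then show "sqint M (\<lambda>x. g x \<bullet> e)" using m by (simp add: sqint_def)
  have "(LINT x|M. (g x \<bullet> e)\<^sup>2) \<le> (LINT x|M. (norm e)\<^sup>2 * (g x \<bullet> g x))"
    using i gg le by (intro integral_mono) auto
  then show "(LINT x|M. (g x \<bullet> e)\<^sup>2) \<le> (norm e)\<^sup>2 * (LINT x|M. g x \<bullet> g x)" by simp
qed

definition tail_const :: real where "tail_const = (norm e1)\<^sup>2 + (norm e2)\<^sup>2"

text \<open>The part of \<open>w\<close> beyond frequency \<open>L\<close> is controlled by its gradient; this is the source
  of compactness.\<close>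

lemma low_frequency_estimate:
  assumes H: "H1 \<Omega> w g" and L: "0 < L"
  shows "(LINT x|M. (w x)\<^sup>2) \<le> (\<Sum>p\<in>{..<L} \<times> {..<L}. (LINT x|M. w x * eb p x)\<^sup>2 / nrm p)
      + tail_const / (real L)\<^sup>2 * (LINT x|M. g x \<bullet> g x)"
proof (rule field_le_epsilon)
  fix e :: real assume e: "0 < e"
  have sw: "sqint M w" and sg: "sqint M g" using H by (auto simp: H1_def L2_iff_sqint)
  obtain f where f: "trigpoly f" "(LINT x|M. (w x - f x)\<^sup>2) < e" using trigpoly_dense[OF sw e] by blast
  obtain F a where F: "finite F" "f = (\<lambda>x. \<Sum>p\<in>F. a p * eb p x)" using f(1) by (auto simp: trigpoly_def)
  have "bdd_above (fst ` F)" "bdd_above (snd ` F)" using F(1) by auto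
  then obtain N1 N2 where N12: "\<And>p. p \<in> F \<Longrightarrow> fst p \<le> N1" "\<And>p. p \<in> F \<Longrightarrow> snd p \<le> N2"
    unfolding bdd_above_def by blast
  \<comment> \<open>The square \<open>Q\<close> has to contain the low frequencies as well as all
    frequencies of \<open>f\<close>; the coefficients on \<open>Q\<close> then recover the norm of
    \<open>w\<close> up to \<open>e\<close>.\<close>
  define N where "N = max L (Suc (max N1 N2))"
  define Q where "Q = {..<N} \<times> {..<N}"
  define R where "R = {..<L} \<times> {..<L}"
  have RQ: "R \<subseteq> Q" "finite Q" by (auto simp: R_def Q_def N_def)
  have FQ: "F \<subseteq> Q" using N12 by (fastforce simp: Q_def N_def less_Suc_eq_le le_max_iff_disj less_max_iff_disj mem_Times_iff)
  define W where "W p = (LINT x|M. w x * eb p x)" for p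
  have f': "f x = (\<Sum>p\<in>Q. (if p \<in> F then a p else 0) * eb p x)" for x
    unfolding F(2) using FQ RQ by (intro sum.mono_neutral_cong_left) auto
  have "(LINT x|M. (w x)\<^sup>2) \<le> (\<Sum>p\<in>Q. (W p)\<^sup>2 / nrm p) + (LINT x|M. (w x - f x)\<^sup>2)"
    unfolding f' W_def by (rule Bessel_ineq(2)[OF RQ(2) sw eb_sqint(1) eb_orth nrm_pos])
  also have "(\<Sum>p\<in>Q. (W p)\<^sup>2 / nrm p) = (\<Sum>p\<in>R. (W p)\<^sup>2 / nrm p) + (\<Sum>p\<in>Q - R. (W p)\<^sup>2 / nrm p)"
    using sum.subset_diff[OF RQ, of "\<lambda>p. (W p)\<^sup>2 / nrm p"] by simp
  also have "(\<Sum>p\<in>Q - R. (W p)\<^sup>2 / nrm p) \<le> tail_const / (real L)\<^sup>2 * (LINT x|M. g x \<bullet> g x)"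
  proof -
    \<comment> \<open>Where one of the two frequencies is at least \<open>L\<close>, the
      coefficients of the directional derivatives exceed that of \<open>w\<close> by a factor of at
      least \<open>L\<close>; Bessel's inequality sums them against the gradient.\<close>
    define U where "U p = (LINT x|M. (g x \<bullet> e1) * eb1 p x)" for p
    define V where "V p = (LINT x|M. (g x \<bullet> e2) * eb2 p x)" for p
    have UW: "(U p)\<^sup>2 = (real (fst p) * pi)\<^sup>2 * (W p)\<^sup>2" and VW: "(V p)\<^sup>2 = (real (snd p) * pi)\<^sup>2 * (W p)\<^sup>2" for p
      unfolding U_def V_def W_def gradient_coefficients[OF H] by (simp_all add: power_mult_distrib)
    have "(\<Sum>p\<in>Q - R. (W p)\<^sup>2 / nrm p) \<le> (\<Sum>p\<in>Q - R. ((U p)\<^sup>2 / nrm p + (V p)\<^sup>2 / nrm p) / (real L)\<^sup>2)"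
    proof (rule sum_mono)
      fix p assume "p \<in> Q - R"
      then have "L \<le> fst p \<or> L \<le> snd p" by (auto simp: Q_def R_def)
      then have "(real L)\<^sup>2 \<le> (real (fst p))\<^sup>2 + (real (snd p))\<^sup>2"
      proof
        assume "L \<le> fst p"
        then have "(real L)\<^sup>2 \<le> (real (fst p))\<^sup>2" by (intro power_mono) auto
        then show ?thesis using zero_le_power2[of "real (snd p)"] by linarith
      next
        assume "L \<le> snd p"
        then have "(real L)\<^sup>2 \<le> (real (snd p))\<^sup>2" by (intro power_mono) auto
        then show ?thesis using zero_le_power2[of "real (fst p)"] by linarith
      qed
      also have "\<dots> \<le> pi\<^sup>2 * ((real (fst p))\<^sup>2 + (real (snd p))\<^sup>2)"
      proof -
        have "1 \<le> pi\<^sup>2" using pi_gt3 by (simp add: power_le_one_iff one_le_power)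
        then show ?thesis using mult_right_mono[of 1 "pi\<^sup>2" "(real (fst p))\<^sup>2 + (real (snd p))\<^sup>2"] by simp
      qed
      finally have "(real L)\<^sup>2 * ((W p)\<^sup>2 / nrm p) \<le> pi\<^sup>2 * ((real (fst p))\<^sup>2 + (real (snd p))\<^sup>2) * ((W p)\<^sup>2 / nrm p)"
        using nrm_pos[of p] by (intro mult_right_mono) auto
      also have "\<dots> = (U p)\<^sup>2 / nrm p + (V p)\<^sup>2 / nrm p"
        unfolding UW VW by (simp add: power_mult_distrib algebra_simps add_divide_distrib)
      finally show "(W p)\<^sup>2 / nrm p \<le> ((U p)\<^sup>2 / nrm p + (V p)\<^sup>2 / nrm p) / (real L)\<^sup>2"
        using L by (simp add: pos_le_divide_eq mult.commute)
    qed
    also have "\<dots> = ((\<Sum>p\<in>Q - R. (U p)\<^sup>2 / nrm p) + (\<Sum>p\<in>Q - R. (V p)\<^sup>2 / nrm p)) / (real L)\<^sup>2"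
      by (simp add: sum.distrib flip: sum_divide_distrib)
    also have "\<dots> \<le> ((norm e1)\<^sup>2 * (LINT x|M. g x \<bullet> g x) + (norm e2)\<^sup>2 * (LINT x|M. g x \<bullet> g x)) / (real L)\<^sup>2"
    proof (intro divide_right_mono add_mono)
      \<comment> \<open>The terms with \<open>fst p = 0\<close> are zero together with their
        \<open>eb1\<close>; dropping them leaves an orthogonal family with the positive norms
        \<open>nrm\<close>.\<close>
      have "(\<Sum>p\<in>Q - R. (U p)\<^sup>2 / nrm p) = (\<Sum>p\<in>{p \<in> Q - R. fst p \<noteq> 0}. (U p)\<^sup>2 / nrm p)"
        using RQ(2) by (intro sum.mono_neutral_right) (auto simp: UW)
      also have "\<dots> \<le> (LINT x|M. (g x \<bullet> e1)\<^sup>2)"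
        unfolding U_def
        by (rule Bessel_ineq(1)[OF _ directional_bound(1)[OF sg] eb_sqint(2) eb1_orth nrm_pos]) (use RQ(2) in auto)
      also have "\<dots> \<le> (norm e1)\<^sup>2 * (LINT x|M. g x \<bullet> g x)" by (rule directional_bound(2)[OF sg])
      finally show "(\<Sum>p\<in>Q - R. (U p)\<^sup>2 / nrm p) \<le> (norm e1)\<^sup>2 * (LINT x|M. g x \<bullet> g x)" .
      have "(\<Sum>p\<in>Q - R. (V p)\<^sup>2 / nrm p) = (\<Sum>p\<in>{p \<in> Q - R. snd p \<noteq> 0}. (V p)\<^sup>2 / nrm p)"
        using RQ(2) by (intro sum.mono_neutral_right) (auto simp: VW)
      also have "\<dots> \<le> (LINT x|M. (g x \<bullet> e2)\<^sup>2)"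
        unfolding V_def
        by (rule Bessel_ineq(1)[OF _ directional_bound(1)[OF sg] eb_sqint(3) eb2_orth nrm_pos]) (use RQ(2) in auto)
      also have "\<dots> \<le> (norm e2)\<^sup>2 * (LINT x|M. g x \<bullet> g x)" by (rule directional_bound(2)[OF sg])
      finally show "(\<Sum>p\<in>Q - R. (V p)\<^sup>2 / nrm p) \<le> (norm e2)\<^sup>2 * (LINT x|M. g x \<bullet> g x)" .
    qed simp
    also have "\<dots> = tail_const / (real L)\<^sup>2 * (LINT x|M. g x \<bullet> g x)"
      by (simp add: tail_const_def distrib_right)
    finally show ?thesis .
  qed
  finally show "(LINT x|M. (w x)\<^sup>2) \<le> (\<Sum>p\<in>{..<L} \<times> {..<L}. (LINT x|M. w x * eb p x)\<^sup>2 / nrm p)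
      + tail_const / (real L)\<^sup>2 * (LINT x|M. g x \<bullet> g x) + e"
    using f(2) unfolding W_def R_def by linarith
qed

text \<open>Along a diagonal subsequence every cosine coefficient converges. For a difference of two
  members, finitely many low frequencies are then small, and the high ones are uniformly small by
  the gradient bound.\<close>

lemma Rellich:
  assumes H: "\<And>k. H1 \<Omega> (u k) (g k)"
    and K: "\<And>k. (LINT x|M. g k x \<bullet> g k x) + (LINT x|M. u k x * u k x) \<le> K"
  obtains r :: "nat \<Rightarrow> nat" where "strict_mono r"
    "\<And>e. e > 0 \<Longrightarrow> \<exists>N. \<forall>m\<ge>N. \<forall>n\<ge>N. (LINT x|M. (u (r m) x - u (r n) x)\<^sup>2) < e"
proof -
  have su: "sqint M (u k)" and sg: "sqint M (g k)" for k using H by (auto simp: H1_def L2_iff_sqint)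
  have nn: "0 \<le> (LINT x|M. g k x \<bullet> g k x)" "0 \<le> (LINT x|M. u k x * u k x)" for k
    by (auto intro!: integral_nonneg_AE)
  have K0: "0 \<le> K" using K[of 0] nn[of 0] by linarith
  define X where "X n k = (LINT x|M. u k x * eb (prod_decode n) x)" for n k
  have "\<bar>X n k\<bar> \<le> sqrt (K * nrm (prod_decode n))" for n k
  proof -
    have "\<bar>X n k\<bar> \<le> sqrt ((LINT x|M. u k x * u k x) * nrm (prod_decode n))"
      using sqint_Cauchy_Schwarz[OF su eb_sqint(1), of k "prod_decode n"] by (simp add: X_def eb_orth)
    also have "\<dots> \<le> sqrt (K * nrm (prod_decode n))"
    proof (intro real_sqrt_le_mono mult_right_mono)
      show "(LINT x|M. u k x * u k x) \<le> K" using K[of k] nn[of k] by linarith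
    qed (use nrm_pos[of "prod_decode n"] in simp)
    finally show ?thesis .
  qed
  then obtain r where r: "strict_mono r" "\<And>n. convergent (\<lambda>k. X n (r k))"
    using bounded_coefficients_subseq[of X "\<lambda>n. sqrt (K * nrm (prod_decode n))"] by blast
  define Y where "Y p k = (LINT x|M. u (r k) x * eb p x)" for p k
  have Y: "Cauchy (Y p)" for p
  proof -
    have "Y p = (\<lambda>k. X (prod_encode p) (r k))" by (simp add: Y_def X_def fun_eq_iff)
    then show ?thesis using r(2)[of "prod_encode p"] by (simp add: Cauchy_convergent_iff)
  qed
  have "\<exists>N. \<forall>m\<ge>N. \<forall>n\<ge>N. (LINT x|M. (u (r m) x - u (r n) x)\<^sup>2) < e" if e: "0 < e" for e
  proof -
    \<comment> \<open>The gradient of a difference has squared norm at most \<open>4 * K\<close>;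
      \<open>L\<close> is then chosen so that the tail costs less than \<open>e / 2\<close>.\<close>
    define C where "C = tail_const * (4 * K)"
    have C: "0 \<le> C" using K0 by (simp add: C_def tail_const_def)
    obtain L0 :: nat where L0: "2 * C / e < real L0" using reals_Archimedean2 by blast
    define L where "L = Suc L0"
    have L: "0 < L" "C / (real L)\<^sup>2 < e / 2"
    proof -
      show "0 < L" by (simp add: L_def)
      have "2 * C / e < real L" using L0 by (simp add: L_def)
      also have "real L \<le> (real L)\<^sup>2" by (simp add: power2_eq_square L_def)
      finally show "C / (real L)\<^sup>2 < e / 2" using e \<open>0 < L\<close> by (simp add: field_simps)
    qed
    define Q where "Q = {..<L} \<times> {..<L}"
    have Q: "finite Q" "card Q = L * L" by (auto simp: Q_def card_cartesian_product)
    \<comment> \<open>Each of the \<open>L * L\<close> low coefficients contributes at most the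
      fraction \<open>1 / (L * L)\<close> of the other half of \<open>e\<close>.\<close>
    define \<delta> where "\<delta> p = sqrt (nrm p * e / (2 * real (L * L)))" for p
    have \<delta>: "0 < \<delta> p" "(\<delta> p)\<^sup>2 = nrm p * e / (2 * real (L * L))" for p
      using nrm_pos[of p] e L(1) by (auto simp: \<delta>_def)
    have "\<exists>N. \<forall>m\<ge>N. \<forall>n\<ge>N. \<bar>Y p m - Y p n\<bar> < \<delta> p" for p
      using Y[of p] \<delta>(1)[of p] unfolding Cauchy_def dist_real_def by blast
    then obtain N where N: "\<And>p m n. m \<ge> N p \<Longrightarrow> n \<ge> N p \<Longrightarrow> \<bar>Y p m - Y p n\<bar> < \<delta> p" by metis
    define N0 where "N0 = Max (insert 0 (N ` Q))"
    have N0: "N p \<le> N0" if "p \<in> Q" for p using that Q by (simp add: N0_def)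
    have "(LINT x|M. (u (r m) x - u (r n) x)\<^sup>2) < e" if mn: "m \<ge> N0" "n \<ge> N0" for m n
    proof -
      have Hd: "H1 \<Omega> (\<lambda>x. u (r m) x - u (r n) x) (\<lambda>x. g (r m) x - g (r n) x)"
        using H1_lin[OF open_parallelogram bounded_parallelogram H[of "r m"] H[of "r n"], where a = 1 and b = "-1"] by simp
      have "(LINT x|M. (u (r m) x - u (r n) x)\<^sup>2) \<le> (\<Sum>p\<in>Q. (LINT x|M. (u (r m) x - u (r n) x) * eb p x)\<^sup>2 / nrm p)
        + tail_const / (real L)\<^sup>2 * (LINT x|M. (g (r m) x - g (r n) x) \<bullet> (g (r m) x - g (r n) x))"
        using low_frequency_estimate[OF Hd L(1)] unfolding Q_def .
      also have "(\<Sum>p\<in>Q. (LINT x|M. (u (r m) x - u (r n) x) * eb p x)\<^sup>2 / nrm p) \<le> (\<Sum>p\<in>Q. e / (2 * real (L * L)))"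
      proof (rule sum_mono)
        fix p assume p: "p \<in> Q"
        have eq: "(LINT x|M. (u (r m) x - u (r n) x) * eb p x) = Y p m - Y p n"
          using integral_inner_lin[OF su su eb_sqint(1), where a = 1 and b = "-1"] by (simp add: Y_def)
        have "\<bar>Y p m - Y p n\<bar> \<le> \<bar>\<delta> p\<bar>" using N[of p m n] N0[OF p] mn by auto
        then have "(Y p m - Y p n)\<^sup>2 \<le> (\<delta> p)\<^sup>2" by (simp only: abs_le_square_iff)
        then have "(Y p m - Y p n)\<^sup>2 / nrm p \<le> (\<delta> p)\<^sup>2 / nrm p"
          using nrm_pos[of p] by (intro divide_right_mono) auto
        also have "\<dots> = e / (2 * real (L * L))" using nrm_pos[of p] unfolding \<delta> by simp
        finally show "(LINT x|M. (u (r m) x - u (r n) x) * eb p x)\<^sup>2 / nrm p \<le> e / (2 * real (L * L))"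
          unfolding eq .
      qed
      also have "(\<Sum>p\<in>Q. e / (2 * real (L * L))) = e / 2" using L(1) by (simp add: Q)
      also have "tail_const / (real L)\<^sup>2 * (LINT x|M. (g (r m) x - g (r n) x) \<bullet> (g (r m) x - g (r n) x))
         \<le> tail_const / (real L)\<^sup>2 * (4 * K)"
      proof (rule mult_left_mono)
        have "(LINT x|M. (g (r m) x - g (r n) x) \<bullet> (g (r m) x - g (r n) x))
            \<le> (LINT x|M. 2 * (g (r m) x \<bullet> g (r m) x) + 2 * (g (r n) x \<bullet> g (r n) x))"
        proof (rule integral_mono)
          fix x
          have "0 \<le> (g (r m) x + g (r n) x) \<bullet> (g (r m) x + g (r n) x)" by simp
          then show "(g (r m) x - g (r n) x) \<bullet> (g (r m) x - g (r n) x) \<le> 2 * (g (r m) x \<bullet> g (r m) x) + 2 * (g (r n) x \<bullet> g (r n) x)"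
            by (simp add: inner_add_left inner_add_right inner_diff_left inner_diff_right inner_commute)
        qed (use sqint_inner[OF sqint_diff[OF sg sg] sqint_diff[OF sg sg]] sqint_inner[OF sg sg] in auto)
        also have "\<dots> = 2 * (LINT x|M. g (r m) x \<bullet> g (r m) x) + 2 * (LINT x|M. g (r n) x \<bullet> g (r n) x)"
          using sqint_inner[OF sg sg] by simp
        also have "\<dots> \<le> 4 * K" using K[of "r m"] K[of "r n"] nn[of "r m"] nn[of "r n"] by linarith
        finally show "(LINT x|M. (g (r m) x - g (r n) x) \<bullet> (g (r m) x - g (r n) x)) \<le> 4 * K" .
      qed (simp add: tail_const_def)
      also have "tail_const / (real L)\<^sup>2 * (4 * K) = C / (real L)\<^sup>2" by (simp add: C_def)
      finally show ?thesis using L(2) by linarith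
    qed
    then show ?thesis by blast
  qed
  then show thesis using that r(1) by blast
qed

section \<open>The Neumann form as an instance of \<open>form_pair\<close>\<close>

definition V :: "((real \<times> real \<Rightarrow> real) \<times> (real \<times> real \<Rightarrow> real \<times> real)) set" where
  "V = {p. H1 \<Omega> (fst p) (snd p)}"

definition DA ::
    "((real \<times> real \<Rightarrow> real) \<times> (real \<times> real \<Rightarrow> real \<times> real)) \<Rightarrow> ((real \<times> real \<Rightarrow> real) \<times> (real \<times> real \<Rightarrow> real \<times> real)) \<Rightarrow> real" where
  "DA p q = (LINT x|M. snd p x \<bullet> snd q x)"
definition DB ::
    "((real \<times> real \<Rightarrow> real) \<times> (real \<times> real \<Rightarrow> real \<times> real)) \<Rightarrow> ((real \<times> real \<Rightarrow> real) \<times> (real \<times> real \<Rightarrow> real \<times> real)) \<Rightarrow> real" where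
  "DB p q = (LINT x|M. fst p x * fst q x)"

lemma V_sqint: "p \<in> V \<Longrightarrow> sqint M (fst p)" "p \<in> V \<Longrightarrow> sqint M (snd p)"
  by (auto simp: V_def H1_def L2_iff_sqint)

sublocale form_pair V pair_lin DA DB
proof
  fix x y z :: "(real \<times> real \<Rightarrow> real) \<times> (real \<times> real \<Rightarrow> real \<times> real)" and a b :: real
  show "pair_lin a x b y \<in> V" if "x \<in> V" "y \<in> V"
    using that H1_lin[OF open_parallelogram bounded_parallelogram] by (simp add: V_def pair_lin_def)
  show "DA x y = DA y x" "DB x y = DB y x" by (simp_all add: DA_def DB_def inner_commute mult.commute)
  show "DA (pair_lin a x b y) z = a * DA x z + b * DA y z" if "x \<in> V" "y \<in> V" "z \<in> V"
    using that integral_inner_lin[OF V_sqint(2) V_sqint(2) V_sqint(2)] by (simp add: DA_def pair_lin_def)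
  show "DB (pair_lin a x b y) z = a * DB x z + b * DB y z" if "x \<in> V" "y \<in> V" "z \<in> V"
    using integral_inner_lin[OF V_sqint(1)[OF that(1)] V_sqint(1)[OF that(2)] V_sqint(1)[OF that(3)], of a b]
    by (simp add: DB_def pair_lin_def)
  show "0 \<le> DA x x" "0 \<le> DB x x" by (auto simp: DA_def DB_def intro!: integral_nonneg_AE)
next
  fix u :: "nat \<Rightarrow> (real \<times> real \<Rightarrow> real) \<times> (real \<times> real \<Rightarrow> real \<times> real)"
  assume u: "\<And>n. u n \<in> V"
    and C: "\<And>e. e > 0 \<Longrightarrow> \<exists>N. \<forall>m\<ge>N. \<forall>n\<ge>N.
      DA (pair_lin 1 (u m) (-1) (u n)) (pair_lin 1 (u m) (-1) (u n)) < e \<and>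
      DB (pair_lin 1 (u m) (-1) (u n)) (pair_lin 1 (u m) (-1) (u n)) < e"
  have "\<exists>v h. H1 \<Omega> v h \<and> (\<lambda>n. LINT x|M. (fst (u n) x - v x) \<bullet> (fst (u n) x - v x)) \<longlonglongrightarrow> 0
     \<and> (\<lambda>n. LINT x|M. (snd (u n) x - h x) \<bullet> (snd (u n) x - h x)) \<longlonglongrightarrow> 0"
  proof (rule H1_complete[OF open_parallelogram bounded_parallelogram])
    show "H1 \<Omega> (fst (u n)) (snd (u n))" for n using u by (simp add: V_def)
    show "\<exists>N. \<forall>m\<ge>N. \<forall>n\<ge>N. (LINT x|M. (fst (u m) x - fst (u n) x) \<bullet> (fst (u m) x - fst (u n) x)) < e"
      if "0 < e" for e
      using C[OF that] by (simp add: DB_def pair_lin_def) blast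
    show "\<exists>N. \<forall>m\<ge>N. \<forall>n\<ge>N. (LINT x|M. (snd (u m) x - snd (u n) x) \<bullet> (snd (u m) x - snd (u n) x)) < e"
      if "0 < e" for e
      using C[OF that] by (simp add: DA_def pair_lin_def) blast
  qed
  then obtain v h where vh: "H1 \<Omega> v h"
    "(\<lambda>n. LINT x|M. (fst (u n) x - v x) \<bullet> (fst (u n) x - v x)) \<longlonglongrightarrow> 0"
    "(\<lambda>n. LINT x|M. (snd (u n) x - h x) \<bullet> (snd (u n) x - h x)) \<longlonglongrightarrow> 0" by blast
  show "\<exists>w\<in>V. (\<lambda>n. DA (pair_lin 1 (u n) (-1) w) (pair_lin 1 (u n) (-1) w)) \<longlonglongrightarrow> 0 \<and>
      (\<lambda>n. DB (pair_lin 1 (u n) (-1) w) (pair_lin 1 (u n) (-1) w)) \<longlonglongrightarrow> 0"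
    using vh by (intro bexI[of _ "(v, h)"]) (auto simp: DA_def DB_def pair_lin_def V_def)
next
  fix u :: "nat \<Rightarrow> (real \<times> real \<Rightarrow> real) \<times> (real \<times> real \<Rightarrow> real \<times> real)" and K
  assume u: "\<And>n. u n \<in> V" and K: "\<And>n. DA (u n) (u n) + DB (u n) (u n) \<le> K"
  obtain r :: "nat \<Rightarrow> nat" where r: "strict_mono r"
    "\<And>e. e > 0 \<Longrightarrow> \<exists>N. \<forall>m\<ge>N. \<forall>n\<ge>N. (LINT x|M. (fst (u (r m)) x - fst (u (r n)) x)\<^sup>2) < e"
    using Rellich[of "\<lambda>n. fst (u n)" "\<lambda>n. snd (u n)" K] u K unfolding V_def DA_def DB_def by blast
  then show "\<exists>r::nat \<Rightarrow> nat. strict_mono r \<and> (\<forall>e>0. \<exists>N. \<forall>m\<ge>N. \<forall>n\<ge>N.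
      DB (pair_lin 1 (u (r m)) (-1) (u (r n))) (pair_lin 1 (u (r m)) (-1) (u (r n))) < e)"
    by (intro exI[of _ r]) (simp add: DB_def pair_lin_def power2_eq_square)
qed

end

section \<open>Matrix eigenvalues\<close>

text \<open>Completeness is that of Euclidean space and compactness is Bolzano-Weierstrass; since
  the form of \<open>N\<close> is nonnegative, a bound on the sum of the forms bounds the
  norm.\<close>

lemma form_pair_matrix:
  fixes N :: "real^'n^'n"
  assumes sym: "transpose N = N" and psd: "\<And>x. 0 \<le> (N *v x) \<bullet> x"
  shows "form_pair UNIV (\<lambda>a x b y. a *\<^sub>R x + b *\<^sub>R y) (\<lambda>x y. (N *v x) \<bullet> y) (\<bullet>)"
proof
  fix x y z :: "real^'n" and a b :: real
  show "(N *v x) \<bullet> y = (N *v y) \<bullet> x"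
    using dot_lmul_matrix[of x N y] sym by (metis inner_commute matrix_vector_mul_lid transpose_matrix_vector)
  show "x \<bullet> y = y \<bullet> x" by (rule inner_commute)
  show "(N *v (a *\<^sub>R x + b *\<^sub>R y)) \<bullet> z = a * ((N *v x) \<bullet> z) + b * ((N *v y) \<bullet> z)"
    by (simp add: matrix_vector_right_distrib matrix_vector_mult_scaleR inner_add_left)
  show "(a *\<^sub>R x + b *\<^sub>R y) \<bullet> z = a * (x \<bullet> z) + b * (y \<bullet> z)" by (simp add: inner_add_left)
  show "0 \<le> (N *v x) \<bullet> x" by (rule psd)
next
  fix u :: "nat \<Rightarrow> real^'n"
  assume C: "\<And>e. e > 0 \<Longrightarrow> \<exists>M. \<forall>m\<ge>M. \<forall>n\<ge>M. (N *v (1 *\<^sub>R u m + - 1 *\<^sub>R u n)) \<bullet> (1 *\<^sub>R u m + - 1 *\<^sub>R u n) < e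
     \<and> (1 *\<^sub>R u m + - 1 *\<^sub>R u n) \<bullet> (1 *\<^sub>R u m + - 1 *\<^sub>R u n) < e"
  have "Cauchy u"
    unfolding Cauchy_def
  proof (intro allI impI)
    fix e :: real assume e: "0 < e"
    then obtain M where M: "\<And>m n. m \<ge> M \<Longrightarrow> n \<ge> M \<Longrightarrow> (u m - u n) \<bullet> (u m - u n) < e\<^sup>2"
      using C[of "e\<^sup>2"] by (auto simp: zero_less_power)
    have "dist (u m) (u n) < e" if "m \<ge> M" "n \<ge> M" for m n
    proof -
      have "(norm (u m - u n))\<^sup>2 < e\<^sup>2" using M[OF that] by (simp add: power2_norm_eq_inner)
      then show ?thesis using e by (simp add: dist_norm power2_less_imp_less)
    qed
    then show "\<exists>M. \<forall>m\<ge>M. \<forall>n\<ge>M. dist (u m) (u n) < e" by blast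
  qed
  then obtain w where w: "u \<longlonglongrightarrow> w" by (auto simp: Cauchy_convergent_iff convergent_def)
  have d: "(\<lambda>n. u n - w) \<longlonglongrightarrow> 0" using w by (simp add: LIM_zero)
  have "(\<lambda>n. (N *v (u n - w)) \<bullet> (u n - w)) \<longlonglongrightarrow> (N *v 0) \<bullet> 0"
    by (intro tendsto_inner d bounded_linear.tendsto[OF matrix_vector_mul_bounded_linear])
  moreover have "(\<lambda>n. (u n - w) \<bullet> (u n - w)) \<longlonglongrightarrow> (0 :: real^'n) \<bullet> 0" by (rule tendsto_inner[OF d d])
  ultimately show "\<exists>w\<in>UNIV. (\<lambda>n. (N *v (1 *\<^sub>R u n + - 1 *\<^sub>R w)) \<bullet> (1 *\<^sub>R u n + - 1 *\<^sub>R w)) \<longlonglongrightarrow> 0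
      \<and> (\<lambda>n. (1 *\<^sub>R u n + - 1 *\<^sub>R w) \<bullet> (1 *\<^sub>R u n + - 1 *\<^sub>R w)) \<longlonglongrightarrow> 0"
    by (intro bexI[of _ w]) auto
next
  fix u :: "nat \<Rightarrow> real^'n" and K
  assume K: "\<And>n. (N *v u n) \<bullet> u n + u n \<bullet> u n \<le> K"
  have "bounded (range u)"
  proof (rule boundedI)
    fix x assume "x \<in> range u"
    then have "(norm x)\<^sup>2 \<le> K" using K psd by (auto simp: power2_norm_eq_inner) (smt (verit) psd)
    then show "norm x \<le> sqrt K" using real_le_rsqrt by blast
  qed
  then obtain l r where r: "strict_mono r" "(u \<circ> r) \<longlonglongrightarrow> l"
    using bounded_imp_convergent_subsequence by blast
  then have C: "Cauchy (u \<circ> r)" using LIMSEQ_imp_Cauchy by blast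
  have "\<exists>M. \<forall>m\<ge>M. \<forall>n\<ge>M. (u (r m) - u (r n)) \<bullet> (u (r m) - u (r n)) < e" if e: "0 < e" for e
  proof -
    have "0 < sqrt e" using e by simp
    then obtain M where M: "\<And>m n. m \<ge> M \<Longrightarrow> n \<ge> M \<Longrightarrow> dist (u (r m)) (u (r n)) < sqrt e"
      using C unfolding Cauchy_def o_def by blast
    have "(u (r m) - u (r n)) \<bullet> (u (r m) - u (r n)) < e" if "m \<ge> M" "n \<ge> M" for m n
    proof -
      have "(norm (u (r m) - u (r n)))\<^sup>2 < (sqrt e)\<^sup>2"
        using M[OF that] by (intro power_strict_mono) (auto simp: dist_norm)
      then show ?thesis using e by (simp add: power2_norm_eq_inner)
    qed
    then show ?thesis by blast
  qed
  then show "\<exists>r::nat \<Rightarrow> nat. strict_mono r \<and> (\<forall>e>0. \<exists>M. \<forall>m\<ge>M. \<forall>n\<ge>M.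
      (1 *\<^sub>R u (r m) + - 1 *\<^sub>R u (r n)) \<bullet> (1 *\<^sub>R u (r m) + - 1 *\<^sub>R u (r n)) < e)"
    using r(1) by (intro exI[of _ r]) simp
qed auto

text \<open>The abstract bound on the plane spanned by \<open>v\<close> and \<open>w\<close>.
  Semidefiniteness excludes negative eigenvalues, and orthonormal eigenvectors are independent, so
  their number is at most the dimension in the definition.\<close>

lemma second_matrix_eigenvalue_bound:
  fixes N :: "real^'n^'n"
  assumes sym: "transpose N = N" and psd: "\<And>x. 0 \<le> (N *v x) \<bullet> x"
    and indep: "\<And>a b. a \<noteq> 0 \<or> b \<noteq> 0 \<Longrightarrow> a *\<^sub>R v + b *\<^sub>R w \<noteq> 0"
  shows "(\<And>a b. a \<noteq> 0 \<or> b \<noteq> 0 \<Longrightarrow> (N *v (a *\<^sub>R v + b *\<^sub>R w)) \<bullet> (a *\<^sub>R v + b *\<^sub>R w)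
        < T * ((a *\<^sub>R v + b *\<^sub>R w) \<bullet> (a *\<^sub>R v + b *\<^sub>R w))) \<Longrightarrow> matrix_eigenvalue N 2 < T"
    and "(\<And>a b. a \<noteq> 0 \<or> b \<noteq> 0 \<Longrightarrow> (N *v (a *\<^sub>R v + b *\<^sub>R w)) \<bullet> (a *\<^sub>R v + b *\<^sub>R w)
        \<le> T * ((a *\<^sub>R v + b *\<^sub>R w) \<bullet> (a *\<^sub>R v + b *\<^sub>R w))) \<Longrightarrow> matrix_eigenvalue N 2 \<le> T"
proof -
  interpret F: form_pair UNIV "\<lambda>a x b y. a *\<^sub>R x + b *\<^sub>R y" "\<lambda>x y. (N *v x) \<bullet> y" "(\<bullet>)"
    by (rule form_pair_matrix[OF sym psd])
  define u where "u i = (if i = (0::nat) then v else w)" for i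
  have u: "u 0 = v" "u (Suc 0) = w" by (auto simp: u_def)
  have B: "(\<Sum>i<2. \<Sum>j<2. x i * x j * (u i \<bullet> u j)) = (x 0 *\<^sub>R v + x 1 *\<^sub>R w) \<bullet> (x 0 *\<^sub>R v + x 1 *\<^sub>R w)" for x :: "nat \<Rightarrow> real"
    by (simp add: numeral_2_eq_2 u inner_add_left inner_add_right algebra_simps)
  have A: "(\<Sum>i<2. \<Sum>j<2. x i * x j * ((N *v u i) \<bullet> u j)) = (N *v (x 0 *\<^sub>R v + x 1 *\<^sub>R w)) \<bullet> (x 0 *\<^sub>R v + x 1 *\<^sub>R w)" for x :: "nat \<Rightarrow> real"
    by (simp add: numeral_2_eq_2 u matrix_vector_right_distrib matrix_vector_mult_scaleR inner_add_left inner_add_right algebra_simps)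
  have ex: "(\<exists>i<2. x i \<noteq> 0) \<longleftrightarrow> x 0 \<noteq> 0 \<or> x 1 \<noteq> 0" for x :: "nat \<Rightarrow> real"
    by (auto simp: less_2_cases_iff)
  have pos: "0 < (\<Sum>i<2. \<Sum>j<2. x i * x j * (u i \<bullet> u j))" if "\<exists>i<2. x i \<noteq> 0" for x :: "nat \<Rightarrow> real"
    using indep that unfolding B ex by simp
  have neg: "enat (dim {v. N *v v = t *\<^sub>R v}) = 0" if "t < 0" for t
  proof -
    have "x = 0" if "N *v x = t *\<^sub>R x" for x
    proof (rule ccontr)
      assume "x \<noteq> 0"
      then have "t * (x \<bullet> x) < 0" using \<open>t < 0\<close> by (simp add: mult_neg_pos)
      then show False using psd[of x] that by simp
    qed
    then have "{v. N *v v = t *\<^sub>R v} \<subseteq> {0}" by auto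
    then have "dim {v. N *v v = t *\<^sub>R v} = 0" by (simp add: dim_eq_0)
    then show ?thesis by (simp add: zero_enat_def)
  qed
  have mult: "enat (card F) \<le> enat (dim {v. N *v v = t *\<^sub>R v})"
    if F: "finite F" and eig: "\<And>i. i \<in> F \<Longrightarrow> F.eigen t (e i)"
      and on: "\<And>i j. i \<in> F \<Longrightarrow> j \<in> F \<Longrightarrow> e i \<bullet> e j = (if i = j then 1 else 0)" for F :: "nat set" and e t
  proof -
    have "N *v e i = t *\<^sub>R e i" if "i \<in> F" for i
    proof -
      have "(N *v e i) \<bullet> x = (t *\<^sub>R e i) \<bullet> x" for x using eig[OF that] by (simp add: F.eigen_def)
      then show ?thesis by (rule vector_eq_rdot[THEN iffD1, rule_format, rotated])
    qed
    then have sub: "e ` F \<subseteq> {v. N *v v = t *\<^sub>R v}" by auto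
    have inj: "inj_on e F" using on by (metis inj_onI zero_neq_one)
    have "independent (e ` F)"
      using on by (intro pairwise_orthogonal_independent) (force simp: pairwise_def orthogonal_def)+
    then have "card (e ` F) \<le> dim {v. N *v v = t *\<^sub>R v}"
      using sub independent_card_le_dim by blast
    then show ?thesis using inj by (simp add: card_image)
  qed
  note up = F.eigenvalue_strict_upper_bound[where w = u and n = 2 and m = "\<lambda>t. enat (dim {v. N *v v = t *\<^sub>R v})",
      OF UNIV_I _ pos neg mult, folded matrix_eigenvalue_def]
  show "matrix_eigenvalue N 2 < T"
    if "\<And>a b. a \<noteq> 0 \<or> b \<noteq> 0 \<Longrightarrow> (N *v (a *\<^sub>R v + b *\<^sub>R w)) \<bullet> (a *\<^sub>R v + b *\<^sub>R w)
        < T * ((a *\<^sub>R v + b *\<^sub>R w) \<bullet> (a *\<^sub>R v + b *\<^sub>R w))"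
    by (rule up(1)) (use that in \<open>auto simp: A B ex simp del: One_nat_def\<close>)
  show "matrix_eigenvalue N 2 \<le> T"
    if "\<And>a b. a \<noteq> 0 \<or> b \<noteq> 0 \<Longrightarrow> (N *v (a *\<^sub>R v + b *\<^sub>R w)) \<bullet> (a *\<^sub>R v + b *\<^sub>R w)
        \<le> T * ((a *\<^sub>R v + b *\<^sub>R w) \<bullet> (a *\<^sub>R v + b *\<^sub>R w))"
    by (rule up(2)) (use that in \<open>auto simp: A B ex simp del: One_nat_def\<close>)
qed

section \<open>The block matrix in coordinates\<close>

definition vec4 :: "real \<Rightarrow> real \<Rightarrow> real \<Rightarrow> real \<Rightarrow> real^(2+2)" where
  "vec4 p q r s = (\<chi> i. case i of Inl j \<Rightarrow> (if j = 1 then p else q) | Inr j \<Rightarrow> (if j = 1 then r else s))"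

lemma sum_UNIV_2_2: "(\<Sum>i\<in>(UNIV :: (2 + 2) set). f i) = f (Inl 1) + f (Inl 2) + (f (Inr 1) + f (Inr 2))"
  for f :: "2 + 2 \<Rightarrow> real"
  using sum.Plus[of "UNIV :: 2 set" "UNIV :: 2 set" f] by (simp add: UNIV_Plus_UNIV sum_2)

lemma vec4_lin: "a *\<^sub>R vec4 p q r s + b *\<^sub>R vec4 p' q' r' s' = vec4 (a * p + b * p') (a * q + b * q') (a * r + b * r') (a * s + b * s')"
  by (auto simp: vec4_def vec_eq_iff split: sum.split)

lemma vec4_inner: "vec4 p q r s \<bullet> vec4 p' q' r' s' = p * p' + q * q' + (r * r' + s * s')"
  by (simp add: inner_vec_def sum_UNIV_2_2 vec4_def)

lemma vec4_exhaust: obtains p q r s where "x = vec4 p q r s"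
proof
  show "x = vec4 (x $ Inl 1) (x $ Inl 2) (x $ Inr 1) (x $ Inr 2)"
    by (auto simp: vec4_def vec_eq_iff split: sum.split) (metis exhaust_2)+
qed

lemma L_mat_entries:
  "L_mat c d $ 1 $ 1 = pi\<^sup>2 * (1 + c\<^sup>2 / d\<^sup>2)" "L_mat c d $ 1 $ 2 = - (8 * c / d\<^sup>2)"
  "L_mat c d $ 2 $ 1 = - (8 * c / d\<^sup>2)" "L_mat c d $ 2 $ 2 = pi\<^sup>2 / d\<^sup>2"
  by (simp_all add: L_mat_def)

lemma M_mat_entries:
  "M_mat c d $ 1 $ 1 = pi\<^sup>2 * (1 + c\<^sup>2 / d\<^sup>2) + pi\<^sup>2 / d\<^sup>2"
  "M_mat c d $ 1 $ 2 = - (32 * sqrt 2 * c / (3 * d\<^sup>2))"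
  "M_mat c d $ 2 $ 1 = - (32 * sqrt 2 * c / (3 * d\<^sup>2))" "M_mat c d $ 2 $ 2 = 4 * pi\<^sup>2 * (1 + c\<^sup>2 / d\<^sup>2)"
  by (simp_all add: M_mat_def)

lemma direct_sum_form:
  "((A \<oplus>\<^sub>m B) *v vec4 p q r s) \<bullet> vec4 p q r s =
     (A $ 1 $ 1 * p + A $ 1 $ 2 * q) * p + (A $ 2 $ 1 * p + A $ 2 $ 2 * q) * q
     + ((B $ 1 $ 1 * r + B $ 1 $ 2 * s) * r + (B $ 2 $ 1 * r + B $ 2 $ 2 * s) * s)"
  unfolding inner_vec_def matrix_vector_mult_def sum_UNIV_2_2
  by (simp add: direct_sum_def vec4_def sum_UNIV_2_2)

text \<open>Pulling out \<open>d\<^sup>2\<close> exposes the two quadratic forms of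
  \<open>trial_regions\<close>, which are compared with \<open>T * d\<^sup>2\<close>.\<close>

lemma block_form:
  assumes "0 < d"
  shows "((L_mat c d \<oplus>\<^sub>m M_mat c d) *v vec4 p q r s) \<bullet> vec4 p q r s =
     (pi\<^sup>2 * ((c\<^sup>2 + d\<^sup>2) * p\<^sup>2 + q\<^sup>2) - 16 * c * p * q
      + (pi\<^sup>2 * ((1 + (c\<^sup>2 + d\<^sup>2)) * r\<^sup>2 + 4 * (c\<^sup>2 + d\<^sup>2) * s\<^sup>2) - 64 * sqrt 2 / 3 * c * r * s)) / d\<^sup>2"
proof -
  define D where "D = d\<^sup>2"
  have D: "D \<noteq> 0" using assms by (simp add: D_def)
  show ?thesis
    unfolding direct_sum_form L_mat_entries M_mat_entries D_def[symmetric]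
    using D by (simp add: field_simps power2_eq_square[of p] power2_eq_square[of q] power2_eq_square[of r] power2_eq_square[of s])
qed

lemma block_symmetric: "transpose (L_mat c d \<oplus>\<^sub>m M_mat c d) = L_mat c d \<oplus>\<^sub>m M_mat c d"
proof -
  have "A $ i $ j = A $ j $ i" if "A $ 1 $ 2 = A $ 2 $ 1" for A :: "real^2^2" and i j
    using that exhaust_2[of i] exhaust_2[of j] by auto
  then have "L_mat c d $ i $ j = L_mat c d $ j $ i" "M_mat c d $ i $ j = M_mat c d $ j $ i" for i j
    by (auto simp: L_mat_def M_mat_def vector_2)
  then show ?thesis
    by (auto simp: transpose_def vec_eq_iff direct_sum_def split: sum.split)
qed

text \<open>The couplings are of order \<open>c \<le> \<rho>\<close>, and the diagonal absorbs them
  by the inequality between arithmetic and geometric means, as long as their coefficient is at most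
  2 pi^2; 18 is a convenient number below it.\<close>

lemma block_psd:
  assumes c: "0 \<le> c" and d: "0 < d"
  shows "0 \<le> ((L_mat c d \<oplus>\<^sub>m M_mat c d) *v x) \<bullet> x"
proof -
  obtain p q r s where x: "x = vec4 p q r s" by (rule vec4_exhaust)
  define \<rho> where "\<rho> = sqrt (c\<^sup>2 + d\<^sup>2)"
  have \<rho>: "\<rho>\<^sup>2 = c\<^sup>2 + d\<^sup>2" "c \<le> \<rho>" "0 \<le> \<rho>" using c by (auto simp: \<rho>_def real_le_rsqrt)
  have cross: "\<bar>K * c * a * b\<bar> \<le> pi\<^sup>2 * (\<rho>\<^sup>2 * a\<^sup>2 + b\<^sup>2)" if "0 \<le> K" "K \<le> 18" for K a b
  proof -
    have "\<bar>K * c * a * b\<bar> = K * c * (\<bar>a\<bar> * \<bar>b\<bar>)" using that c by (simp add: abs_mult)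
    also have "\<dots> \<le> (2 * pi\<^sup>2) * \<rho> * (\<bar>a\<bar> * \<bar>b\<bar>)"
      using that c \<rho> pi_sq_bounds by (intro mult_right_mono mult_mono) auto
    also have "\<dots> = pi\<^sup>2 * (2 * (\<rho> * \<bar>a\<bar>) * \<bar>b\<bar>)" by simp
    also have "\<dots> \<le> pi\<^sup>2 * ((\<rho> * \<bar>a\<bar>)\<^sup>2 + \<bar>b\<bar>\<^sup>2)"
      using zero_le_power2[of "\<rho> * \<bar>a\<bar> - \<bar>b\<bar>"] by (intro mult_left_mono) (auto simp: power2_diff)
    finally show ?thesis by (simp add: power_mult_distrib)
  qed
  have s2: "sqrt 2 \<le> 3 / 2" by (rule real_le_lsqrt) (auto simp: power2_eq_square)
  \<comment> \<open>With \<open>2 * s\<close> as the variable the M block takes the shape of the L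
    block, and the coefficient \<open>64 * sqrt 2 / 6\<close> is at most 16.\<close>
  have "\<bar>64 * sqrt 2 / 6 * c * (2 * s) * r\<bar> \<le> pi\<^sup>2 * (\<rho>\<^sup>2 * (2 * s)\<^sup>2 + r\<^sup>2)" using s2 by (intro cross) auto
  then have "64 * sqrt 2 / 3 * c * r * s \<le> pi\<^sup>2 * (4 * \<rho>\<^sup>2 * s\<^sup>2 + r\<^sup>2)"
    by (simp add: abs_le_iff mult_ac power_mult_distrib)
  also have "\<dots> \<le> pi\<^sup>2 * ((1 + \<rho>\<^sup>2) * r\<^sup>2 + 4 * \<rho>\<^sup>2 * s\<^sup>2)"
    by (intro mult_left_mono) (auto simp: distrib_right)
  finally have "0 \<le> pi\<^sup>2 * ((1 + \<rho>\<^sup>2) * r\<^sup>2 + 4 * \<rho>\<^sup>2 * s\<^sup>2) - 64 * sqrt 2 / 3 * c * r * s" by simp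
  moreover have "\<bar>16 * c * p * q\<bar> \<le> pi\<^sup>2 * (\<rho>\<^sup>2 * p\<^sup>2 + q\<^sup>2)" by (intro cross) auto
  then have "0 \<le> pi\<^sup>2 * (\<rho>\<^sup>2 * p\<^sup>2 + q\<^sup>2) - 16 * c * p * q" by (simp add: abs_le_iff)
  ultimately show ?thesis
    unfolding x block_form[OF d] \<rho>(1) by (intro divide_nonneg_nonneg add_nonneg_nonneg) auto
qed

section \<open>Neumann eigenvalues\<close>

context parallelogram_domain
begin

lemma eigen_neumann_laplacian:
  assumes "eigen t p"
  shows "neumann_laplacian \<Omega> (fst p) (\<lambda>x. t * fst p x)"
proof -
  have p: "p \<in> V" and eig: "\<And>q. q \<in> V \<Longrightarrow> DA p q = t * DB p q" using assms by (auto simp: eigen_def)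
  have "(\<lambda>x. t * fst p x) \<in> L2 \<Omega>"
    using sqint_lin[OF V_sqint(1)[OF p] V_sqint(1)[OF p], of t 0] by (simp add: L2_iff_sqint)
  moreover have "(LINT x|M. snd p x \<bullet> h x) = (LINT x|M. t * fst p x * v x)" if "H1 \<Omega> v h" for v h
    using eig[of "(v, h)"] that by (simp add: V_def DA_def DB_def mult.assoc)
  ultimately show ?thesis using p unfolding neumann_laplacian_def V_def by blast
qed

text \<open>The index set is renumbered as an initial segment, as the definition asks for.
  Integrating a vanishing combination against \<open>u j\<close> isolates the coefficient
  \<open>a j\<close>.\<close>

lemma neumann_multiplicity_ge:
  fixes F :: "nat set"
  assumes F: "finite F" and eig: "\<And>i. i \<in> F \<Longrightarrow> eigen t (e i)"
    and on: "\<And>i j. i \<in> F \<Longrightarrow> j \<in> F \<Longrightarrow> DB (e i) (e j) = (if i = j then 1 else 0)"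
  shows "enat (card F) \<le> neumann_multiplicity \<Omega> t"
proof -
  obtain f where f: "bij_betw f {0..<card F} F" using F ex_bij_betw_nat_finite by blast
  define u where "u i = fst (e (f i))" for i
  have fF: "f i \<in> F" if "i < card F" for i using f that by (auto simp: bij_betw_def)
  have su: "sqint M (u i)" if "i < card F" for i
    using eig[OF fF[OF that]] V_sqint(1) by (auto simp: u_def eigen_def)
  have inner: "(LINT x|M. u i x * u j x) = (if i = j then 1 else 0)" if "i < card F" "j < card F" for i j
    using on[OF fF[OF that(1)] fF[OF that(2)]] f that
    by (auto simp: u_def DB_def bij_betw_def inj_on_eq_iff)
  have "L2_independent \<Omega> (card F) u"
    unfolding L2_independent_def
  proof (intro allI impI)
    fix a :: "nat \<Rightarrow> real" and j
    assume ae: "AE x in M. (\<Sum>i<card F. a i * u i x) = 0" and j: "j < card F"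
    have "0 = (LINT x|M. (\<Sum>i<card F. a i * u i x) * u j x)"
      using ae by (intro integral_eq_zero_AE[symmetric]) (auto elim: eventually_mono)
    also have "\<dots> = (LINT x|M. (\<Sum>i<card F. a i * (u i x * u j x)))"
      by (simp only: sum_distrib_right mult.assoc)
    also have "\<dots> = (\<Sum>i<card F. (LINT x|M. a i * (u i x * u j x)))"
      using su j by (intro Bochner_Integration.integral_sum integrable_mult_right sqint_real_mult) auto
    also have "\<dots> = (\<Sum>i<card F. if i = j then a j else 0)"
      using inner j by (intro sum.cong) auto
    finally show "a j = 0" using j by simp
  qed
  moreover have "\<forall>i<card F. neumann_laplacian \<Omega> (u i) (\<lambda>x. t * u i x)"
    using eig fF eigen_neumann_laplacian unfolding u_def by blast
  ultimately show ?thesis unfolding neumann_multiplicity_def by (intro Sup_upper) blast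
qed

text \<open>An eigenfunction tested against itself gives the Dirichlet integral as \<open>t\<close>
  times the squared norm. For negative \<open>t\<close> it vanishes almost everywhere, which
  contradicts independence.\<close>

lemma neumann_multiplicity_neg:
  assumes "t < 0"
  shows "neumann_multiplicity \<Omega> t = 0"
proof -
  have "n = 0" if lap: "\<forall>i<n. neumann_laplacian \<Omega> (u i) (\<lambda>x. t * u i x)" and ind: "L2_independent \<Omega> n u"
    for n and u :: "nat \<Rightarrow> real \<times> real \<Rightarrow> real"
  proof (rule ccontr)
    assume "n \<noteq> 0"
    then obtain g where H: "H1 \<Omega> (u 0) g"
      and eq: "\<And>v h. H1 \<Omega> v h \<Longrightarrow> (LINT x|M. g x \<bullet> h x) = (LINT x|M. t * u 0 x * v x)"
      using lap unfolding neumann_laplacian_def by blast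
    have su: "sqint M (u 0)" using H by (auto simp: H1_def L2_iff_sqint)
    have "0 \<le> (LINT x|M. g x \<bullet> g x)" by (intro integral_nonneg_AE) auto
    also have "\<dots> = t * (LINT x|M. (u 0 x)\<^sup>2)" using eq[OF H] by (simp add: mult.assoc power2_eq_square)
    finally have "(LINT x|M. (u 0 x)\<^sup>2) \<le> 0" using assms by (simp add: zero_le_mult_iff)
    then have "(LINT x|M. (u 0 x)\<^sup>2) = 0" by (intro antisym integral_nonneg_AE) auto
    then have "AE x in M. (u 0 x)\<^sup>2 = 0"
      using su by (subst (asm) integral_nonneg_eq_0_iff_AE) (auto simp: sqint_def)
    then have "AE x in M. (\<Sum>i<n. (if i = 0 then 1 else 0) * u i x) = 0"
    proof eventually_elim
      case (elim x)
      have "(\<Sum>i<n. (if i = 0 then 1 else 0) * u i x) = (\<Sum>i<n. if i = 0 then u 0 x else 0)"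
        by (intro sum.cong) auto
      then show ?case using elim \<open>n \<noteq> 0\<close> by simp
    qed
    then have "\<forall>i<n. (if i = 0 then 1 else 0 :: real) = 0"
      using spec[OF ind[unfolded L2_independent_def], of "\<lambda>i. if i = 0 then 1 else 0"] by simp
    then show False using \<open>n \<noteq> 0\<close> by auto
  qed
  then have "neumann_multiplicity \<Omega> t \<le> 0"
    unfolding neumann_multiplicity_def by (intro Sup_least) (auto simp: zero_enat_def)
  then show ?thesis by simp
qed

section \<open>Trial spaces that contain the constants\<close>

lemma one_in_V: "((\<lambda>_. 1), (\<lambda>_. 0)) \<in> V"
  unfolding V_def H1_def fst_conv snd_conv mem_Collect_eq
proof (intro conjI)
  show "(\<lambda>_. 1) \<in> L2 \<Omega>" "(\<lambda>_. 0) \<in> L2 \<Omega>" by (auto simp: L2_iff_sqint intro!: continuous_sqint_M)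
  show "weak_gradient \<Omega> (\<lambda>_. 1) (\<lambda>_. 0)"
    by (rule weak_gradient_C1[OF open_parallelogram bounded_parallelogram]) auto
qed

lemma C1_in_V:
  assumes der: "\<And>x. (u has_derivative (\<lambda>h. G x \<bullet> h)) (at x)" and G: "continuous_on UNIV G"
  shows "(u, G) \<in> V"
proof -
  have "continuous_on UNIV u"
    using der has_derivative_continuous by (metis continuous_on_eq_continuous_at open_UNIV)
  then show ?thesis
    using weak_gradient_C1[OF open_parallelogram bounded_parallelogram der G] G
    by (auto simp: V_def H1_def L2_iff_sqint intro: continuous_sqint_M)
qed

lemma integral_one: "(LINT x|M. 1) = d"
  using integral_product[of "\<lambda>_. 1" "\<lambda>_. 1"] by simp

text \<open>The constant function is the first of three trial functions. It has no energy and is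
  orthogonal to the mean-zero functions \<open>p\<close> and \<open>q\<close>, so for
  \<open>T > 0\<close> only a condition on the plane of \<open>p\<close> and \<open>q\<close>
  remains.\<close>

lemma third_eigenvalue_bound:
  assumes p: "p \<in> V" and q: "q \<in> V" and mean: "(LINT x|M. fst p x) = 0" "(LINT x|M. fst q x) = 0"
    and pos: "\<And>a b. a \<noteq> 0 \<or> b \<noteq> 0 \<Longrightarrow> 0 < a\<^sup>2 * DB p p + 2 * a * b * DB p q + b\<^sup>2 * DB q q" and T: "0 < T"
  shows "(\<And>a b. a \<noteq> 0 \<or> b \<noteq> 0 \<Longrightarrow> a\<^sup>2 * DA p p + 2 * a * b * DA p q + b\<^sup>2 * DA q q
      < T * (a\<^sup>2 * DB p p + 2 * a * b * DB p q + b\<^sup>2 * DB q q)) \<Longrightarrow> neumann_eigenvalue \<Omega> 3 < T"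
    and "(\<And>a b. a \<noteq> 0 \<or> b \<noteq> 0 \<Longrightarrow> a\<^sup>2 * DA p p + 2 * a * b * DA p q + b\<^sup>2 * DA q q
      \<le> T * (a\<^sup>2 * DB p p + 2 * a * b * DB p q + b\<^sup>2 * DB q q)) \<Longrightarrow> neumann_eigenvalue \<Omega> 3 \<le> T"
proof -
  define w where "w i = (if i = (0::nat) then ((\<lambda>_. 1), (\<lambda>_. 0)) else if i = 1 then p else q)" for i
  have wV: "w i \<in> V" for i using one_in_V p q by (auto simp: w_def)
  have w: "w 0 = ((\<lambda>_. 1), (\<lambda>_. 0))" "w (Suc 0) = p" "w (Suc (Suc 0)) = q" by (auto simp: w_def)
  have B0: "DB (w 0) (w 0) = d" "DB (w 0) p = 0" "DB (w 0) q = 0" "DB p (w 0) = 0" "DB q (w 0) = 0"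
    using mean integral_one by (auto simp: DB_def w)
  have A0: "DA (w 0) v = 0" "DA v (w 0) = 0" for v by (auto simp: DA_def w)
  have BA: "DB q p = DB p q" "DA q p = DA p q" using p q by (auto intro: B_sym A_sym)
  have B: "(\<Sum>i<3. \<Sum>j<3. x i * x j * DB (w i) (w j)) = (x 0)\<^sup>2 * d + ((x 1)\<^sup>2 * DB p p + 2 * x 1 * x 2 * DB p q + (x 2)\<^sup>2 * DB q q)" for x
    using B0 BA by (simp add: numeral_3_eq_3 numeral_2_eq_2 w(2,3) algebra_simps)
  have A: "(\<Sum>i<3. \<Sum>j<3. x i * x j * DA (w i) (w j)) = (x 1)\<^sup>2 * DA p p + 2 * x 1 * x 2 * DA p q + (x 2)\<^sup>2 * DA q q" for x
    using A0 BA by (simp add: numeral_3_eq_3 numeral_2_eq_2 w(2,3) algebra_simps)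
  have ex: "(\<exists>i<3. x i \<noteq> 0) \<longleftrightarrow> x 0 \<noteq> 0 \<or> x 1 \<noteq> 0 \<or> x 2 \<noteq> 0" for x :: "nat \<Rightarrow> real"
    by (auto simp: numeral_3_eq_3 numeral_2_eq_2 less_Suc_eq)
  have posB: "0 < (\<Sum>i<3. \<Sum>j<3. x i * x j * DB (w i) (w j))" if "\<exists>i<3. x i \<noteq> 0" for x :: "nat \<Rightarrow> real"
  proof (cases "x 1 \<noteq> 0 \<or> x 2 \<noteq> 0")
    case True
    have "0 \<le> (x 0)\<^sup>2 * d" using d_pos by simp
    then show ?thesis unfolding B using pos[OF True] by linarith
  next
    case False
    then show ?thesis using that d_pos unfolding B ex by simp
  qed
  note up = eigenvalue_strict_upper_bound[where w = w and n = 3 and m = "neumann_multiplicity \<Omega>",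
      OF wV _ posB neumann_multiplicity_neg neumann_multiplicity_ge, folded neumann_eigenvalue_def]
  show "neumann_eigenvalue \<Omega> 3 < T"
    if less: "\<And>a b. a \<noteq> 0 \<or> b \<noteq> 0 \<Longrightarrow> a\<^sup>2 * DA p p + 2 * a * b * DA p q + b\<^sup>2 * DA q q
      < T * (a\<^sup>2 * DB p p + 2 * a * b * DB p q + b\<^sup>2 * DB q q)"
    unfolding neumann_eigenvalue_def
  proof (rule up(1)[unfolded neumann_eigenvalue_def])
    fix x :: "nat \<Rightarrow> real" assume x: "\<exists>i<3. x i \<noteq> 0"
    have nn: "0 \<le> T * ((x 0)\<^sup>2 * d)" using d_pos T by simp
    show "(\<Sum>i<3. \<Sum>j<3. x i * x j * DA (w i) (w j)) < T * (\<Sum>i<3. \<Sum>j<3. x i * x j * DB (w i) (w j))"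
    proof (cases "x 1 \<noteq> 0 \<or> x 2 \<noteq> 0")
      case True
      then show ?thesis unfolding A B distrib_left[of T "(x 0)\<^sup>2 * d"] using less[OF True] nn by linarith
    next
      case False
      then show ?thesis using x d_pos T unfolding A B ex by simp
    qed
  qed auto
  show "neumann_eigenvalue \<Omega> 3 \<le> T"
    if le: "\<And>a b. a \<noteq> 0 \<or> b \<noteq> 0 \<Longrightarrow> a\<^sup>2 * DA p p + 2 * a * b * DA p q + b\<^sup>2 * DA q q
      \<le> T * (a\<^sup>2 * DB p p + 2 * a * b * DB p q + b\<^sup>2 * DB q q)"
    unfolding neumann_eigenvalue_def
  proof (rule up(2)[unfolded neumann_eigenvalue_def])
    fix x :: "nat \<Rightarrow> real" assume x: "\<exists>i<3. x i \<noteq> 0"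
    have nn: "0 \<le> T * ((x 0)\<^sup>2 * d)" using d_pos T by simp
    show "(\<Sum>i<3. \<Sum>j<3. x i * x j * DA (w i) (w j)) \<le> T * (\<Sum>i<3. \<Sum>j<3. x i * x j * DB (w i) (w j))"
    proof (cases "x 1 \<noteq> 0 \<or> x 2 \<noteq> 0")
      case True
      then show ?thesis unfolding A B distrib_left[of T "(x 0)\<^sup>2 * d"] using le[OF True] nn by linarith
    next
      case False
      then show ?thesis using x d_pos T unfolding A B ex by simp
    qed
  qed auto
qed

lemma a_inner: "a1 \<bullet> a1 = (c\<^sup>2 + d\<^sup>2) / d\<^sup>2" "a1 \<bullet> a2 = - c / d\<^sup>2" "a2 \<bullet> a1 = - c / d\<^sup>2" "a2 \<bullet> a2 = 1 / d\<^sup>2"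
  using d_pos by (auto simp: a1_def a2_def power2_eq_square field_simps)

text \<open>A function \<open>\<phi>(s,t)\<close> of the coordinates has gradient \<open>\<phi>\<^sub>s a1 + \<phi>\<^sub>t a2\<close>.\<close>

lemma gradient_form:
  assumes "integrable M (\<lambda>x. f x * f' x)" "integrable M (\<lambda>x. f x * g' x)"
    "integrable M (\<lambda>x. g x * f' x)" "integrable M (\<lambda>x. g x * g' x)"
  shows "DA (u, \<lambda>x. f x *\<^sub>R a1 + g x *\<^sub>R a2) (v, \<lambda>x. f' x *\<^sub>R a1 + g' x *\<^sub>R a2) =
     ((c\<^sup>2 + d\<^sup>2) * (LINT x|M. f x * f' x) - c * ((LINT x|M. f x * g' x) + (LINT x|M. g x * f' x)) + (LINT x|M. g x * g' x)) / d\<^sup>2"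
proof -
  have "(f x *\<^sub>R a1 + g x *\<^sub>R a2) \<bullet> (f' x *\<^sub>R a1 + g' x *\<^sub>R a2) =
      ((c\<^sup>2 + d\<^sup>2) / d\<^sup>2) * (f x * f' x) + (- c / d\<^sup>2) * (f x * g' x) + ((- c / d\<^sup>2) * (g x * f' x) + (1 / d\<^sup>2) * (g x * g' x))" for x
    by (simp add: inner_add_left inner_add_right a_inner algebra_simps)
  then have "DA (u, \<lambda>x. f x *\<^sub>R a1 + g x *\<^sub>R a2) (v, \<lambda>x. f' x *\<^sub>R a1 + g' x *\<^sub>R a2) =
     ((c\<^sup>2 + d\<^sup>2) / d\<^sup>2) * (LINT x|M. f x * f' x) + (- c / d\<^sup>2) * (LINT x|M. f x * g' x)
     + ((- c / d\<^sup>2) * (LINT x|M. g x * f' x) + (1 / d\<^sup>2) * (LINT x|M. g x * g' x))"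
    unfolding DA_def using assms by simp
  also have "(P / D) * i + (- c / D) * j + ((- c / D) * k + (1 / D) * l) = (P * i - c * (j + k) + l) / D" for P D i j k l :: real
    by (simp add: diff_divide_distrib add_divide_distrib distrib_left)
  finally show ?thesis .
qed


section \<open>Trial functions from the cosine basis, with L and M as Gram matrices\<close>

definition ebV :: "nat \<times> nat \<Rightarrow> (real \<times> real \<Rightarrow> real) \<times> (real \<times> real \<Rightarrow> real \<times> real)" where
  "ebV p = (eb p, \<lambda>x. (- (real (fst p) * pi) * eb1 p x) *\<^sub>R a1 + (- (real (snd p) * pi) * eb2 p x) *\<^sub>R a2)"

lemma ebV_in_V: "ebV p \<in> V"
  unfolding ebV_def
proof (rule C1_in_V)
  show "continuous_on UNIV (\<lambda>x. (- (real (fst p) * pi) * eb1 p x) *\<^sub>R a1 + (- (real (snd p) * pi) * eb2 p x) *\<^sub>R a2)"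
    unfolding eb1_def eb2_def by (intro continuous_intros)
  fix x
  show "(eb p has_derivative (\<lambda>h. ((- (real (fst p) * pi) * eb1 p x) *\<^sub>R a1 + (- (real (snd p) * pi) * eb2 p x) *\<^sub>R a2) \<bullet> h)) (at x)"
    unfolding eb_def[abs_def] eb1_def eb2_def
    by (auto intro!: derivative_eq_intros simp: inner_add_left inner_commute[of a1] inner_commute[of a2] algebra_simps)
qed

lemma DB_ebV: "DB (ebV p) (ebV q) = (if p = q then nrm p else 0)"
  by (simp add: DB_def ebV_def eb_orth)

lemma mean_ebV: "p \<noteq> (0, 0) \<Longrightarrow> (LINT x|M. fst (ebV p) x) = 0"
  using eb_orth[of p "(0, 0)"] by (simp add: ebV_def eb_def[of "(0, 0)"])

text \<open>These integrals produce the off-diagonal entries. The value 2 / pi, taken twice, gives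
  the 8 in L; the product of 4 / (3 pi) and 2 / pi gives the coupling in M.\<close>

definition sincos :: "nat \<Rightarrow> nat \<Rightarrow> real" where
  "sincos m n = integral {0..1} (\<lambda>s. sin (real m * pi * s) * cos (real n * pi * s))"

lemma sincos_values: "sincos (Suc 0) 0 = 2 / pi" "sincos (Suc 0) (Suc 0) = 0" "sincos 2 (Suc 0) = 4 / (3 * pi)"
proof -
  show "sincos (Suc 0) 0 = 2 / pi"
    using integral_sin_affine[of pi 0] by (simp add: sincos_def)
  have "sincos (Suc 0) (Suc 0) = integral {0..1} (\<lambda>s. sin (2 * pi * s) / 2)"
    unfolding sincos_def by (rule arg_cong[where f = "integral {0..1}"], rule ext) (simp add: sin_double mult.assoc)
  then show "sincos (Suc 0) (Suc 0) = 0"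
    using integral_sin_affine[of "2 * pi" 0] by simp
  have "sin (2 * pi * s) * cos (pi * s) = (sin (3 * pi * s + 0) + sin (pi * s + 0)) / 2" for s
    using sin_times_cos[of "2 * pi * s" "pi * s"] by (simp add: algebra_simps)
  then have "sincos 2 (Suc 0) = integral {0..1} (\<lambda>s. (sin (3 * pi * s + 0) + sin (pi * s + 0)) / 2)"
    unfolding sincos_def by (intro arg_cong[where f = "integral {0..1}"] ext) simp
  also have "\<dots> = (integral {0..1} (\<lambda>s. sin (3 * pi * s + 0)) + integral {0..1} (\<lambda>s. sin (pi * s + 0))) / 2"
    by (subst integral_divide, subst Henstock_Kurzweil_Integration.integral_add)
       (auto intro!: integrable_continuous_real continuous_intros)
  also have "\<dots> = (2 / (3 * pi) + 2 / pi) / 2"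
    using integral_sin_affine[of pi 0] integral_sin_affine[of "3 * pi" 0] by simp
  finally show "sincos 2 (Suc 0) = 4 / (3 * pi)" by (simp add: field_simps)
qed

lemma eb1_eb2: "(LINT x|M. eb1 p x * eb2 q x) = d * (sincos (fst p) (fst q) * sincos (snd q) (snd p))"
proof -
  have "(LINT x|M. eb1 p x * eb2 q x) = (LINT x|M.
     (\<lambda>s. sin (real (fst p) * pi * s) * cos (real (fst q) * pi * s)) (x \<bullet> a1)
     * (\<lambda>t. sin (real (snd q) * pi * t) * cos (real (snd p) * pi * t)) (x \<bullet> a2))"
    by (simp add: eb1_def eb2_def mult_ac)
  also have "\<dots> = d * (sincos (fst p) (fst q) * sincos (snd q) (snd p))"
    unfolding sincos_def by (intro integral_product continuous_intros)
  finally show ?thesis .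
qed

lemma DA_ebV:
  "DA (ebV p) (ebV q) = pi\<^sup>2 / d\<^sup>2 * ((c\<^sup>2 + d\<^sup>2) * (real (fst p) * real (fst q) * (LINT x|M. eb1 p x * eb1 q x))
     - c * (real (fst p) * real (snd q) * (LINT x|M. eb1 p x * eb2 q x) + real (snd p) * real (fst q) * (LINT x|M. eb1 q x * eb2 p x))
     + real (snd p) * real (snd q) * (LINT x|M. eb2 p x * eb2 q x))"
proof -
  have i: "integrable M (\<lambda>x. (a * e x) * (b * f x))" if "sqint M e" "sqint M f" for a b and e f :: "_ \<Rightarrow> real"
    using integrable_mult_right[OF sqint_real_mult[OF that], of "a * b"] by (simp add: mult_ac)
  have I: "(LINT x|M. (a * e x) * (b * f x)) = a * b * (LINT x|M. e x * f x)" for a b and e f :: "_ \<Rightarrow> real"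
    by (simp add: mult_ac flip: integral_mult_right_zero)
  have c: "(LINT x|M. eb2 p x * eb1 q x) = (LINT x|M. eb1 q x * eb2 p x)" by (simp add: mult.commute)
  have "DA (ebV p) (ebV q) = ((c\<^sup>2 + d\<^sup>2) * (LINT x|M. (- (real (fst p) * pi) * eb1 p x) * (- (real (fst q) * pi) * eb1 q x))
     - c * ((LINT x|M. (- (real (fst p) * pi) * eb1 p x) * (- (real (snd q) * pi) * eb2 q x))
         + (LINT x|M. (- (real (snd p) * pi) * eb2 p x) * (- (real (fst q) * pi) * eb1 q x)))
     + (LINT x|M. (- (real (snd p) * pi) * eb2 p x) * (- (real (snd q) * pi) * eb2 q x))) / d\<^sup>2"
    unfolding ebV_def by (intro gradient_form i eb_sqint)
  also have "\<dots> = (pi\<^sup>2 * ((c\<^sup>2 + d\<^sup>2) * (real (fst p) * real (fst q) * (LINT x|M. eb1 p x * eb1 q x))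
     - c * (real (fst p) * real (snd q) * (LINT x|M. eb1 p x * eb2 q x) + real (snd p) * real (fst q) * (LINT x|M. eb1 q x * eb2 p x))
     + real (snd p) * real (snd q) * (LINT x|M. eb2 p x * eb2 q x))) / d\<^sup>2"
    unfolding I c by (rule arg_cong[where f = "\<lambda>y. y / d\<^sup>2"]) algebra
  finally show ?thesis by simp
qed

text \<open>The modes \<open>(1, 0)\<close> and \<open>(0, 1)\<close>, both of squared norm
  \<open>d / 2\<close>, have L as their normalised energy matrix.\<close>

lemma third_eigenvalue_L:
  assumes T: "0 < T"
  shows "(\<And>x y. x \<noteq> 0 \<or> y \<noteq> 0 \<Longrightarrow> pi\<^sup>2 * ((c\<^sup>2 + d\<^sup>2) * x\<^sup>2 + y\<^sup>2) - 16 * c * x * y < T * d\<^sup>2 * (x\<^sup>2 + y\<^sup>2))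
      \<Longrightarrow> neumann_eigenvalue \<Omega> 3 < T"
    and "(\<And>x y. x \<noteq> 0 \<or> y \<noteq> 0 \<Longrightarrow> pi\<^sup>2 * ((c\<^sup>2 + d\<^sup>2) * x\<^sup>2 + y\<^sup>2) - 16 * c * x * y \<le> T * d\<^sup>2 * (x\<^sup>2 + y\<^sup>2))
      \<Longrightarrow> neumann_eigenvalue \<Omega> 3 \<le> T"
proof -
  let ?p = "ebV (1, 0)" and ?q = "ebV (0, 1)"
  have B: "DB ?p ?p = d / 2" "DB ?p ?q = 0" "DB ?q ?q = d / 2" by (auto simp: DB_ebV nrm_def)
  have A: "DA ?p ?p = pi\<^sup>2 * (c\<^sup>2 + d\<^sup>2) / (2 * d)" "DA ?p ?q = - 4 * c / d" "DA ?q ?q = pi\<^sup>2 / (2 * d)"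
    using d_pos by (simp_all add: DA_ebV eb1_orth eb2_orth eb1_eb2 sincos_values nrm_def power2_eq_square)
  have Bf: "a\<^sup>2 * DB ?p ?p + 2 * a * b * DB ?p ?q + b\<^sup>2 * DB ?q ?q = d / 2 * (a\<^sup>2 + b\<^sup>2)" for a b
    unfolding B by (simp add: algebra_simps)
  have Af: "a\<^sup>2 * DA ?p ?p + 2 * a * b * DA ?p ?q + b\<^sup>2 * DA ?q ?q
      = (pi\<^sup>2 * ((c\<^sup>2 + d\<^sup>2) * a\<^sup>2 + b\<^sup>2) - 16 * c * a * b) / (2 * d)" for a b
    unfolding A using d_pos by (simp add: field_simps)
  have Tf: "T * (d / 2 * (a\<^sup>2 + b\<^sup>2)) = T * d\<^sup>2 * (a\<^sup>2 + b\<^sup>2) / (2 * d)" for a b :: real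
    using d_pos by (simp add: power2_eq_square)
  have pos: "0 < d / 2 * (a\<^sup>2 + b\<^sup>2)" if "a \<noteq> 0 \<or> b \<noteq> 0" for a b
    using that d_pos by (simp add: sum_power2_gt_zero_iff)
  note bound = third_eigenvalue_bound[OF ebV_in_V[of "(1, 0)"] ebV_in_V[of "(0, 1)"] mean_ebV mean_ebV _ T, unfolded Bf Af Tf]
  show "neumann_eigenvalue \<Omega> 3 < T"
    if less: "\<And>x y. x \<noteq> 0 \<or> y \<noteq> 0 \<Longrightarrow> pi\<^sup>2 * ((c\<^sup>2 + d\<^sup>2) * x\<^sup>2 + y\<^sup>2) - 16 * c * x * y < T * d\<^sup>2 * (x\<^sup>2 + y\<^sup>2)"
  proof (rule bound(1))
    show "(pi\<^sup>2 * ((c\<^sup>2 + d\<^sup>2) * a\<^sup>2 + b\<^sup>2) - 16 * c * a * b) / (2 * d) < T * d\<^sup>2 * (a\<^sup>2 + b\<^sup>2) / (2 * d)"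
      if ab: "a \<noteq> 0 \<or> b \<noteq> 0" for a b
      using less[OF ab] d_pos by (intro divide_strict_right_mono) auto
  qed (use pos in auto)
  show "neumann_eigenvalue \<Omega> 3 \<le> T"
    if le: "\<And>x y. x \<noteq> 0 \<or> y \<noteq> 0 \<Longrightarrow> pi\<^sup>2 * ((c\<^sup>2 + d\<^sup>2) * x\<^sup>2 + y\<^sup>2) - 16 * c * x * y \<le> T * d\<^sup>2 * (x\<^sup>2 + y\<^sup>2)"
  proof (rule bound(2))
    show "(pi\<^sup>2 * ((c\<^sup>2 + d\<^sup>2) * a\<^sup>2 + b\<^sup>2) - 16 * c * a * b) / (2 * d) \<le> T * d\<^sup>2 * (a\<^sup>2 + b\<^sup>2) / (2 * d)"
      if ab: "a \<noteq> 0 \<or> b \<noteq> 0" for a b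
      using le[OF ab] d_pos by (intro divide_right_mono) auto
  qed (use pos in auto)
qed

text \<open>The mode \<open>(1, 0)\<close>, with energy \<open>L11\<close>, is paired with a
  combination of \<open>(1, 1)\<close> and \<open>(2, 0)\<close>. Under the central symmetry the
  first is odd and the others are even, so the mixed terms vanish and the two quotients are compared
  with \<open>T\<close> separately.\<close>

lemma third_eigenvalue_M:
  assumes T: "0 < T" and L11: "pi\<^sup>2 * (c\<^sup>2 + d\<^sup>2) < T * d\<^sup>2" and xy: "x \<noteq> 0 \<or> y \<noteq> 0"
    and M: "pi\<^sup>2 * ((1 + (c\<^sup>2 + d\<^sup>2)) * x\<^sup>2 + 4 * (c\<^sup>2 + d\<^sup>2) * y\<^sup>2) - 64 * sqrt 2 / 3 * c * x * y < T * d\<^sup>2 * (x\<^sup>2 + y\<^sup>2)"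
  shows "neumann_eigenvalue \<Omega> 3 < T"
proof -
  let ?p = "ebV (1, 0)" and ?f = "ebV (1, 1)" and ?g = "ebV (2, 0)"
  \<comment> \<open>The squared norms of the two modes are \<open>d / 4\<close> and
    \<open>d / 2\<close>; the factors 2 and \<open>sqrt 2\<close> bring both to \<open>d\<close>, so
    that \<open>x\<close> and \<open>y\<close> are coordinates with respect to M.\<close>
  define q where "q = pair_lin (2 * x) ?f (sqrt 2 * y) ?g"
  have qV: "q \<in> V" unfolding q_def by (intro lin_closed ebV_in_V)
  have B: "DB ?p ?p = d / 2" "DB ?p q = 0" "DB q q = d * (x\<^sup>2 + y\<^sup>2)"
    unfolding q_def
    by (auto simp: B_lin2 B_square ebV_in_V DB_ebV nrm_def power_mult_distrib algebra_simps)
  have A1: "DA ?p ?p = pi\<^sup>2 * (c\<^sup>2 + d\<^sup>2) / (2 * d)" "DA ?p ?f = 0" "DA ?p ?g = 0"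
    "DA ?f ?f = pi\<^sup>2 * (1 + (c\<^sup>2 + d\<^sup>2)) / (4 * d)" "DA ?f ?g = - (16 * c) / (3 * d)" "DA ?g ?g = 2 * pi\<^sup>2 * (c\<^sup>2 + d\<^sup>2) / d"
    using d_pos
    by (simp_all add: DA_ebV eb1_orth eb2_orth eb1_eb2 sincos_values nrm_def power2_eq_square) (simp_all add: field_simps)
  have A: "DA ?p q = 0" "DA q q = (pi\<^sup>2 * ((1 + (c\<^sup>2 + d\<^sup>2)) * x\<^sup>2 + 4 * (c\<^sup>2 + d\<^sup>2) * y\<^sup>2) - 64 * sqrt 2 / 3 * c * x * y) / d"
    unfolding q_def using d_pos
    by (simp_all add: A_lin2 A_square ebV_in_V A1 power_mult_distrib del: One_nat_def) (simp add: field_simps)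
  have mean: "(LINT z|M. fst q z) = 0"
  proof -
    have "(LINT z|M. fst q z) = (LINT z|M. 2 * x * fst ?f z + sqrt 2 * y * fst ?g z)" by (simp add: q_def pair_lin_def)
    also have "\<dots> = 2 * x * (LINT z|M. fst ?f z) + sqrt 2 * y * (LINT z|M. fst ?g z)"
      using sqint_integrable[OF V_sqint(1)[OF ebV_in_V]] by simp
    finally show ?thesis by (simp add: mean_ebV)
  qed
  have xy2: "0 < x\<^sup>2 + y\<^sup>2" using xy by (simp add: sum_power2_gt_zero_iff)
  have Aq: "DA q q < T * (d * (x\<^sup>2 + y\<^sup>2))"
    unfolding A using M d_pos by (simp add: divide_less_eq power2_eq_square mult_ac)
  have Ap: "DA ?p ?p < T * (d / 2)"
  proof -
    have "pi\<^sup>2 * (c\<^sup>2 + d\<^sup>2) / (2 * d) < T * d\<^sup>2 / (2 * d)"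
      using L11 d_pos by (intro divide_strict_right_mono) auto
    also have "\<dots> = T * (d / 2)" using d_pos by (simp add: power2_eq_square)
    finally show ?thesis unfolding A1 .
  qed
  show ?thesis
  proof (rule third_eigenvalue_bound(1)[OF ebV_in_V qV mean_ebV mean _ T])
    fix a b :: real assume ab: "a \<noteq> 0 \<or> b \<noteq> 0"
    show "0 < a\<^sup>2 * DB ?p ?p + 2 * a * b * DB ?p q + b\<^sup>2 * DB q q"
      unfolding B using ab d_pos xy2 by (cases "a = 0") (auto intro: add_pos_nonneg)
    show "a\<^sup>2 * DA ?p ?p + 2 * a * b * DA ?p q + b\<^sup>2 * DA q q < T * (a\<^sup>2 * DB ?p ?p + 2 * a * b * DB ?p q + b\<^sup>2 * DB q q)"
    proof -
      have "a\<^sup>2 * DA ?p ?p + b\<^sup>2 * DA q q < a\<^sup>2 * (T * (d / 2)) + b\<^sup>2 * (T * (d * (x\<^sup>2 + y\<^sup>2)))"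
      proof (cases "a = 0")
        case True
        then show ?thesis using ab Aq by simp
      next
        case False
        then show ?thesis using Ap Aq
          by (intro add_less_le_mono mult_strict_left_mono mult_left_mono) auto
      qed
      then show ?thesis unfolding A(1) B by (simp add: algebra_simps)
    qed
  qed simp
qed

section \<open>Trial functions along the long diagonal\<close>

lemma integral_cos_linear:
  fixes a b :: real
  assumes "a \<noteq> 0" "b \<noteq> 0"
  shows "(LINT x|M. cos (a * (x \<bullet> a1) + b * (x \<bullet> a2))) = d * ((sin a * sin b - (1 - cos a) * (1 - cos b)) / (a * b))"
proof -
  have i: "integrable M (\<lambda>x. cos (a * (x \<bullet> a1)) * cos (b * (x \<bullet> a2)))" "integrable M (\<lambda>x. sin (a * (x \<bullet> a1)) * sin (b * (x \<bullet> a2)))"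
    by (intro sqint_integrable continuous_sqint_M continuous_intros)+
  have "(LINT x|M. cos (a * (x \<bullet> a1) + b * (x \<bullet> a2)))
     = (LINT x|M. (\<lambda>s. cos (a * s + 0)) (x \<bullet> a1) * (\<lambda>s. cos (b * s + 0)) (x \<bullet> a2))
       - (LINT x|M. (\<lambda>s. sin (a * s + 0)) (x \<bullet> a1) * (\<lambda>s. sin (b * s + 0)) (x \<bullet> a2))"
    using i by (simp add: cos_add)
  also have "\<dots> = d * (integral {0..1} (\<lambda>s. cos (a * s + 0)) * integral {0..1} (\<lambda>s. cos (b * s + 0)))
     - d * (integral {0..1} (\<lambda>s. sin (a * s + 0)) * integral {0..1} (\<lambda>s. sin (b * s + 0)))"
    by (intro arg_cong2[of _ _ _ _ "(-)"] integral_product continuous_intros)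
  also have "\<dots> = d * ((sin a * sin b - (1 - cos a) * (1 - cos b)) / (a * b))"
    unfolding integral_cos_affine[OF assms(1)] integral_cos_affine[OF assms(2)]
      integral_sin_affine[OF assms(1)] integral_sin_affine[OF assms(2)]
    using assms by (simp add: field_simps)
  finally show ?thesis .
qed

text \<open>Trial functions that depend only on the projection to the long diagonal replace Kroeger's
  bound on the third eigenvalue.\<close>

lemma third_eigenvalue_diagonal:
  assumes c: "0 \<le> c" and le: "c\<^sup>2 + d\<^sup>2 \<le> 1" and T: "64 < T * ((1 + c)\<^sup>2 + d\<^sup>2)"
  shows "neumann_eigenvalue \<Omega> 3 < T"
proof -
  define D where "D = (1 + c)\<^sup>2 + d\<^sup>2"
  have D: "0 < D" using d_pos by (simp add: D_def add_nonneg_pos)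
  have T0: "0 < T" using T D unfolding D_def[symmetric] by (smt (verit) zero_less_mult_iff)
  \<comment> \<open>These are the values of \<open>x \<bullet> v\<close> at the vertices (1, 0) and
    (c, d), when \<open>v\<close> points along the long diagonal and is scaled so that
    \<open>x \<bullet> v\<close> runs from 0 to 1 along it. The hypothesis on \<open>c\<close> and
    \<open>d\<close> is what orders them.\<close>
  define \<alpha> \<beta> where "\<alpha> = (1 + c) / D" and "\<beta> = (c + (c\<^sup>2 + d\<^sup>2)) / D"
  have \<beta>0: "0 < \<beta>" using c d_pos D by (auto simp: \<beta>_def intro!: divide_pos_pos add_nonneg_pos)
  have \<beta>\<alpha>: "\<beta> \<le> \<alpha>" unfolding \<beta>_def \<alpha>_def using D le by (intro divide_right_mono) auto
  have \<alpha>\<beta>: "\<alpha> + \<beta> = 1" using D by (simp add: \<alpha>_def \<beta>_def D_def add_divide_distrib[symmetric] power2_sum algebra_simps)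
  have \<alpha>0: "0 < \<alpha>" using \<beta>0 \<beta>\<alpha> by simp
  define z m where "z = (sin (pi * \<alpha>))\<^sup>2" and "m = (sin (pi * \<alpha>))\<^sup>2 / (pi\<^sup>2 * \<alpha> * \<beta>)"
  note tb = trig_rayleigh_bound[OF \<beta>0 \<beta>\<alpha> \<alpha>\<beta>, folded z_def m_def]
  define v where "v = \<alpha> *\<^sub>R a1 + \<beta> *\<^sub>R a2"
  have v: "v = (1 / D) *\<^sub>R (1 + c, d)"
    using d_pos D by (simp add: v_def \<alpha>_def \<beta>_def a1_def a2_def field_simps power2_eq_square)
  have vv: "v \<bullet> v = 1 / D"
  proof -
    have "(1 + c, d) \<bullet> (1 + c, d) = D" by (simp add: D_def power2_eq_square)
    then show ?thesis unfolding v inner_scaleR_left inner_scaleR_right using D by simp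
  qed
  have xv: "x \<bullet> v = \<alpha> * (x \<bullet> a1) + \<beta> * (x \<bullet> a2)" for x by (simp add: v_def inner_add_right)
  \<comment> \<open>By the product-to-sum formulas all entries of both Gram matrices reduce to these
    moments. The central symmetry replaces \<open>x \<bullet> v\<close> by
    \<open>1 - x \<bullet> v\<close>, which is why the moments with odd \<open>k\<close>
    vanish.\<close>
  define J where "J k = (LINT x|M. cos (k * pi * (x \<bullet> v)))" for k :: real
  have J: "J k = d * ((sin (k * pi * \<alpha>) * sin (k * pi - k * pi * \<alpha>) - (1 - cos (k * pi * \<alpha>)) * (1 - cos (k * pi - k * pi * \<alpha>)))
      / (k\<^sup>2 * (pi\<^sup>2 * \<alpha> * \<beta>)))" if "k \<noteq> 0" for k
  proof -
    have b: "k * pi * \<beta> = k * pi - k * pi * \<alpha>"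
    proof -
      have "\<beta> = 1 - \<alpha>" using \<alpha>\<beta> by simp
      then show ?thesis by (simp add: right_diff_distrib)
    qed
    have "J k = (LINT x|M. cos ((k * pi * \<alpha>) * (x \<bullet> a1) + (k * pi * \<beta>) * (x \<bullet> a2)))"
      by (simp add: J_def xv distrib_left mult.assoc)
    also have "\<dots> = d * ((sin (k * pi * \<alpha>) * sin (k * pi * \<beta>) - (1 - cos (k * pi * \<alpha>)) * (1 - cos (k * pi * \<beta>))) / ((k * pi * \<alpha>) * (k * pi * \<beta>)))"
      using \<alpha>0 \<beta>0 that by (intro integral_cos_linear) auto
    also have "(k * pi * \<alpha>) * (k * pi * \<beta>) = k\<^sup>2 * (pi\<^sup>2 * \<alpha> * \<beta>)" by (simp add: power2_eq_square)
    finally show ?thesis unfolding b .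
  qed
  have sc: "(sin t)\<^sup>2 = 1 - (cos t)\<^sup>2" for t :: real by (simp add: sin_squared_eq)
  have J1: "J 1 = 0"
    unfolding J[OF one_neq_zero] by (simp add: sc power2_eq_square[symmetric] algebra_simps)
  have J3: "J 3 = 0"
  proof -
    have s: "sin (3 * pi - t) = sin t" "cos (3 * pi - t) = - cos t" for t
    proof -
      have e: "3 * pi - t = (pi - t) + 2 * pi" by simp
      show "sin (3 * pi - t) = sin t" "cos (3 * pi - t) = - cos t"
        unfolding e by (simp_all only: sin_periodic cos_periodic sin_pi_minus cos_pi_minus)
    qed
    have "J 3 = d * ((sin (3 * pi * \<alpha>) * sin (3 * pi * \<alpha>) - (1 - cos (3 * pi * \<alpha>)) * (1 + cos (3 * pi * \<alpha>)))
      / (3\<^sup>2 * (pi\<^sup>2 * \<alpha> * \<beta>)))" by (subst J) (simp_all add: s)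
    then show ?thesis by (simp add: sc power2_eq_square[symmetric] algebra_simps)
  qed
  have half: "- (sin (2 * t))\<^sup>2 - (1 - cos (2 * t))\<^sup>2 = - 4 * (sin t)\<^sup>2" for t :: real
  proof -
    have "cos (2 * t) = 1 - 2 * (sin t)\<^sup>2" by (rule cos_double_sin)
    moreover have "(sin (2 * t))\<^sup>2 = 1 - (cos (2 * t))\<^sup>2" by (rule sc)
    ultimately show ?thesis by (simp add: power2_eq_square algebra_simps)
  qed
  have J2: "J 2 = - m * d"
  proof -
    have "J 2 = d * ((- (sin (2 * (pi * \<alpha>)))\<^sup>2 - (1 - cos (2 * (pi * \<alpha>)))\<^sup>2) / (2\<^sup>2 * (pi\<^sup>2 * \<alpha> * \<beta>)))"
      by (subst J) (simp_all add: power2_eq_square mult.assoc)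
    then show ?thesis unfolding half by (simp add: m_def)
  qed
  have J4: "J 4 = - (m * (1 - z)) * d"
  proof -
    have s: "sin (4 * pi - t) = - sin t" "cos (4 * pi - t) = cos t" for t
    proof -
      have e: "4 * pi - t = (2 * pi - t) + 2 * pi" by simp
      show "sin (4 * pi - t) = - sin t" "cos (4 * pi - t) = cos t"
        unfolding e by (simp_all only: sin_periodic cos_periodic sin_2pi_minus cos_2pi_minus)
    qed
    have "J 4 = d * ((- (sin (4 * pi * \<alpha>))\<^sup>2 - (1 - cos (4 * pi * \<alpha>))\<^sup>2) / (4\<^sup>2 * (pi\<^sup>2 * \<alpha> * \<beta>)))"
      by (subst J) (simp_all add: s power2_eq_square)
    also have "4 * pi * \<alpha> = 2 * (2 * (pi * \<alpha>))" by simp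
    finally have "J 4 = d * (- 4 * (sin (2 * (pi * \<alpha>)))\<^sup>2 / (4\<^sup>2 * (pi\<^sup>2 * \<alpha> * \<beta>)))" unfolding half .
    moreover have "(sin (2 * (pi * \<alpha>)))\<^sup>2 = 4 * z * (1 - z)"
      unfolding sin_double z_def by (simp add: power_mult_distrib cos_squared_eq)
    ultimately show ?thesis by (simp add: m_def z_def)
  qed
  have ci: "integrable M (\<lambda>x. cos (k * pi * (x \<bullet> v)))" for k :: real
    by (intro sqint_integrable continuous_sqint_M continuous_intros)
  have cci: "integrable M (\<lambda>x. cos (k * pi * (x \<bullet> v)) * cos (l * pi * (x \<bullet> v)))" for k l :: real
    by (intro sqint_integrable continuous_sqint_M continuous_intros)
  have cc: "(LINT x|M. cos (k * pi * (x \<bullet> v)) * cos (l * pi * (x \<bullet> v))) = (J (k - l) + J (k + l)) / 2" for k l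
  proof -
    have eq: "cos (k * pi * (x \<bullet> v)) * cos (l * pi * (x \<bullet> v)) = (cos ((k - l) * pi * (x \<bullet> v)) + cos ((k + l) * pi * (x \<bullet> v))) / 2" for x
      by (simp add: cos_times_cos algebra_simps)
    show ?thesis unfolding eq using ci by (simp add: J_def)
  qed
  have ss: "(LINT x|M. sin (k * pi * (x \<bullet> v)) * sin (l * pi * (x \<bullet> v))) = (J (k - l) - J (k + l)) / 2" for k l
  proof -
    have eq: "sin (k * pi * (x \<bullet> v)) * sin (l * pi * (x \<bullet> v)) = (cos ((k - l) * pi * (x \<bullet> v)) - cos ((k + l) * pi * (x \<bullet> v))) / 2" for x
      by (simp add: sin_times_sin algebra_simps)
    show ?thesis unfolding eq using ci by (simp add: J_def)
  qed
  have J0: "J 0 = d" using integral_one by (simp add: J_def)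
  have Jm1: "J (- 1) = 0" using J1 by (simp add: J_def)
  define p where "p = (\<lambda>x. cos (1 * pi * (x \<bullet> v)), \<lambda>x. (- pi * sin (1 * pi * (x \<bullet> v))) *\<^sub>R v)"
  \<comment> \<open>The integral \<open>J 2\<close> is \<open>- m * d\<close> and the domain has
    area \<open>d\<close>, so the constant \<open>m\<close> restores mean zero. As
    \<open>J 1\<close> and \<open>J 3\<close> vanish, \<open>p\<close> and \<open>q\<close> are
    orthogonal for both forms.\<close>
  define q where "q = (\<lambda>x. cos (2 * pi * (x \<bullet> v)) + m, \<lambda>x. (- 2 * pi * sin (2 * pi * (x \<bullet> v))) *\<^sub>R v)"
  have pV: "p \<in> V" unfolding p_def
    by (rule C1_in_V) (auto intro!: derivative_eq_intros continuous_intros simp: inner_commute)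
  have qV: "q \<in> V" unfolding q_def
    by (rule C1_in_V) (auto intro!: derivative_eq_intros continuous_intros simp: inner_commute)
  have mp: "(LINT x|M. fst p x) = 0" using J1 by (simp add: p_def J_def)
  have mq: "(LINT x|M. fst q x) = 0" using J2 ci[of 2] integral_one by (simp add: q_def J_def)
  have Bpp: "DB p p = d * (1 - m) / 2"
    using cc[of 1 1] J0 J2 by (simp add: DB_def p_def algebra_simps)
  have Bpq: "DB p q = 0"
  proof -
    have "DB p q = (LINT x|M. cos (1 * pi * (x \<bullet> v)) * cos (2 * pi * (x \<bullet> v)) + m * cos (1 * pi * (x \<bullet> v)))"
      by (simp add: DB_def p_def q_def algebra_simps)
    also have "\<dots> = (LINT x|M. cos (1 * pi * (x \<bullet> v)) * cos (2 * pi * (x \<bullet> v))) + m * (LINT x|M. cos (1 * pi * (x \<bullet> v)))"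
      by (subst Bochner_Integration.integral_add[OF cci integrable_mult_right[OF ci]]) (rule arg_cong[OF integral_mult_right_zero])
    finally show ?thesis unfolding cc J_def[symmetric] using J1 J3 Jm1 by simp
  qed
  have Bqq: "DB q q = d * ((1 - m * (1 - z)) / 2 - m\<^sup>2)"
  proof -
    have "DB q q = (LINT x|M. cos (2 * pi * (x \<bullet> v)) * cos (2 * pi * (x \<bullet> v)) + (2 * m * cos (2 * pi * (x \<bullet> v)) + m\<^sup>2))"
      by (simp add: DB_def q_def power2_eq_square algebra_simps)
    also have "\<dots> = (LINT x|M. cos (2 * pi * (x \<bullet> v)) * cos (2 * pi * (x \<bullet> v))) + (2 * m * (LINT x|M. cos (2 * pi * (x \<bullet> v))) + m\<^sup>2 * d)"
      using cci[of 2 2] ci[of 2] integral_one by simp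
    finally show ?thesis unfolding cc J_def[symmetric] using J0 J2 J4 by (simp add: power2_eq_square algebra_simps)
  qed
  have App: "DA p p = pi\<^sup>2 / D * (d * (1 + m) / 2)"
  proof -
    have "DA p p = pi\<^sup>2 * (v \<bullet> v) * (LINT x|M. sin (1 * pi * (x \<bullet> v)) * sin (1 * pi * (x \<bullet> v)))"
      by (simp add: DA_def p_def power2_eq_square mult_ac flip: integral_mult_right_zero)
    then show ?thesis unfolding ss vv using J0 J2 by (simp add: algebra_simps)
  qed
  have Apq: "DA p q = 0"
  proof -
    have "DA p q = 2 * pi\<^sup>2 * (v \<bullet> v) * (LINT x|M. sin (1 * pi * (x \<bullet> v)) * sin (2 * pi * (x \<bullet> v)))"
      by (simp add: DA_def p_def q_def power2_eq_square mult_ac flip: integral_mult_right_zero)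
    then show ?thesis unfolding ss using J3 Jm1 by simp
  qed
  have Aqq: "DA q q = 4 * pi\<^sup>2 / D * (d * (1 + m * (1 - z)) / 2)"
  proof -
    have "DA q q = 4 * pi\<^sup>2 * (v \<bullet> v) * (LINT x|M. sin (2 * pi * (x \<bullet> v)) * sin (2 * pi * (x \<bullet> v)))"
      by (simp add: DA_def q_def power2_eq_square mult_ac flip: integral_mult_right_zero)
    then show ?thesis unfolding ss vv using J0 J4 by (simp add: algebra_simps)
  qed
  have TD: "64 / D < T" using T D by (simp add: D_def[symmetric] divide_less_eq)
  \<comment> \<open>Four times the last estimate of \<open>trig_rayleigh_bound\<close>, rearranged
    as energy of \<open>q\<close> against 64 times its norm; it also shows that this norm is
    positive.\<close>
  have "4 * pi\<^sup>2 * (1 + m * (1 - z)) < 64 * (1 - m * (1 - z) - 2 * m\<^sup>2)"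
    using tb(5) by (simp add: algebra_simps)
  moreover have "0 \<le> pi\<^sup>2 * (1 + m * (1 - z))" using tb by simp
  ultimately have S: "0 < 1 - m * (1 - z) - 2 * m\<^sup>2" by (simp add: algebra_simps)
  have Bq0: "0 < DB q q" unfolding Bqq using S d_pos by (intro mult_pos_pos) auto
  have Bp0: "0 < DB p p" unfolding Bpp using tb(2) d_pos by simp
  have Aq: "DA q q < T * DB q q"
  proof -
    have "DA q q = (4 * pi\<^sup>2 * (1 + m * (1 - z))) * (d / (2 * D))" unfolding Aqq by simp
    also have "\<dots> < (64 * (1 - m * (1 - z) - 2 * m\<^sup>2)) * (d / (2 * D))"
      using \<open>4 * pi\<^sup>2 * (1 + m * (1 - z)) < _\<close> d_pos D by (intro mult_strict_right_mono) auto
    also have "\<dots> = 64 / D * DB q q" unfolding Bqq using D by (simp add: field_simps)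
    also have "\<dots> < T * DB q q" using TD Bq0 by (rule mult_strict_right_mono)
    finally show ?thesis .
  qed
  have Ap: "DA p p < T * DB p p"
  proof -
    \<comment> \<open>The quotient of \<open>p\<close> is far from critical: about 13.9 against
      38.\<close>
    have "pi\<^sup>2 * (1 + m) \<le> 9.8697 * 1.406" using tb(1,2) pi_sq_bounds by (intro mult_mono) auto
    also have "\<dots> < 64 * (1 - m)" using tb(2) by simp
    finally have "pi\<^sup>2 * (1 + m) * (d / (2 * D)) < 64 * (1 - m) * (d / (2 * D))"
      using d_pos D by (intro mult_strict_right_mono) auto
    then have "DA p p < 64 / D * DB p p" unfolding App Bpp using D by (simp add: field_simps)
    also have "\<dots> < T * DB p p" using TD Bp0 by (rule mult_strict_right_mono)
    finally show ?thesis .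
  qed
  show ?thesis
  proof (rule third_eigenvalue_bound(1)[OF pV qV mp mq _ T0])
    fix a b :: real assume ab: "a \<noteq> 0 \<or> b \<noteq> 0"
    show "0 < a\<^sup>2 * DB p p + 2 * a * b * DB p q + b\<^sup>2 * DB q q"
      unfolding Bpq using ab Bp0 Bq0 by (cases "a = 0") (auto intro: add_pos_nonneg)
    show "a\<^sup>2 * DA p p + 2 * a * b * DA p q + b\<^sup>2 * DA q q < T * (a\<^sup>2 * DB p p + 2 * a * b * DB p q + b\<^sup>2 * DB q q)"
    proof -
      have "a\<^sup>2 * DA p p + b\<^sup>2 * DA q q < a\<^sup>2 * (T * DB p p) + b\<^sup>2 * (T * DB q q)"
      proof (cases "a = 0")
        case True
        then show ?thesis using ab Aq by simp
      next
        case False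
        then show ?thesis using Ap Aq
          by (intro add_less_le_mono mult_strict_left_mono mult_left_mono) auto
      qed
      then show ?thesis unfolding Apq Bpq by (simp add: algebra_simps)
    qed
  qed
qed

end

section \<open>Combination of the bounds for the matrices and for the domain\<close>

lemma matrix_eigenvalue_L:
  assumes c: "0 \<le> c" and d: "0 < d"
  shows "(\<And>x y. x \<noteq> 0 \<or> y \<noteq> 0 \<Longrightarrow> pi\<^sup>2 * ((c\<^sup>2 + d\<^sup>2) * x\<^sup>2 + y\<^sup>2) - 16 * c * x * y < T * d\<^sup>2 * (x\<^sup>2 + y\<^sup>2))
      \<Longrightarrow> matrix_eigenvalue (L_mat c d \<oplus>\<^sub>m M_mat c d) 2 < T"
    and "(\<And>x y. x \<noteq> 0 \<or> y \<noteq> 0 \<Longrightarrow> pi\<^sup>2 * ((c\<^sup>2 + d\<^sup>2) * x\<^sup>2 + y\<^sup>2) - 16 * c * x * y \<le> T * d\<^sup>2 * (x\<^sup>2 + y\<^sup>2))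
      \<Longrightarrow> matrix_eigenvalue (L_mat c d \<oplus>\<^sub>m M_mat c d) 2 \<le> T"
proof -
  let ?v = "vec4 1 0 0 0" and ?w = "vec4 0 1 0 0"
  have lin: "a *\<^sub>R ?v + b *\<^sub>R ?w = vec4 a b 0 0" for a b by (simp add: vec4_lin)
  have ne: "a *\<^sub>R ?v + b *\<^sub>R ?w \<noteq> 0" if "a \<noteq> 0 \<or> b \<noteq> 0" for a b
  proof
    assume "a *\<^sub>R ?v + b *\<^sub>R ?w = 0"
    then have "vec4 a b 0 0 \<bullet> vec4 a b 0 0 = 0" unfolding lin by simp
    then show False using that by (simp add: vec4_inner sum_squares_eq_zero_iff)
  qed
  note bound = second_matrix_eigenvalue_bound[OF block_symmetric block_psd[OF c d] ne, where T = T, unfolded lin block_form[OF d] vec4_inner]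
  show "matrix_eigenvalue (L_mat c d \<oplus>\<^sub>m M_mat c d) 2 < T"
    if "\<And>x y. x \<noteq> 0 \<or> y \<noteq> 0 \<Longrightarrow> pi\<^sup>2 * ((c\<^sup>2 + d\<^sup>2) * x\<^sup>2 + y\<^sup>2) - 16 * c * x * y < T * d\<^sup>2 * (x\<^sup>2 + y\<^sup>2)"
    by (rule bound(1)) (use that d in \<open>auto simp: pos_divide_less_eq power2_eq_square mult_ac\<close>)
  show "matrix_eigenvalue (L_mat c d \<oplus>\<^sub>m M_mat c d) 2 \<le> T"
    if "\<And>x y. x \<noteq> 0 \<or> y \<noteq> 0 \<Longrightarrow> pi\<^sup>2 * ((c\<^sup>2 + d\<^sup>2) * x\<^sup>2 + y\<^sup>2) - 16 * c * x * y \<le> T * d\<^sup>2 * (x\<^sup>2 + y\<^sup>2)"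
    by (rule bound(2)) (use that d in \<open>auto simp: pos_divide_le_eq power2_eq_square mult_ac\<close>)
qed

text \<open>The plane is spanned by the first unit vector of the L block and a vector of the M
  block. The blocks do not couple, so it is enough that each of the two quotients is below
  \<open>T\<close>.\<close>

lemma matrix_eigenvalue_M:
  assumes c: "0 \<le> c" and d: "0 < d" and L11: "pi\<^sup>2 * (c\<^sup>2 + d\<^sup>2) < T * d\<^sup>2" and xy: "x \<noteq> 0 \<or> y \<noteq> 0"
    and M: "pi\<^sup>2 * ((1 + (c\<^sup>2 + d\<^sup>2)) * x\<^sup>2 + 4 * (c\<^sup>2 + d\<^sup>2) * y\<^sup>2) - 64 * sqrt 2 / 3 * c * x * y < T * d\<^sup>2 * (x\<^sup>2 + y\<^sup>2)"
  shows "matrix_eigenvalue (L_mat c d \<oplus>\<^sub>m M_mat c d) 2 < T"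
proof -
  let ?v = "vec4 1 0 0 0" and ?w = "vec4 0 0 x y"
  have lin: "a *\<^sub>R ?v + b *\<^sub>R ?w = vec4 a 0 (b * x) (b * y)" for a b by (simp add: vec4_lin)
  have ne: "a *\<^sub>R ?v + b *\<^sub>R ?w \<noteq> 0" if "a \<noteq> 0 \<or> b \<noteq> 0" for a b
  proof
    assume "a *\<^sub>R ?v + b *\<^sub>R ?w = 0"
    then have "vec4 a 0 (b * x) (b * y) \<bullet> vec4 a 0 (b * x) (b * y) = 0" unfolding lin by simp
    then have "a\<^sup>2 + ((b * x)\<^sup>2 + (b * y)\<^sup>2) = 0" by (simp add: vec4_inner power2_eq_square)
    then have "a\<^sup>2 = 0" "(b * x)\<^sup>2 + (b * y)\<^sup>2 = 0"
      using add_nonneg_eq_0_iff[of "a\<^sup>2" "(b * x)\<^sup>2 + (b * y)\<^sup>2"] by auto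
    then show False using that xy by (auto simp: sum_power2_eq_zero_iff)
  qed
  define P where "P = pi\<^sup>2 * ((1 + (c\<^sup>2 + d\<^sup>2)) * x\<^sup>2 + 4 * (c\<^sup>2 + d\<^sup>2) * y\<^sup>2) - 64 * sqrt 2 / 3 * c * x * y"
  show ?thesis
  proof (rule second_matrix_eigenvalue_bound(1)[OF block_symmetric block_psd[OF c d] ne, where T = T])
    fix a b :: real assume ab: "a \<noteq> 0 \<or> b \<noteq> 0"
    have form: "((L_mat c d \<oplus>\<^sub>m M_mat c d) *v (a *\<^sub>R ?v + b *\<^sub>R ?w)) \<bullet> (a *\<^sub>R ?v + b *\<^sub>R ?w) = (a\<^sup>2 * (pi\<^sup>2 * (c\<^sup>2 + d\<^sup>2)) + b\<^sup>2 * P) / d\<^sup>2"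
      unfolding lin block_form[OF d] P_def by (simp add: power_mult_distrib power2_eq_square[of b] algebra_simps)
    have inner: "(a *\<^sub>R ?v + b *\<^sub>R ?w) \<bullet> (a *\<^sub>R ?v + b *\<^sub>R ?w) = a\<^sup>2 + b\<^sup>2 * (x\<^sup>2 + y\<^sup>2)"
      unfolding lin vec4_inner by (simp add: power2_eq_square algebra_simps)
    have "a\<^sup>2 * (pi\<^sup>2 * (c\<^sup>2 + d\<^sup>2)) + b\<^sup>2 * P < a\<^sup>2 * (T * d\<^sup>2) + b\<^sup>2 * (T * d\<^sup>2 * (x\<^sup>2 + y\<^sup>2))"
    proof (cases "a = 0")
      case True
      then show ?thesis using ab M by (simp add: P_def)
    next
      case False
      then show ?thesis using L11 M
        by (intro add_less_le_mono mult_strict_left_mono mult_left_mono) (auto simp: P_def)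
    qed
    then have "(a\<^sup>2 * (pi\<^sup>2 * (c\<^sup>2 + d\<^sup>2)) + b\<^sup>2 * P) / d\<^sup>2 < T * (a\<^sup>2 + b\<^sup>2 * (x\<^sup>2 + y\<^sup>2))"
      using d by (simp add: pos_divide_less_eq algebra_simps)
    then show "((L_mat c d \<oplus>\<^sub>m M_mat c d) *v (a *\<^sub>R ?v + b *\<^sub>R ?w)) \<bullet> (a *\<^sub>R ?v + b *\<^sub>R ?w)
        < T * ((a *\<^sub>R ?v + b *\<^sub>R ?w) \<bullet> (a *\<^sub>R ?v + b *\<^sub>R ?w))"
      unfolding form inner .
  qed
qed

text \<open>The same vectors or the same constant 64 serve both inequalities, so each region of
  parameters settles the matrix side and the Neumann eigenvalue together.\<close>

lemma strict_bounds:
  fixes c d :: real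
  assumes c: "0 \<le> c" and d: "0 < d" and le: "c\<^sup>2 + d\<^sup>2 \<le> 1" and ne: "(c, d) \<noteq> (0, 1 / 2)"
  defines "T \<equiv> 9 * pi\<^sup>2 / (1 + sqrt (c\<^sup>2 + d\<^sup>2))\<^sup>2"
  shows "min (matrix_eigenvalue (L_mat c d \<oplus>\<^sub>m M_mat c d) 2) ((2 * j01 + pi)\<^sup>2 / ((1 + c)\<^sup>2 + d\<^sup>2)) < T
    \<and> neumann_eigenvalue (parallelogram c d) 3 < T"
proof -
  interpret parallelogram_domain c d using d by unfold_locales
  define r where "r = sqrt (c\<^sup>2 + d\<^sup>2)"
  have r: "r\<^sup>2 = c\<^sup>2 + d\<^sup>2" "0 < r" "c \<le> r" using c d by (auto simp: r_def add_nonneg_pos real_le_rsqrt)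
  have T0: "0 < T" using r(2) by (simp add: T_def r_def[symmetric])
  show ?thesis
  proof (cases "5 * c\<^sup>2 \<le> c\<^sup>2 + d\<^sup>2")
    case True
    note tr = trial_regions[OF c d le ne True, folded T_def, unfolded r(1)[unfolded r_def]]
    from tr(2) show ?thesis
    proof
      assume L: "\<forall>x y. x \<noteq> 0 \<or> y \<noteq> 0 \<longrightarrow> pi\<^sup>2 * ((c\<^sup>2 + d\<^sup>2) * x\<^sup>2 + y\<^sup>2) - 16 * c * x * y < T * d\<^sup>2 * (x\<^sup>2 + y\<^sup>2)"
      have "matrix_eigenvalue (L_mat c d \<oplus>\<^sub>m M_mat c d) 2 < T"
        by (rule matrix_eigenvalue_L(1)[OF c d]) (use L in blast)
      moreover have "neumann_eigenvalue (parallelogram c d) 3 < T"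
        by (rule third_eigenvalue_L(1)[OF T0]) (use L in blast)
      ultimately show ?thesis by simp
    next
      assume "\<exists>x y. (x \<noteq> 0 \<or> y \<noteq> 0) \<and>
         pi\<^sup>2 * ((1 + (c\<^sup>2 + d\<^sup>2)) * x\<^sup>2 + 4 * (c\<^sup>2 + d\<^sup>2) * y\<^sup>2) - 64 * sqrt 2 / 3 * c * x * y < T * d\<^sup>2 * (x\<^sup>2 + y\<^sup>2)"
      then obtain x y where xy: "x \<noteq> 0 \<or> y \<noteq> 0"
        "pi\<^sup>2 * ((1 + (c\<^sup>2 + d\<^sup>2)) * x\<^sup>2 + 4 * (c\<^sup>2 + d\<^sup>2) * y\<^sup>2) - 64 * sqrt 2 / 3 * c * x * y < T * d\<^sup>2 * (x\<^sup>2 + y\<^sup>2)"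
        by blast
      show ?thesis
        using matrix_eigenvalue_M[OF c d tr(1) xy] third_eigenvalue_M[OF T0 tr(1) xy] by simp
    qed
  next
    case False
    have "64 * (1 + r)\<^sup>2 < 9 * pi\<^sup>2 * (1 + 2 * c + r\<^sup>2)"
      by (rule kroeger_region[OF c r(3,2)]) (use False r(1) in simp)
    also have "1 + 2 * c + r\<^sup>2 = (1 + c)\<^sup>2 + d\<^sup>2" unfolding r(1) by (simp add: power2_sum)
    finally have less: "64 < T * ((1 + c)\<^sup>2 + d\<^sup>2)"
      using r(2) by (simp add: T_def r_def[symmetric] pos_less_divide_eq mult_ac)
    have D: "0 < (1 + c)\<^sup>2 + d\<^sup>2" using d by (simp add: add_nonneg_pos)
    have "(2 * j01 + pi)\<^sup>2 / ((1 + c)\<^sup>2 + d\<^sup>2) < T"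
      using kroeger_constant less D by (simp add: pos_divide_less_eq)
    then show ?thesis using third_eigenvalue_diagonal[OF c le less] by simp
  qed
qed

text \<open>At this point L is diagonal with entries pi^2 and 4 pi^2, and the latter equals the
  threshold; the L alternative holds with equality allowed.\<close>

lemma degenerate_bounds:
  "matrix_eigenvalue (L_mat 0 (1 / 2) \<oplus>\<^sub>m M_mat 0 (1 / 2)) 2 \<le> 4 * pi\<^sup>2"
  "neumann_eigenvalue (parallelogram 0 (1 / 2)) 3 \<le> 4 * pi\<^sup>2"
proof -
  interpret parallelogram_domain 0 "1 / 2" by unfold_locales simp
  have le: "pi\<^sup>2 * ((0\<^sup>2 + (1 / 2)\<^sup>2) * x\<^sup>2 + y\<^sup>2) - 16 * 0 * x * y \<le> 4 * pi\<^sup>2 * (1 / 2)\<^sup>2 * (x\<^sup>2 + y\<^sup>2)" for x y :: real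
  proof -
    have "(0\<^sup>2 + (1 / 2)\<^sup>2) * x\<^sup>2 + y\<^sup>2 \<le> x\<^sup>2 + y\<^sup>2" by (simp add: power2_eq_square[of "1 / 2"])
    from mult_left_mono[OF this, of "pi\<^sup>2"] show ?thesis by (simp add: power2_eq_square[of "1 / 2"])
  qed
  show "matrix_eigenvalue (L_mat 0 (1 / 2) \<oplus>\<^sub>m M_mat 0 (1 / 2)) 2 \<le> 4 * pi\<^sup>2"
    by (rule matrix_eigenvalue_L(2)) (use le in auto)
  show "neumann_eigenvalue (parallelogram 0 (1 / 2)) 3 \<le> 4 * pi\<^sup>2"
    by (rule third_eigenvalue_L(2)) (use le in auto)
qed

theorem theorem4p3:
  fixes c d :: real
  assumes "c \<ge> 0" and "d > 0" and "c\<^sup>2 + d\<^sup>2 \<le> 1"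
  shows "min (matrix_eigenvalue (L_mat c d \<oplus>\<^sub>m M_mat c d) 2)
             ((2 * j01 + pi)\<^sup>2 / ((1 + c)\<^sup>2 + d\<^sup>2))
           \<le> 9 * pi\<^sup>2 / (1 + sqrt (c\<^sup>2 + d\<^sup>2))\<^sup>2
       \<and> (perimeter c d)\<^sup>2 * neumann_eigenvalue (parallelogram c d) 3 \<le> 36 * pi\<^sup>2
       \<and> ((c, d) \<noteq> (0, 1 / 2) \<longrightarrow>
             min (matrix_eigenvalue (L_mat c d \<oplus>\<^sub>m M_mat c d) 2)
                 ((2 * j01 + pi)\<^sup>2 / ((1 + c)\<^sup>2 + d\<^sup>2))
               < 9 * pi\<^sup>2 / (1 + sqrt (c\<^sup>2 + d\<^sup>2))\<^sup>2
           \<and> (perimeter c d)\<^sup>2 * neumann_eigenvalue (parallelogram c d) 3 < 36 * pi\<^sup>2)"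
proof (cases "(c, d) = (0, 1 / 2)")
  case True
  then have c: "c = 0" and d: "d = 1 / 2" by auto
  have s: "sqrt (0\<^sup>2 + (1 / 2)\<^sup>2) = (1 / 2 :: real)" by simp
  have "9 * pi\<^sup>2 / (1 + 1 / 2)\<^sup>2 = 4 * pi\<^sup>2" by (simp add: power2_eq_square)
  moreover have "(2 * (1 + 1 / 2 :: real))\<^sup>2 = 9" by (simp add: power2_eq_square)
  ultimately show ?thesis
    using degenerate_bounds unfolding c d perimeter_eq s by (simp add: min.coboundedI1)
next
  case False
  define r where "r = sqrt (c\<^sup>2 + d\<^sup>2)"
  have r: "0 \<le> r" using assms by (simp add: r_def)
  have p: "(perimeter c d)\<^sup>2 = 4 * (1 + r)\<^sup>2" unfolding perimeter_eq r_def power_mult_distrib by simp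
  note strict = strict_bounds[OF assms False, folded r_def]
  then have "(perimeter c d)\<^sup>2 * neumann_eigenvalue (parallelogram c d) 3 < (perimeter c d)\<^sup>2 * (9 * pi\<^sup>2 / (1 + r)\<^sup>2)"
    unfolding p using r by (intro mult_strict_left_mono) auto
  also have "\<dots> = 36 * pi\<^sup>2" unfolding p using r by simp
  finally show ?thesis using strict unfolding r_def by auto
qed

end
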